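(* Let $\alpha>0$. Then: (i) The space $H_2^{(\alpha)}(\mathbb{C}^+)$ is a reproducing kernel Hilbert space with reproducing kernel $$K_\alpha(z,w)=\int_0^1\int_0^1\frac{(1-x)^{\alpha-1}}{\Gamma(\alpha)}\,\frac{(1-y)^{\alpha-1}}{\Gamma(\alpha)}\,\frac{1}{xz+y\overline{w}}\,dx\,dy,\qquad z,w\in\mathbb{C}^+.$$ (ii) The Laplace transform $\mathcal{L}$ is an isometric isomorphism from $\mathcal{T}_2^{(\alpha)}(t^\alpha)$ onto $H_2^{(\alpha)}(\mathbb{C}^+)$.
   Context: Notation: $\mathbb{R}^+=(0,\infty)$, $\mathbb{C}^+=\{z\in\mathbb{C}:\Re z>0\}$, and $\mathcal{L}f(z)=\int_0^\infty f(t)e^{-zt}\,dt$ for $z\in\mathbb{C}^+$. The real space. For $\alpha>0$ let $\mathcal{C}_\alpha^*\colon L_2(\mathbb{R}^+)\to L_2(\mathbb{R}^+)$ be the bounded injective operator $\mathcal{C}_\alpha^*f(s)=\alpha\int_s^\infty\frac{(u-s)^{\alpha-1}}{u^\alpha}f(u)\,du$, $s>0$. Put $\mathcal{T}_2^{(\alpha)}(t^\alpha):=\mathcal{C}_\alpha^*(L_2(\mathbb{R}^+))$ with norm $\|f\|_{2,(\alpha)}:=\Gamma(\alpha+1)\|(\mathcal{C}_\alpha^* )^{-1}f\|_{L_2(\mathbb{R}^+)}$; it is a Hilbert space. The complex space. $H_2(\mathbb{C}^+)$ is the Hardy space of holomorphic functions $F$ on $\mathbb{C}^+$ with $\|F\|_2:=\sup_{x>0}\left(\frac{1}{2\pi}\int_{-\infty}^\infty|F(x+iy)|^2dy\right)^{1/2}<\infty$.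 For $t\in\mathbb{R}$ let $T_2(t)F(z)=e^{-t/2}F(e^{-t}z)$, which defines a strongly continuous group of isometries on $H_2(\mathbb{C}^+)$. For $\alpha>0$ let $\mathfrak{C}_\alpha^*F:=\int_0^\infty\alpha(1-e^{-t})^{\alpha-1}e^{-t/2}\,T_2(-t)F\,dt$ (Bochner integral), a bounded injective operator on $H_2(\mathbb{C}^+)$. Put $H_2^{(\alpha)}(\mathbb{C}^+):=\mathfrak{C}_\alpha^*(H_2(\mathbb{C}^+))$ with norm $\|F\|_{2,(\alpha)}:=\Gamma(\alpha+1)\|(\mathfrak{C}_\alpha^* )^{-1}F\|_2$; it is a Hilbert space (inner product transported from $H_2(\mathbb{C}^+)$). A reproducing kernel $K$ of a Hilbert space $H$ of functions on $\mathbb{C}^+$ means: $K(\cdot,w)\in H$ and $F(w)=(F\,|\,K(\cdot,w))_H$ for all $F\in H$, $w\in\mathbb{C}^+$. *)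

theory Defs
  imports "HOL-Complex_Analysis.Complex_Analysis"
begin

section \<open>Function spaces with explicit carriers\<close>

text \<open>
  A function on a set \<open>X\<close> is encoded as a total function that vanishes outside \<open>X\<close>, so that two
  elements of a space of functions on \<open>X\<close> are equal iff they agree on \<open>X\<close>.
\<close>

definition zero_ext :: "'a set \<Rightarrow> ('a \<Rightarrow> complex) \<Rightarrow> 'a \<Rightarrow> complex" where
  "zero_ext X F = (\<lambda>z. if z \<in> X then F z else 0)"

text \<open>Inner products are linear in the first and conjugate-linear in the second argument.\<close>

definition hilbert_function_space ::
  "'a set \<Rightarrow> ('a \<Rightarrow> complex) set \<Rightarrow> (('a \<Rightarrow> complex) \<Rightarrow> real)
    \<Rightarrow> (('a \<Rightarrow> complex) \<Rightarrow> ('a \<Rightarrow> complex) \<Rightarrow> complex) \<Rightarrow> bool" where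
  "hilbert_function_space X H N ip \<longleftrightarrow>
     (\<forall>F\<in>H. \<forall>z. z \<notin> X \<longrightarrow> F z = 0) \<and>
     (\<lambda>_. 0) \<in> H \<and>
     (\<forall>F\<in>H. \<forall>G\<in>H. \<forall>a b. (\<lambda>z. a * F z + b * G z) \<in> H) \<and>
     (\<forall>F\<in>H. \<forall>G\<in>H. \<forall>L\<in>H. \<forall>a b. ip (\<lambda>z. a * F z + b * G z) L = a * ip F L + b * ip G L) \<and>
     (\<forall>F\<in>H. \<forall>G\<in>H. ip G F = cnj (ip F G)) \<and>
     (\<forall>F\<in>H. 0 \<le> N F \<and> ip F F = complex_of_real ((N F)\<^sup>2)) \<and>
     (\<forall>F\<in>H. N F = 0 \<longrightarrow> F = (\<lambda>_. 0)) \<and>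
     (\<forall>Q :: nat \<Rightarrow> 'a \<Rightarrow> complex.
        (\<forall>n. Q n \<in> H) \<and>
        (\<forall>e>0. \<exists>n0. \<forall>m\<ge>n0. \<forall>n\<ge>n0. N (\<lambda>z. Q m z - Q n z) < e) \<longrightarrow>
        (\<exists>F\<in>H. (\<lambda>n. N (\<lambda>z. Q n z - F z)) \<longlonglongrightarrow> 0))"

definition reproducing_kernel ::
  "'a set \<Rightarrow> ('a \<Rightarrow> complex) set \<Rightarrow> (('a \<Rightarrow> complex) \<Rightarrow> ('a \<Rightarrow> complex) \<Rightarrow> complex)
    \<Rightarrow> ('a \<Rightarrow> 'a \<Rightarrow> complex) \<Rightarrow> bool" where
  "reproducing_kernel X H ip K \<longleftrightarrow>
     (\<forall>w\<in>X. zero_ext X (\<lambda>z. K z w) \<in> H \<and> (\<forall>F\<in>H. F w = ip F (zero_ext X (\<lambda>z. K z w))))"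

text \<open>
  \<open>V\<close> consists of representatives of the elements of a normed space, identified along \<open>E\<close>;
  \<open>W\<close> is a normed space of functions.  The first conjunct says that \<open>\<Phi>\<close> is well defined on
  classes, the fourth that it is injective on classes.
\<close>

definition isometric_isomorphism ::
  "('a \<Rightarrow> complex) set \<Rightarrow> (('a \<Rightarrow> complex) \<Rightarrow> ('a \<Rightarrow> complex) \<Rightarrow> bool) \<Rightarrow> (('a \<Rightarrow> complex) \<Rightarrow> real)
    \<Rightarrow> ('b \<Rightarrow> complex) set \<Rightarrow> (('b \<Rightarrow> complex) \<Rightarrow> real)
    \<Rightarrow> (('a \<Rightarrow> complex) \<Rightarrow> ('b \<Rightarrow> complex)) \<Rightarrow> bool" where
  "isometric_isomorphism V E NV W NW \<Phi> \<longleftrightarrow>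
     (\<forall>f\<in>V. \<forall>g\<in>V. E f g \<longrightarrow> \<Phi> f = \<Phi> g) \<and>
     (\<forall>f\<in>V. \<forall>g\<in>V. \<forall>a b. (\<lambda>t. a * f t + b * g t) \<in> V \<and>
        \<Phi> (\<lambda>t. a * f t + b * g t) = (\<lambda>z. a * \<Phi> f z + b * \<Phi> g z)) \<and>
     (\<forall>f\<in>V. NW (\<Phi> f) = NV f) \<and>
     (\<forall>f\<in>V. \<forall>g\<in>V. \<Phi> f = \<Phi> g \<longrightarrow> E f g) \<and>
     \<Phi> ` V = W"


section \<open>Bochner integrals in a space of functions\<close>

text \<open>
  The library's Bochner integral is tied to a Banach space type.  The following is the same
  definition for values in a set \<open>H\<close> of functions with norm \<open>N\<close>.
\<close>

definition simple_bochner_integrable_in ::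
  "'t measure \<Rightarrow> ('a \<Rightarrow> complex) set \<Rightarrow> ('t \<Rightarrow> 'a \<Rightarrow> complex) \<Rightarrow> bool" where
  "simple_bochner_integrable_in M H s \<longleftrightarrow>
     simple_function M s \<and> s ` space M \<subseteq> H \<and> emeasure M {t \<in> space M. s t \<noteq> (\<lambda>_. 0)} \<noteq> \<infinity>"

definition simple_bochner_integral_in ::
  "'t measure \<Rightarrow> ('t \<Rightarrow> 'a \<Rightarrow> complex) \<Rightarrow> 'a \<Rightarrow> complex" where
  "simple_bochner_integral_in M s =
     (\<lambda>z. \<Sum>y\<in>s ` space M. measure M {t \<in> space M. s t = y} *\<^sub>R y z)"

text \<open>
  The measurability of \<open>N (\<phi> - s n)\<close> together with the convergence of its integrals to \<open>0\<close>
  yields an a.e. convergent subsequence of \<open>s\<close>; hence \<open>\<phi>\<close> is strongly measurable.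
\<close>

definition has_bochner_integral_in ::
  "'t measure \<Rightarrow> ('a \<Rightarrow> complex) set \<Rightarrow> (('a \<Rightarrow> complex) \<Rightarrow> real)
    \<Rightarrow> ('t \<Rightarrow> 'a \<Rightarrow> complex) \<Rightarrow> ('a \<Rightarrow> complex) \<Rightarrow> bool" where
  "has_bochner_integral_in M H N \<phi> G \<longleftrightarrow>
     (\<forall>t\<in>space M. \<phi> t \<in> H) \<and> G \<in> H \<and>
     (\<exists>s :: nat \<Rightarrow> 't \<Rightarrow> 'a \<Rightarrow> complex.
        (\<forall>n. simple_bochner_integrable_in M H (s n)) \<and>
        (\<forall>n. (\<lambda>t. N (\<lambda>z. \<phi> t z - s n t z)) \<in> borel_measurable M) \<and>
        (\<lambda>n. \<integral>\<^sup>+ t. ennreal (N (\<lambda>z. \<phi> t z - s n t z)) \<partial>M) \<longlonglongrightarrow> 0 \<and>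
        (\<lambda>n. N (\<lambda>z. simple_bochner_integral_in M (s n) z - G z)) \<longlonglongrightarrow> 0)"

definition bochner_integral_in ::
  "'t measure \<Rightarrow> ('a \<Rightarrow> complex) set \<Rightarrow> (('a \<Rightarrow> complex) \<Rightarrow> real)
    \<Rightarrow> ('t \<Rightarrow> 'a \<Rightarrow> complex) \<Rightarrow> 'a \<Rightarrow> complex" where
  "bochner_integral_in M H N \<phi> = (THE G. has_bochner_integral_in M H N \<phi> G)"


section \<open>The spaces on the positive half-line\<close>

text \<open>
  Elements of the Lebesgue space are represented by Borel functions, with identification along
  \<open>ae_eq_pos\<close>; values outside the open half-line are irrelevant.
\<close>

definition L2_pos :: "(real \<Rightarrow> complex) set" where
  "L2_pos = {f. set_borel_measurable lborel {0<..} f \<and>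
                set_integrable lborel {0<..} (\<lambda>t. (cmod (f t))\<^sup>2)}"

definition L2_pos_norm :: "(real \<Rightarrow> complex) \<Rightarrow> real" where
  "L2_pos_norm f = sqrt (LINT t:{0<..}|lborel. (cmod (f t))\<^sup>2)"

definition ae_eq_pos :: "(real \<Rightarrow> complex) \<Rightarrow> (real \<Rightarrow> complex) \<Rightarrow> bool" where
  "ae_eq_pos f g \<longleftrightarrow> (AE t in lborel. 0 < t \<longrightarrow> f t = g t)"

definition cesaro_star_real :: "real \<Rightarrow> (real \<Rightarrow> complex) \<Rightarrow> real \<Rightarrow> complex" where
  "cesaro_star_real \<alpha> f =
     (\<lambda>s. \<alpha> *\<^sub>R (LINT u:{s<..}|lborel. ((u - s) powr (\<alpha> - 1) / u powr \<alpha>) *\<^sub>R f u))"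

definition T2_space :: "real \<Rightarrow> (real \<Rightarrow> complex) set" where
  "T2_space \<alpha> = {f. set_borel_measurable lborel {0<..} f \<and>
                    (\<exists>g\<in>L2_pos. ae_eq_pos f (cesaro_star_real \<alpha> g))}"

text \<open>By injectivity of the operator, the preimage chosen here is unique up to \<open>ae_eq_pos\<close>.\<close>

definition T2_norm :: "real \<Rightarrow> (real \<Rightarrow> complex) \<Rightarrow> real" where
  "T2_norm \<alpha> f = Gamma (\<alpha> + 1) *
     L2_pos_norm (SOME g. g \<in> L2_pos \<and> ae_eq_pos f (cesaro_star_real \<alpha> g))"


section \<open>The spaces on the right half-plane\<close>

definition right_half_plane :: "complex set" where
  "right_half_plane = {z. 0 < Re z}"

definition hardy_norm :: "(complex \<Rightarrow> complex) \<Rightarrow> real" where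
  "hardy_norm F = (SUP x\<in>{0<..}. sqrt (1 / (2 * pi) * (LINT y|lborel. (cmod (F (Complex x y)))\<^sup>2)))"

definition hardy :: "(complex \<Rightarrow> complex) set" where
  "hardy = {F. F holomorphic_on right_half_plane \<and>
               (\<forall>z. z \<notin> right_half_plane \<longrightarrow> F z = 0) \<and>
               (\<forall>x>0. integrable lborel (\<lambda>y. (cmod (F (Complex x y)))\<^sup>2)) \<and>
               bdd_above ((\<lambda>x. sqrt (1 / (2 * pi) * (LINT y|lborel. (cmod (F (Complex x y)))\<^sup>2))) ` {0<..})}"

text \<open>
  The inner product of the Hardy space is the one that induces its norm; by polarization it is
  \<open>1/4 * (\<Sum>k<4. \<i>^k * \<parallel>F + \<i>^k G\<parallel>\<^sup>2)\<close>.
\<close>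

definition hardy_inner :: "(complex \<Rightarrow> complex) \<Rightarrow> (complex \<Rightarrow> complex) \<Rightarrow> complex" where
  "hardy_inner F G =
     1 / 4 * (\<Sum>k<4. \<i> ^ k * complex_of_real ((hardy_norm (\<lambda>z. F z + \<i> ^ k * G z))\<^sup>2))"

definition dilation :: "real \<Rightarrow> (complex \<Rightarrow> complex) \<Rightarrow> complex \<Rightarrow> complex" where
  "dilation t F = (\<lambda>z. exp (- t / 2) *\<^sub>R F (exp (- t) *\<^sub>R z))"

definition cesaro_star_hardy :: "real \<Rightarrow> (complex \<Rightarrow> complex) \<Rightarrow> complex \<Rightarrow> complex" where
  "cesaro_star_hardy \<alpha> F =
     bochner_integral_in (restrict_space lborel {0<..}) hardy hardy_norm
       (\<lambda>t z. (\<alpha> * (1 - exp (- t)) powr (\<alpha> - 1) * exp (- t / 2)) *\<^sub>R dilation (- t) F z)"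

definition hardy_sobolev :: "real \<Rightarrow> (complex \<Rightarrow> complex) set" where
  "hardy_sobolev \<alpha> = cesaro_star_hardy \<alpha> ` hardy"

definition hardy_sobolev_norm :: "real \<Rightarrow> (complex \<Rightarrow> complex) \<Rightarrow> real" where
  "hardy_sobolev_norm \<alpha> F =
     Gamma (\<alpha> + 1) * hardy_norm (inv_into hardy (cesaro_star_hardy \<alpha>) F)"

definition hardy_sobolev_inner ::
  "real \<Rightarrow> (complex \<Rightarrow> complex) \<Rightarrow> (complex \<Rightarrow> complex) \<Rightarrow> complex" where
  "hardy_sobolev_inner \<alpha> F G =
     complex_of_real ((Gamma (\<alpha> + 1))\<^sup>2) *
       hardy_inner (inv_into hardy (cesaro_star_hardy \<alpha>) F) (inv_into hardy (cesaro_star_hardy \<alpha>) G)"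

definition hardy_sobolev_kernel :: "real \<Rightarrow> complex \<Rightarrow> complex \<Rightarrow> complex" where
  "hardy_sobolev_kernel \<alpha> z w =
     (LBINT x=0..1. (LBINT y=0..1.
        complex_of_real ((1 - x) powr (\<alpha> - 1) / Gamma \<alpha>) *
        complex_of_real ((1 - y) powr (\<alpha> - 1) / Gamma \<alpha>) *
        (1 / (x *\<^sub>R z + y *\<^sub>R cnj w))))"

definition laplace :: "(real \<Rightarrow> complex) \<Rightarrow> complex \<Rightarrow> complex" where
  "laplace f = zero_ext right_half_plane
     (\<lambda>z. LINT t:{0<..}|lborel. f t * exp (- (z * complex_of_real t)))"

end

theory Submission
  imports Defs
begin

text \<open>
  By the Paley--Wiener theorem the Laplace transform is an isometry of \<open>L\<^sub>2\<close> of the half-line onto the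
  Hardy space.  Surjectivity comes from the Riesz representation theorem: Cauchy's formula on vertical
  lines gives \<open>\<bar>\<Sum> c w * F w\<bar> \<le> \<parallel>F\<parallel> * \<parallel>\<Sum> c w * exp (- w t)\<parallel>\<close> for finite sums, so \<open>F\<close> acts on
  combinations of exponentials as an inner product with some square-integrable \<open>f\<close>.

  Under this identification the operator on the Hardy space, built from the dilations at \<open>- t\<close>, is
  conjugate to the adjoint of the operator on the half-line, not to that operator itself.  The
  two operators nevertheless have the same range with the same norm: evaluating the Laplace transform
  of their values at \<open>w\<close> is in both cases an inner product with a vector \<open>avg w\<close>, the two families of
  vectors have the same Gram matrix, namely the kernel \<open>K\<close> up to a constant, and both are total, since
  a vanishing Riemann--Liouville convolution has a vanishing factor.
\<close>

section \<open>Square-integrable functions\<close>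

text \<open>The coincidence of ranges and norms is an instance of normality. With e_w for
  \<open>expfun w\<close>, one family of vectors is C e_w, where C f(s) is the integral of \<alpha>
  (1 - x)^(\<alpha> - 1) f(s x) over 0 < x < 1, and the other is C* e_w. Both operators average the
  same commutative group of dilations, so C commutes with C* and <C e_z, C e_w> = <C* e_z, C* e_w>.
  On exponentials this is a cancellation in the integrands. Equal Gram matrices give contractions in
  both directions, and totality makes them inverse to each other.

  Boundary values on the imaginary axis are avoided: Cauchy's formula is used on lines Re z = x > 0
  at points shifted by x, and x tends to 0 only at the end. Duality against finite combinations of
  exponentials replaces most direct estimates: it yields square-integrability of the averages,
  membership of means in the Hardy space, and the lower bound for the Hardy norm.

  The values of the operator on the half-line are controlled through integrals against exponentials,
  and the uniqueness theorem for the Laplace transform is stated for functions with such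
  integrals.\<close>

definition L2 :: "'t measure \<Rightarrow> ('t \<Rightarrow> complex) set" where
  "L2 M = {f \<in> borel_measurable M. integrable M (\<lambda>t. (cmod (f t))\<^sup>2)}"

definition l2_norm :: "'t measure \<Rightarrow> ('t \<Rightarrow> complex) \<Rightarrow> real" where
  "l2_norm M f = sqrt (LINT t|M. (cmod (f t))\<^sup>2)"

definition l2_inner :: "'t measure \<Rightarrow> ('t \<Rightarrow> complex) \<Rightarrow> ('t \<Rightarrow> complex) \<Rightarrow> complex" where
  "l2_inner M f g = (LINT t|M. f t * cnj (g t))"

lemma borel_measurable_cnj [measurable (raw)]:
  "f \<in> borel_measurable M \<Longrightarrow> (\<lambda>t. cnj (f t)) \<in> borel_measurable M"
  by (rule borel_measurable_continuous_on[where f = cnj]) (auto intro: continuous_intros)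

lemma L2_measurable [measurable_dest]: "f \<in> L2 M \<Longrightarrow> f \<in> borel_measurable M"
  by (simp add: L2_def)

lemma L2_integrable_square: "f \<in> L2 M \<Longrightarrow> integrable M (\<lambda>t. (cmod (f t))\<^sup>2)"
  by (simp add: L2_def)

lemma L2I:
  assumes "f \<in> borel_measurable M" "integrable M (\<lambda>t. (cmod (f t))\<^sup>2)"
  shows "f \<in> L2 M"
  using assms by (simp add: L2_def)

lemma L2_zero [simp]: "(\<lambda>_. 0) \<in> L2 M"
  by (simp add: L2_def)

lemma L2_cnj: "f \<in> L2 M \<Longrightarrow> (\<lambda>t. cnj (f t)) \<in> L2 M"
  by (auto simp: L2_def)

lemma L2_scale: "f \<in> L2 M \<Longrightarrow> (\<lambda>t. c * f t) \<in> L2 M"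
  by (auto simp: L2_def norm_mult power_mult_distrib)

lemma L2_integrable_mult:
  assumes f: "f \<in> L2 M" and g: "g \<in> L2 M"
  shows "integrable M (\<lambda>t. f t * g t)"
proof (rule Bochner_Integration.integrable_bound)
  show "integrable M (\<lambda>t. (cmod (f t))\<^sup>2 + (cmod (g t))\<^sup>2)"
    using f g by (simp add: L2_def)
  show "(\<lambda>t. f t * g t) \<in> borel_measurable M"
    using f g by measurable
  have "2 * (a * b) \<le> a\<^sup>2 + b\<^sup>2" "0 \<le> a * b" if "a \<ge> 0" "b \<ge> 0" for a b :: real
    using that sum_squares_bound[of a b] by auto
  then show "AE t in M. norm (f t * g t) \<le> norm ((cmod (f t))\<^sup>2 + (cmod (g t))\<^sup>2)"
    by (intro AE_I2) (smt (verit) norm_ge_zero norm_mult real_norm_def)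
qed

lemma L2_add:
  assumes f: "f \<in> L2 M" and g: "g \<in> L2 M"
  shows "(\<lambda>t. f t + g t) \<in> L2 M"
proof (rule L2I)
  show "integrable M (\<lambda>t. (cmod (f t + g t))\<^sup>2)"
  proof (rule Bochner_Integration.integrable_bound)
    show "integrable M (\<lambda>t. 2 * (cmod (f t))\<^sup>2 + 2 * (cmod (g t))\<^sup>2)"
      using f g by (simp add: L2_def)
    show "(\<lambda>t. (cmod (f t + g t))\<^sup>2) \<in> borel_measurable M"
      using f g by measurable
    have "(cmod (a + b))\<^sup>2 \<le> 2 * (cmod a)\<^sup>2 + 2 * (cmod b)\<^sup>2" for a b
      using power_mono[OF norm_triangle_ineq[of a b], of 2] sum_squares_bound[of "cmod a" "cmod b"]
      by (auto simp: power2_sum)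
    then show "AE t in M. norm ((cmod (f t + g t))\<^sup>2) \<le> norm (2 * (cmod (f t))\<^sup>2 + 2 * (cmod (g t))\<^sup>2)"
      by auto
  qed
qed (use f g in measurable)

lemma L2_lincomb:
  "f \<in> L2 M \<Longrightarrow> g \<in> L2 M \<Longrightarrow> (\<lambda>t. a * f t + b * g t) \<in> L2 M"
  by (intro L2_add L2_scale)

lemma L2_diff: "f \<in> L2 M \<Longrightarrow> g \<in> L2 M \<Longrightarrow> (\<lambda>t. f t - g t) \<in> L2 M"
  using L2_lincomb[of f M g 1 "-1"] by simp

lemma L2_sum: "(\<And>i. i \<in> I \<Longrightarrow> f i \<in> L2 M) \<Longrightarrow> (\<lambda>t. \<Sum>i\<in>I. c i * f i t) \<in> L2 M"
  by (induction I rule: infinite_finite_induct) (auto intro!: L2_add L2_scale)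

lemma L2_cong_AE:
  assumes "f \<in> L2 M" "g \<in> borel_measurable M" "AE t in M. f t = g t"
  shows "g \<in> L2 M"
proof (rule L2I)
  have "integrable M (\<lambda>t. (cmod (f t))\<^sup>2) \<longleftrightarrow> integrable M (\<lambda>t. (cmod (g t))\<^sup>2)"
    using assms by (intro integrable_cong_AE) (auto simp: L2_def elim: AE_mp)
  then show "integrable M (\<lambda>t. (cmod (g t))\<^sup>2)"
    using assms by (simp add: L2_def)
qed fact

lemma l2_norm_nonneg [simp]: "0 \<le> l2_norm M f"
  by (simp add: l2_norm_def)

lemma l2_norm_sq: "(l2_norm M f)\<^sup>2 = (LINT t|M. (cmod (f t))\<^sup>2)"
  by (simp add: l2_norm_def)

lemma l2_inner_self: "l2_inner M f f = complex_of_real ((l2_norm M f)\<^sup>2)"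
  by (simp add: l2_inner_def l2_norm_sq complex_norm_square[symmetric] del: of_real_power)

lemma l2_inner_cnj: "l2_inner M g f = cnj (l2_inner M f g)"
proof -
  have "cnj (l2_inner M f g) = (LINT t|M. cnj (f t * cnj (g t)))"
    unfolding l2_inner_def by (rule Bochner_Integration.integral_cnj[symmetric])
  then show ?thesis
    by (simp add: l2_inner_def mult.commute)
qed

lemma l2_inner_add_left:
  assumes "f \<in> L2 M" "g \<in> L2 M" "h \<in> L2 M"
  shows "l2_inner M (\<lambda>t. f t + g t) h = l2_inner M f h + l2_inner M g h"
  using assms unfolding l2_inner_def
  by (simp add: distrib_right L2_integrable_mult L2_cnj)

lemma l2_inner_scale_left: "l2_inner M (\<lambda>t. c * f t) h = c * l2_inner M f h"
  by (simp add: l2_inner_def mult.assoc)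

lemma l2_inner_scale_right: "l2_inner M h (\<lambda>t. c * f t) = cnj c * l2_inner M h f"
  by (subst (1 2) l2_inner_cnj) (simp add: l2_inner_scale_left)

lemma l2_inner_lincomb_left:
  assumes "f \<in> L2 M" "g \<in> L2 M" "h \<in> L2 M"
  shows "l2_inner M (\<lambda>t. a * f t + b * g t) h = a * l2_inner M f h + b * l2_inner M g h"
  using assms by (simp add: l2_inner_add_left l2_inner_scale_left L2_scale)

lemma l2_inner_sum_left:
  assumes "\<And>i. i \<in> I \<Longrightarrow> f i \<in> L2 M" "h \<in> L2 M"
  shows "l2_inner M (\<lambda>t. \<Sum>i\<in>I. c i * f i t) h = (\<Sum>i\<in>I. c i * l2_inner M (f i) h)"
  using assms
proof (induction I rule: infinite_finite_induct)
  case (insert i I)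
  then show ?case
    by (simp add: l2_inner_add_left l2_inner_scale_left L2_sum L2_scale)
qed (simp_all add: l2_inner_def)

lemma l2_inner_sum_right:
  assumes "\<And>i. i \<in> I \<Longrightarrow> f i \<in> L2 M" "h \<in> L2 M"
  shows "l2_inner M h (\<lambda>t. \<Sum>i\<in>I. c i * f i t) = (\<Sum>i\<in>I. cnj (c i) * l2_inner M h (f i))"
  using l2_inner_sum_left[OF assms, where c = c]
  by (subst (1 2) l2_inner_cnj) simp

lemma l2_norm_scale: "l2_norm M (\<lambda>t. c * f t) = cmod c * l2_norm M f"
  by (simp add: l2_norm_def norm_mult power_mult_distrib real_sqrt_mult)

lemma l2_norm_cnj: "l2_norm M (\<lambda>t. cnj (f t)) = l2_norm M f"
  by (simp add: l2_norm_def)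

lemma l2_norm_zero [simp]: "l2_norm M (\<lambda>_. 0) = 0"
  by (simp add: l2_norm_def)

lemma l2_norm_minus_commute: "l2_norm M (\<lambda>t. f t - g t) = l2_norm M (\<lambda>t. g t - f t)"
  by (simp add: l2_norm_def norm_minus_commute)

lemma l2_norm_add_sq:
  assumes "f \<in> L2 M" "g \<in> L2 M"
  shows "(l2_norm M (\<lambda>t. f t + g t))\<^sup>2 = (l2_norm M f)\<^sup>2 + (l2_norm M g)\<^sup>2 + 2 * Re (l2_inner M f g)"
proof -
  define h where "h t = f t * cnj (g t)" for t
  have "(cmod (f t + g t))\<^sup>2 = (cmod (f t))\<^sup>2 + (cmod (g t))\<^sup>2 + 2 * Re (h t)" for t
    unfolding cmod_power2 by (simp add: h_def power2_eq_square algebra_simps)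
  moreover have "integrable M h"
    unfolding h_def using assms by (intro L2_integrable_mult L2_cnj)
  ultimately show ?thesis
    using assms by (simp add: l2_norm_sq l2_inner_def L2_integrable_square flip: h_def)
qed

lemma l2_cauchy_schwarz:
  assumes f: "f \<in> L2 M" and g: "g \<in> L2 M"
  shows "cmod (l2_inner M f g) \<le> l2_norm M f * l2_norm M g"
proof -
  define z where "z = l2_inner M f g"
  have quad: "0 \<le> (l2_norm M f)\<^sup>2 + s\<^sup>2 * ((cmod z)\<^sup>2 * (l2_norm M g)\<^sup>2) - 2 * s * (cmod z)\<^sup>2" for s :: real
  proof -
    \<comment> \<open>Multiplying by z itself aligns the phase: the cross term becomes real and the
      squared norm of f + c * g a quadratic polynomial in s.\<close>
    define c where "c = - s * z"
    have "l2_inner M f (\<lambda>t. c * g t) = cnj c * z"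
      by (simp add: l2_inner_scale_right z_def)
    moreover have "Re (cnj c * z) = - s * (cmod z)\<^sup>2"
      unfolding cmod_power2 by (simp add: c_def power2_eq_square algebra_simps)
    moreover have "0 \<le> (l2_norm M (\<lambda>t. f t + c * g t))\<^sup>2"
      by simp
    moreover have "(l2_norm M (\<lambda>t. c * g t))\<^sup>2 = s\<^sup>2 * ((cmod z)\<^sup>2 * (l2_norm M g)\<^sup>2)"
      unfolding l2_norm_scale by (simp add: c_def norm_mult power_mult_distrib)
    ultimately show ?thesis
      using l2_norm_add_sq[OF f L2_scale[OF g, of c]] by simp
  qed
  have "(cmod z)\<^sup>2 \<le> (l2_norm M f)\<^sup>2 * (l2_norm M g)\<^sup>2"
  proof (cases "z = 0")
    case False
    then have z: "(cmod z)\<^sup>2 > 0" by simp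
    define A B where "A = (l2_norm M f)\<^sup>2" and "B = (l2_norm M g)\<^sup>2"
    have q: "0 \<le> A + s\<^sup>2 * ((cmod z)\<^sup>2 * B) - 2 * s * (cmod z)\<^sup>2" for s
      using quad[of s] by (simp add: A_def B_def)
    show ?thesis
    proof (cases "B = 0")
      case True
      \<comment> \<open>The polynomial is affine in s; at the chosen s it equals - A - 2, which is
        negative.\<close>
      then show ?thesis
        using q[of "(A + 1) / (cmod z)\<^sup>2"] z zero_le_power2[of "l2_norm M f"] by (simp add: A_def[symmetric] B_def[symmetric] split: if_splits)
    next
      case False
      then have "B > 0" by (simp add: B_def)
      \<comment> \<open>The minimum of the quadratic polynomial is at s = 1 / B.\<close>
      then have "(cmod z)\<^sup>2 \<le> A * B"
        using q[of "1 / B"] z by (simp add: field_simps power2_eq_square)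
      then show ?thesis
        by (simp add: A_def B_def)
    qed
  qed simp
  then show ?thesis
    using power2_le_imp_le[of "cmod z" "l2_norm M f * l2_norm M g"]
    by (simp add: z_def power_mult_distrib)
qed

lemma l2_norm_triangle:
  assumes f: "f \<in> L2 M" and g: "g \<in> L2 M"
  shows "l2_norm M (\<lambda>t. f t + g t) \<le> l2_norm M f + l2_norm M g"
proof (rule power2_le_imp_le)
  have "Re (l2_inner M f g) \<le> l2_norm M f * l2_norm M g"
    using l2_cauchy_schwarz[OF f g] complex_Re_le_cmod order_trans by blast
  then show "(l2_norm M (\<lambda>t. f t + g t))\<^sup>2 \<le> (l2_norm M f + l2_norm M g)\<^sup>2"
    by (simp add: l2_norm_add_sq[OF f g] power2_sum)
qed simp

lemma l2_norm_triangle_diff: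
  assumes "f \<in> L2 M" "g \<in> L2 M" "h \<in> L2 M"
  shows "l2_norm M (\<lambda>t. f t - h t) \<le> l2_norm M (\<lambda>t. f t - g t) + l2_norm M (\<lambda>t. g t - h t)"
  using l2_norm_triangle[of "\<lambda>t. f t - g t" M "\<lambda>t. g t - h t"] assms by (simp add: L2_diff)

lemma l2_norm_cong_AE:
  assumes "f \<in> borel_measurable M" "g \<in> borel_measurable M" "AE t in M. f t = g t"
  shows "l2_norm M f = l2_norm M g"
  unfolding l2_norm_def using assms
  by (intro arg_cong[where f = sqrt] integral_cong_AE) (auto elim: AE_mp)

lemma l2_norm_eq_0_iff:
  assumes "f \<in> L2 M"
  shows "l2_norm M f = 0 \<longleftrightarrow> (AE t in M. f t = 0)"
  using integral_nonneg_eq_0_iff_AE[OF L2_integrable_square[OF assms]] by (simp add: l2_norm_def)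

text \<open>Fatou for the squared moduli gives membership of the limit and the bound at once. The
  bound is required only eventually, so that it applies to tails of a Cauchy sequence and to norms
  that approach their limit from above.\<close>

lemma L2_fatou:
  assumes f: "\<And>n. f n \<in> L2 M" and g: "g \<in> borel_measurable M"
    and lim: "AE t in M. (\<lambda>n. f n t) \<longlonglongrightarrow> g t"
    and bound: "eventually (\<lambda>n. l2_norm M (f n) \<le> B) sequentially"
  shows "g \<in> L2 M" "l2_norm M g \<le> B"
proof -
  have B0: "0 \<le> B"
    using bound by (auto simp: eventually_sequentially intro: order_trans[OF l2_norm_nonneg])
  have [measurable]: "f n \<in> borel_measurable M" "g \<in> borel_measurable M" for n
    using f g by (auto simp: L2_def)
  have nn: "(\<integral>\<^sup>+t. ennreal ((cmod (f n t))\<^sup>2) \<partial>M) = ennreal ((l2_norm M (f n))\<^sup>2)" for n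
    using f by (subst nn_integral_eq_integral) (auto simp: L2_def l2_norm_sq)
  have "(\<integral>\<^sup>+t. ennreal ((cmod (g t))\<^sup>2) \<partial>M)
      = (\<integral>\<^sup>+t. liminf (\<lambda>n. ennreal ((cmod (f n t))\<^sup>2)) \<partial>M)"
  proof (rule nn_integral_cong_AE)
    show "AE t in M. ennreal ((cmod (g t))\<^sup>2) = liminf (\<lambda>n. ennreal ((cmod (f n t))\<^sup>2))"
      using lim
    proof eventually_elim
      case (elim t)
      then have "(\<lambda>n. ennreal ((cmod (f n t))\<^sup>2)) \<longlonglongrightarrow> ennreal ((cmod (g t))\<^sup>2)"
        by (intro tendsto_ennrealI tendsto_intros)
      then show ?case
        by (intro lim_imp_Liminf[symmetric]) simp
    qed
  qed
  also have "\<dots> \<le> liminf (\<lambda>n. \<integral>\<^sup>+t. ennreal ((cmod (f n t))\<^sup>2) \<partial>M)"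
    by (intro nn_integral_liminf) auto
  also have "\<dots> \<le> ennreal (B\<^sup>2)"
    unfolding nn using bound
    by (intro Liminf_le) (auto elim!: eventually_mono intro!: ennreal_leI power_mono)
  finally have le: "(\<integral>\<^sup>+t. ennreal ((cmod (g t))\<^sup>2) \<partial>M) \<le> ennreal (B\<^sup>2)" .
  then have int: "integrable M (\<lambda>t. (cmod (g t))\<^sup>2)"
    by (intro integrableI_bounded) (auto intro: le_less_trans)
  then show "g \<in> L2 M"
    by (auto intro: L2I)
  have "(l2_norm M g)\<^sup>2 \<le> B\<^sup>2"
    using le nn_integral_eq_integral[OF int] by (simp add: l2_norm_sq ennreal_le_iff)
  then show "l2_norm M g \<le> B"
    using B0 by (rule power2_le_imp_le)
qed


text \<open>Riesz--Fischer: a rapidly converging subsequence is dominated in the mean by the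
  pointwise sum of its increments, and Fatou's lemma transfers the Cauchy estimate to its limit.\<close>

lemma L2_complete:
  assumes f: "\<And>n. f n \<in> L2 M"
    and cauchy: "\<And>e. e > 0 \<Longrightarrow> \<exists>N. \<forall>m\<ge>N. \<forall>n\<ge>N. l2_norm M (\<lambda>t. f m t - f n t) < e"
  obtains g where "g \<in> L2 M" "(\<lambda>n. l2_norm M (\<lambda>t. f n t - g t)) \<longlonglongrightarrow> 0"
proof -
  have [measurable]: "f n \<in> borel_measurable M" for n
    using f by (simp add: L2_def)
  obtain N where N: "\<And>k m n. m \<ge> N k \<Longrightarrow> n \<ge> N k \<Longrightarrow> l2_norm M (\<lambda>t. f m t - f n t) < (1/2)^k"
    using cauchy[of "(1/2)^_"] by (metis zero_less_divide_1_iff zero_less_numeral zero_less_power)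
  \<comment> \<open>Summing the thresholds makes \<open>r\<close> increasing as well as at least
    \<open>N k\<close>; the added \<open>k\<close> sends it to infinity.\<close>
  define r where "r k = (\<Sum>j\<le>k. N j) + k" for k
  have rN: "r k \<ge> N k" for k
    unfolding r_def by (rule trans_le_add1) (auto intro: member_le_sum)
  have r_mono: "r k \<le> r (Suc k)" for k
    by (simp add: r_def)
  have r_ge: "r k \<ge> k" for k
    by (simp add: r_def)
  define d where "d k t = cmod (f (r (Suc k)) t - f (r k) t)" for k t
  have [measurable]: "d k \<in> borel_measurable M" for k
    unfolding d_def by measurable
  define S where "S k t = complex_of_real (\<Sum>j<k. d j t)" for k t
  have d_L2: "(\<lambda>t. complex_of_real (d k t)) \<in> L2 M" for k
    using L2_diff[OF f f, of "r (Suc k)" "r k"] by (auto simp: L2_def d_def)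
  have S_L2: "S k \<in> L2 M" for k
    using L2_sum[of "{..<k}" "\<lambda>j t. complex_of_real (d j t)" M "\<lambda>_. 1"] d_L2
    by (simp add: S_def[abs_def])
  have d_norm: "l2_norm M (\<lambda>t. complex_of_real (d k t)) \<le> (1/2)^k" for k
    using N[of k "r (Suc k)" "r k"] rN[of k] r_mono[of k] by (simp add: l2_norm_def d_def)
  have S_norm: "l2_norm M (S k) \<le> (\<Sum>j<k. (1/2)^j)" for k
  proof (induction k)
    case 0
    then show ?case by (simp add: S_def[abs_def])
  next
    case (Suc k)
    have "S (Suc k) = (\<lambda>t. S k t + complex_of_real (d k t))"
      by (auto simp: S_def)
    then show ?case
      using l2_norm_triangle[OF S_L2[of k] d_L2[of k]] d_norm[of k] Suc by simp
  qed
  have S_norm2: "l2_norm M (S k) \<le> 2" for k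
  proof -
    have "(\<Sum>j<k. (1/2)^j) = 2 - 2 * (1/2::real)^k"
      by (induction k) auto
    then show ?thesis
      using S_norm[of k] zero_le_power[of "1/2::real" k] by linarith
  qed
  have "(\<integral>\<^sup>+t. (\<Sum>j. ennreal (d j t))\<^sup>2 \<partial>M) \<le> ennreal 4"
  proof -
    \<comment> \<open>Working with the full series in the extended reals postpones the question of
      convergence: finiteness of the integral of its square yields summability a.e.\<close>
    have eq: "(\<Sum>j. ennreal (d j t))\<^sup>2 = liminf (\<lambda>k. ennreal ((cmod (S k t))\<^sup>2))" for t
    proof -
      have "(\<lambda>k. \<Sum>j<k. ennreal (d j t)) \<longlonglongrightarrow> (\<Sum>j. ennreal (d j t))"
        by (rule summable_LIMSEQ) simp
      then have "(\<lambda>k. (\<Sum>j<k. ennreal (d j t)) * (\<Sum>j<k. ennreal (d j t)))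
          \<longlonglongrightarrow> (\<Sum>j. ennreal (d j t)) * (\<Sum>j. ennreal (d j t))"
        by (intro tendsto_mult_ennreal) auto
      moreover have "(\<Sum>j<k. ennreal (d j t)) * (\<Sum>j<k. ennreal (d j t)) = ennreal ((cmod (S k t))\<^sup>2)" for k
        by (simp add: S_def d_def sum_ennreal sum_nonneg ennreal_mult[symmetric] power2_eq_square
            flip: of_real_sum)
      ultimately show ?thesis
        by (simp add: power2_eq_square lim_imp_Liminf)
    qed
    have "(\<integral>\<^sup>+t. (\<Sum>j. ennreal (d j t))\<^sup>2 \<partial>M) = (\<integral>\<^sup>+t. liminf (\<lambda>k. ennreal ((cmod (S k t))\<^sup>2)) \<partial>M)"
      by (simp only: eq)
    also have "\<dots> \<le> liminf (\<lambda>k. \<integral>\<^sup>+t. ennreal ((cmod (S k t))\<^sup>2) \<partial>M)"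
      by (intro nn_integral_liminf) (auto simp: S_def)
    also have "(\<lambda>k. \<integral>\<^sup>+t. ennreal ((cmod (S k t))\<^sup>2) \<partial>M) = (\<lambda>k. ennreal ((l2_norm M (S k))\<^sup>2))"
      by (subst nn_integral_eq_integral) (use S_L2 in \<open>auto simp: L2_def l2_norm_sq\<close>)
    also have "liminf \<dots> \<le> ennreal (2\<^sup>2)"
      using S_norm2 by (intro Liminf_le always_eventually allI ennreal_leI power_mono) auto
    finally show ?thesis by simp
  qed
  then have "AE t in M. (\<Sum>j. ennreal (d j t))\<^sup>2 \<noteq> \<infinity>"
    by (intro nn_integral_PInf_AE) (auto simp: top_unique)
  then have conv: "AE t in M. convergent (\<lambda>k. f (r k) t)"
  proof eventually_elim
    case (elim t)
    then have "(\<Sum>j. ennreal (d j t)) \<noteq> top"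
      by (auto simp: power2_eq_square ennreal_mult_eq_top_iff)
    then have "summable (\<lambda>j. d j t)"
      by (intro summable_suminf_not_top) (auto simp: d_def)
    then have "summable (\<lambda>j. f (r (Suc j)) t - f (r j) t)"
      by (intro summable_norm_cancel[of "\<lambda>j. f (r (Suc j)) t - f (r j) t"]) (simp add: d_def)
    then have "convergent (\<lambda>n. \<Sum>j<n. f (r (Suc j)) t - f (r j) t)"
      by (simp add: summable_iff_convergent)
    moreover have "(\<Sum>j<n. f (r (Suc j)) t - f (r j) t) = f (r n) t - f (r 0) t" for n
      by (rule sum_lessThan_telescope)
    ultimately have "convergent (\<lambda>n. f (r n) t - f (r 0) t)"
      by simp
    then show ?case
      using convergent_add_const_iff[of "- f (r 0) t" "\<lambda>n. f (r n) t"] by simp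
  qed
  \<comment> \<open>Where the subsequence diverges this value is arbitrary; the form as a
    \<open>lim\<close> makes \<open>g\<close> measurable.\<close>
  define g where "g t = lim (\<lambda>k. f (r k) t)" for t
  have [measurable]: "g \<in> borel_measurable M"
    unfolding g_def by measurable
  have lim: "AE t in M. (\<lambda>k. f (r k) t) \<longlonglongrightarrow> g t"
    using conv by eventually_elim (simp add: g_def convergent_LIMSEQ_iff)
  have est: "(\<lambda>t. f n t - g t) \<in> L2 M \<and> l2_norm M (\<lambda>t. f n t - g t) \<le> (1/2)^k" if "n \<ge> N k" for n k
  proof -
    have "AE t in M. (\<lambda>j. f n t - f (r j) t) \<longlonglongrightarrow> f n t - g t"
      using lim by eventually_elim (intro tendsto_intros)
    moreover have "eventually (\<lambda>j. l2_norm M (\<lambda>t. f n t - f (r j) t) \<le> (1/2)^k) sequentially"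
      using eventually_ge_at_top[of "N k"]
    proof eventually_elim
      case (elim j)
      then have "r j \<ge> N k"
        using r_ge[of j] by linarith
      then show ?case
        using N[OF that] by (intro less_imp_le)
    qed
    ultimately show ?thesis
      using L2_fatou[of "\<lambda>j t. f n t - f (r j) t" M "\<lambda>t. f n t - g t" "(1/2)^k"] f
      by (auto intro: L2_diff)
  qed
  \<comment> \<open>Here g = f (N 0) - (f (N 0) - g), and the difference in brackets is
    square-integrable by \<open>est\<close> with k = 0.\<close>
  have "g \<in> L2 M"
    using L2_diff[OF f[of "N 0"] est[of 0 "N 0", THEN conjunct1]] by simp
  moreover have "(\<lambda>n. l2_norm M (\<lambda>t. f n t - g t)) \<longlonglongrightarrow> 0"
  proof (rule LIMSEQ_I)
    fix e :: real assume "e > 0"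
    then obtain k where "(1/2::real)^k < e"
      using real_arch_pow_inv[of e "1/2"] by auto
    then show "\<exists>no. \<forall>n\<ge>no. norm (l2_norm M (\<lambda>t. f n t - g t) - 0) < e"
      using est[of k] by (intro exI[of _ "N k"]) (auto intro: le_less_trans)
  qed
  ultimately show ?thesis
    using that by blast
qed

lemma l2_inner_tendsto:
  assumes f: "\<And>n. f n \<in> L2 M" and g: "g \<in> L2 M" and h: "h \<in> L2 M"
    and lim: "(\<lambda>n. l2_norm M (\<lambda>t. f n t - g t)) \<longlonglongrightarrow> 0"
  shows "(\<lambda>n. l2_inner M (f n) h) \<longlonglongrightarrow> l2_inner M g h"
proof (rule Lim_null[THEN iffD2], rule Lim_null_comparison)
  show "\<forall>\<^sub>F n in sequentially. norm (l2_inner M (f n) h - l2_inner M g h)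
      \<le> l2_norm M (\<lambda>t. f n t - g t) * l2_norm M h"
    using l2_cauchy_schwarz[OF L2_diff[OF f g] h] l2_inner_lincomb_left[OF f g h, of 1 _ "-1"]
    by (intro always_eventually) simp
  show "(\<lambda>n. l2_norm M (\<lambda>t. f n t - g t) * l2_norm M h) \<longlonglongrightarrow> 0"
    using tendsto_mult_left_zero[OF lim] .
qed

lemma l2_norm_tendsto:
  assumes f: "\<And>n. f n \<in> L2 M" and g: "g \<in> L2 M"
    and lim: "(\<lambda>n. l2_norm M (\<lambda>t. f n t - g t)) \<longlonglongrightarrow> 0"
  shows "(\<lambda>n. l2_norm M (f n)) \<longlonglongrightarrow> l2_norm M g"
proof (rule Lim_null[THEN iffD2], rule Lim_null_comparison[OF _ lim])
  have "\<bar>l2_norm M (f n) - l2_norm M g\<bar> \<le> l2_norm M (\<lambda>t. f n t - g t)" for n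
    using l2_norm_triangle_diff[OF f[of n] g L2_zero] l2_norm_triangle_diff[OF g f[of n] L2_zero]
    by (auto simp: l2_norm_minus_commute[of M g])
  then show "\<forall>\<^sub>F n in sequentially. norm (l2_norm M (f n) - l2_norm M g) \<le> l2_norm M (\<lambda>t. f n t - g t)"
    by simp
qed


lemma l2_parallelogram:
  assumes "f \<in> L2 M" "g \<in> L2 M"
  shows "(l2_norm M (\<lambda>t. f t - g t))\<^sup>2
    = 2 * (l2_norm M f)\<^sup>2 + 2 * (l2_norm M g)\<^sup>2 - (l2_norm M (\<lambda>t. f t + g t))\<^sup>2"
  using l2_norm_add_sq[OF assms] l2_norm_add_sq[OF assms(1) L2_scale[OF assms(2), of "-1"]]
    l2_norm_scale[of M "-1" g] l2_inner_scale_right[of M f "-1" g]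
  by simp

text \<open>The representing element is the limit of a minimizing sequence of
  \<open>\<parallel>v\<parallel>\<^sup>2 - 2 Re \<Lambda> v\<close> over the span of the family.\<close>

lemma L2_riesz_family:
  fixes b :: "'i \<Rightarrow> 't \<Rightarrow> complex" and lam :: "'i \<Rightarrow> complex"
  assumes b: "\<And>i. i \<in> I \<Longrightarrow> b i \<in> L2 M" and C: "0 \<le> C"
    and bound: "\<And>S c. finite S \<Longrightarrow> S \<subseteq> I \<Longrightarrow>
      cmod (\<Sum>i\<in>S. c i * lam i) \<le> C * l2_norm M (\<lambda>t. \<Sum>i\<in>S. c i * b i t)"
  obtains h S c where "h \<in> L2 M" "l2_norm M h \<le> C" "\<And>i. i \<in> I \<Longrightarrow> l2_inner M (b i) h = lam i"
    "\<And>n::nat. finite (S n)" "\<And>n. S n \<subseteq> I"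
    "(\<lambda>n. l2_norm M (\<lambda>t. (\<Sum>i\<in>S n. c n i * b i t) - h t)) \<longlonglongrightarrow> 0"
proof -
  \<comment> \<open>Coefficients vanish off the index set, so that two combinations can be added
    over the union of their index sets.\<close>
  define V where "V = {(S :: 'i set, c :: 'i \<Rightarrow> complex). finite S \<and> S \<subseteq> I \<and> (\<forall>i. i \<notin> S \<longrightarrow> c i = 0)}"
  define v where "v = (\<lambda>(S, c) t. \<Sum>i\<in>S. c i * b i t)"
  define L where "L = (\<lambda>(S, c). \<Sum>i\<in>S. c i * lam i)"
  have v_L2: "v p \<in> L2 M" if "p \<in> V" for p
    using that b unfolding V_def v_def by (auto intro!: L2_sum)
  have bnd: "cmod (L p) \<le> C * l2_norm M (v p)" if "p \<in> V" for p
    using that bound by (auto simp: V_def L_def v_def)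
  have comb: "\<exists>r\<in>V. v r = (\<lambda>t. x * v p t + y * v q t) \<and> L r = x * L p + y * L q"
    if "p \<in> V" "q \<in> V" for p q x y
  proof -
    obtain S c T d where pq: "p = (S, c)" "q = (T, d)" by (metis surj_pair)
    have fin: "finite S" "finite T" "S \<subseteq> I" "T \<subseteq> I"
      and zero: "\<And>i. i \<notin> S \<Longrightarrow> c i = 0" "\<And>i. i \<notin> T \<Longrightarrow> d i = 0"
      using that by (auto simp: pq V_def)
    have S: "(\<Sum>i\<in>S. c i * u i) = (\<Sum>i\<in>S \<union> T. c i * u i)" for u
      using fin zero by (intro sum.mono_neutral_left) auto
    have T: "(\<Sum>i\<in>T. d i * u i) = (\<Sum>i\<in>S \<union> T. d i * u i)" for u
      using fin zero by (intro sum.mono_neutral_left) auto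
    show ?thesis
      using fin zero
      by (intro bexI[of _ "(S \<union> T, \<lambda>i. x * c i + y * d i)"])
        (auto simp: pq V_def v_def L_def S T sum_distrib_left sum.distrib algebra_simps)
  qed
  define J where "J p = (l2_norm M (v p))\<^sup>2 - 2 * Re (L p)" for p
  have J_ge: "J p \<ge> - C\<^sup>2" if "p \<in> V" for p
  proof -
    have "Re (L p) \<le> C * l2_norm M (v p)"
      using bnd[OF that] complex_Re_le_cmod[of "L p"] by linarith
    moreover have "0 \<le> (l2_norm M (v p) - C)\<^sup>2" by simp
    ultimately show ?thesis
      by (simp add: J_def power2_eq_square algebra_simps)
  qed
  have V_ne: "({}, \<lambda>_. 0) \<in> V" by (simp add: V_def)
  define m where "m = (INF p\<in>V. J p)"
  have bdd: "bdd_below (J ` V)"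
    using J_ge by (intro bdd_belowI2[of _ "- C\<^sup>2"])
  have m_le: "m \<le> J p" if "p \<in> V" for p
    unfolding m_def using bdd that by (rule cINF_lower)
  have "\<exists>p\<in>V. J p < m + e" if "e > 0" for e
    using cINF_less_iff[of V J "m + e"] bdd V_ne that by (auto simp: m_def[symmetric])
  then have "\<exists>p. p \<in> V \<and> J p < m + 1 / real (Suc n)" for n
    by (meson of_nat_0_less_iff zero_less_Suc zero_less_divide_1_iff)
  then obtain p where p: "\<And>n. p n \<in> V" "\<And>n. J (p n) < m + 1 / real (Suc n)"
    by metis
  \<comment> \<open>By the parallelogram law the left side is 2 * J (p i) + 2 * J (p j) - 4 * J r
    for the midpoint r, since the linear parts cancel; and J r is at least the infimum m.\<close>
  have diff: "(l2_norm M (\<lambda>t. v (p i) t - v (p j) t))\<^sup>2 \<le> 2 / real (Suc i) + 2 / real (Suc j)" for i j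
  proof -
    obtain r where r: "r \<in> V" "v r = (\<lambda>t. (1/2) * v (p i) t + (1/2) * v (p j) t)"
        "L r = (1/2) * L (p i) + (1/2) * L (p j)"
      using comb[OF p(1) p(1)] by blast
    have "v r = (\<lambda>t. (1/2) * (v (p i) t + v (p j) t))"
      by (simp add: r(2) algebra_simps)
    then have "l2_norm M (\<lambda>t. v (p i) t + v (p j) t) = 2 * l2_norm M (v r)"
      using l2_norm_scale[of M "1/2" "\<lambda>t. v (p i) t + v (p j) t"] by simp
    then have "(l2_norm M (\<lambda>t. v (p i) t + v (p j) t))\<^sup>2 = 4 * (l2_norm M (v r))\<^sup>2"
      by (simp add: power_mult_distrib power2_eq_square)
    then show ?thesis
      using l2_parallelogram[OF v_L2[OF p(1)] v_L2[OF p(1)], of i j] m_le[OF r(1)] p(2)[of i] p(2)[of j]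
      by (simp add: J_def r(3))
  qed
  have "\<exists>N. \<forall>i\<ge>N. \<forall>j\<ge>N. l2_norm M (\<lambda>t. v (p i) t - v (p j) t) < e" if e: "e > 0" for e
  proof -
    obtain N where N: "inverse (real (Suc N)) < e\<^sup>2 / 4"
      using reals_Archimedean[of "e\<^sup>2 / 4"] e by auto
    have "l2_norm M (\<lambda>t. v (p i) t - v (p j) t) < e" if "i \<ge> N" "j \<ge> N" for i j
    proof (rule power2_less_imp_less)
      have "2 / real (Suc k) \<le> 2 * inverse (real (Suc N))" if "k \<ge> N" for k
        using that by (simp add: field_simps)
      from this[OF that(1)] this[OF that(2)] show "(l2_norm M (\<lambda>t. v (p i) t - v (p j) t))\<^sup>2 < e\<^sup>2"
        using diff[of i j] N by linarith
    qed (use e in simp)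
    then show ?thesis by blast
  qed
  then obtain h where h: "h \<in> L2 M" and lim: "(\<lambda>n. l2_norm M (\<lambda>t. v (p n) t - h t)) \<longlonglongrightarrow> 0"
    using L2_complete[of "\<lambda>n. v (p n)" M] v_L2[OF p(1)] by blast
  note inner_lim = l2_inner_tendsto[OF v_L2[OF p(1)] h _ lim]
  have Re_eq: "Re (l2_inner M h (v q)) = Re (L q)" if q: "q \<in> V" for q
  proof -
    define D where "D = Re (l2_inner M h (v q)) - Re (L q)"
    \<comment> \<open>\<open>J\<close> at the combination p n + s * q is at least m, while J (p n)
      exceeds m by less than 1 / (n + 1). In the limit this becomes the first-order condition at
      h.\<close>
    have ge: "0 \<le> s\<^sup>2 * (l2_norm M (v q))\<^sup>2 + 2 * s * D" for s :: real
    proof -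
      define x where "x n = s\<^sup>2 * (l2_norm M (v q))\<^sup>2 + 2 * s * (Re (l2_inner M (v (p n)) (v q)) - Re (L q))
          + 1 / real (Suc n)" for n
      have "x \<longlonglongrightarrow> s\<^sup>2 * (l2_norm M (v q))\<^sup>2 + 2 * s * D + 0"
        unfolding x_def D_def
        by (intro tendsto_intros inner_lim v_L2 q LIMSEQ_Suc[OF lim_1_over_n])
      moreover have "0 \<le> x n" for n
      proof -
        obtain r where r: "r \<in> V" "v r = (\<lambda>t. 1 * v (p n) t + of_real s * v q t)"
            "L r = 1 * L (p n) + of_real s * L q"
          using comb[OF p(1) q] by blast
        have "(l2_norm M (v r))\<^sup>2 = (l2_norm M (v (p n)))\<^sup>2 + s\<^sup>2 * (l2_norm M (v q))\<^sup>2
            + 2 * (s * Re (l2_inner M (v (p n)) (v q)))"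
          using l2_norm_add_sq[OF v_L2[OF p(1)] L2_scale[OF v_L2[OF q]], of n "of_real s"]
          by (simp add: r(2) l2_norm_scale l2_inner_scale_right power_mult_distrib)
        then show ?thesis
          using m_le[OF r(1)] p(2)[of n] by (simp add: J_def r(3) x_def algebra_simps)
      qed
      ultimately show ?thesis
        using LIMSEQ_le_const[of x _ 0] by simp
    qed
    have "D = 0"
    proof (rule ccontr)
      assume D: "D \<noteq> 0"
      \<comment> \<open>The added 1 keeps A positive when v q = 0; with s = - D / A the inequality
        \<open>ge\<close> forces D = 0.\<close>
      define A where "A = (l2_norm M (v q))\<^sup>2 + 1"
      have A: "A > 0" by (simp add: A_def add_nonneg_pos)
      have "0 \<le> (D / A)\<^sup>2 * (A - 1) - 2 * (D / A) * D"
        using ge[of "- D / A"] by (simp add: A_def)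
      also have "\<dots> = - (D\<^sup>2 * (A + 1) / A\<^sup>2)"
        using A by (simp add: field_simps power2_eq_square)
      finally show False
        using D A zero_less_divide_iff[of "D\<^sup>2 * (A + 1)" "A\<^sup>2"] by (simp add: mult_le_0_iff divide_le_0_iff)
    qed
    then show ?thesis by (simp add: D_def)
  qed
  have repr: "l2_inner M (v q) h = L q" if q: "q \<in> V" for q
  proof (rule complex_eqI)
    show "Re (l2_inner M (v q) h) = Re (L q)"
      using Re_eq[OF q] l2_inner_cnj[of M h "v q"] by simp
    \<comment> \<open>Passing from q to \<i> * q converts the identity of real parts into that of
      imaginary parts.\<close>
    obtain r where r: "r \<in> V" "v r = (\<lambda>t. \<i> * v q t + 0 * v q t)" "L r = \<i> * L q + 0 * L q"
      using comb[OF q q] by blast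
    have "Re (l2_inner M (v r) h) = Re (L r)"
      using Re_eq[OF r(1)] l2_inner_cnj[of M h "v r"] by simp
    then show "Im (l2_inner M (v q) h) = Im (L q)"
      by (simp add: r(2,3) l2_inner_scale_left)
  qed
  show ?thesis
  proof (rule that[of h "\<lambda>n. fst (p n)" "\<lambda>n. snd (p n)"])
    show "h \<in> L2 M" by fact
    show "l2_inner M (b i) h = lam i" if "i \<in> I" for i
      using repr[of "({i}, \<lambda>j. if j = i then 1 else 0)"] that by (simp add: V_def v_def L_def)
    show "finite (fst (p n))" "fst (p n) \<subseteq> I" for n
      using p(1)[of n] by (auto simp: V_def)
    show "(\<lambda>n. l2_norm M (\<lambda>t. (\<Sum>i\<in>fst (p n). snd (p n) i * b i t) - h t)) \<longlonglongrightarrow> 0"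
      using lim by (simp add: v_def case_prod_beta)
    \<comment> \<open>On the approximating combinations the pairing with h is \<open>L\<close>,
      hence bounded by C times their norm; in the limit the squared norm of h is at most C times its
      norm.\<close>
    have "(\<lambda>n. cmod (l2_inner M (v (p n)) h)) \<longlonglongrightarrow> cmod (l2_inner M h h)"
      by (intro tendsto_norm inner_lim h)
    moreover have "(\<lambda>n. C * l2_norm M (v (p n))) \<longlonglongrightarrow> C * l2_norm M h"
      by (intro tendsto_intros l2_norm_tendsto[OF v_L2[OF p(1)] h lim])
    moreover have "cmod (l2_inner M (v (p n)) h) \<le> C * l2_norm M (v (p n))" for n
      using repr[OF p(1)] bnd[OF p(1)] by simp
    ultimately have "cmod (l2_inner M h h) \<le> C * l2_norm M h"
      by (intro LIMSEQ_le) auto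
    then have "l2_norm M h * l2_norm M h \<le> C * l2_norm M h"
      by (simp add: l2_inner_self power2_eq_square norm_mult)
    then show "l2_norm M h \<le> C"
      using C l2_norm_nonneg[of M h] by (cases "l2_norm M h = 0") (auto simp: less_le)
  qed
qed

section \<open>Lebesgue measure restricted to a Borel set\<close>

abbreviation leb :: "real set \<Rightarrow> real measure" where
  "leb A \<equiv> restrict_space lborel A"

abbreviation pos :: "real measure" where
  "pos \<equiv> leb {0<..}"

lemma sigma_finite_leb: "A \<in> sets borel \<Longrightarrow> sigma_finite_measure (leb A)"
  by (intro sigma_finite_measure_restrict_space lborel.sigma_finite_measure_axioms) auto

interpretation pos: sigma_finite_measure pos
  by (rule sigma_finite_leb) simp

lemma measurable_leb_id [measurable (raw)]: "(\<lambda>x. x) \<in> borel_measurable (leb A)"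
  by (intro measurable_restrict_space1) simp

lemma set_integral_leb:
  fixes f :: "real \<Rightarrow> 'a::{banach, second_countable_topology}"
  assumes "A \<in> sets borel"
  shows "(LINT t:A|lborel. f t) = (LINT t|leb A. f t)"
  unfolding set_lebesgue_integral_def using assms by (subst integral_restrict_space) auto

lemma set_integrable_leb:
  fixes f :: "real \<Rightarrow> 'a::{banach, second_countable_topology}"
  assumes "A \<in> sets borel"
  shows "set_integrable lborel A f \<longleftrightarrow> integrable (leb A) f"
  unfolding set_integrable_def using assms by (subst integrable_restrict_space) auto

lemma set_borel_measurable_leb:
  fixes f :: "real \<Rightarrow> 'a::real_normed_vector"
  assumes "A \<in> sets borel"
  shows "set_borel_measurable lborel A f \<longleftrightarrow> f \<in> borel_measurable (leb A)"
  unfolding set_borel_measurable_def using assms by (subst borel_measurable_restrict_space_iff) auto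

text \<open>For a non-negative function a gauge integral is a Lebesgue integral; the exponential and
  Gamma integrals enter in this way.\<close>

lemma has_bochner_integral_leb_nonneg:
  fixes f :: "real \<Rightarrow> real"
  assumes "A \<in> sets borel" "f \<in> borel_measurable borel" "\<And>x. 0 \<le> f x" "(f has_integral r) A"
  shows "has_bochner_integral (leb A) f r"
proof (rule has_bochner_integral_nn_integral)
  show "0 \<le> r"
    using assms(3,4) by (rule has_integral_nonneg[rotated])
  show "f \<in> borel_measurable (leb A)"
    using assms(2) by (intro measurable_restrict_space1) simp
  have "(\<integral>\<^sup>+ x. ennreal (f x) \<partial>leb A) = (\<integral>\<^sup>+ x. ennreal (indicator A x * f x) \<partial>lborel)"
    using assms(1)
    by (subst nn_integral_restrict_space) (auto intro!: nn_integral_cong split: split_indicator)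
  also have "\<dots> = ennreal r"
    using assms(2,3,4) by (intro nn_integral_has_integral_lebesgue) auto
  finally show "(\<integral>\<^sup>+ x. ennreal (f x) \<partial>leb A) = ennreal r" .
qed (use assms(3) in simp)

lemma AE_pos_iff: "(AE t in pos. P t) \<longleftrightarrow> (AE t in lborel. 0 < t \<longrightarrow> P t)"
  by (subst AE_restrict_space_iff) auto

text \<open>Tonelli with the second variable outermost: in the applications the inner integral over
  the first variable is an explicit estimate or a substitution.\<close>

lemma (in pair_sigma_finite) integrable_pairI:
  fixes f :: "'a \<Rightarrow> 'b \<Rightarrow> 'c::{banach, second_countable_topology}"
  assumes [measurable]: "case_prod f \<in> borel_measurable (M1 \<Otimes>\<^sub>M M2)"
    and fin: "(\<integral>\<^sup>+y. \<integral>\<^sup>+x. ennreal (norm (f x y)) \<partial>M1 \<partial>M2) < \<infinity>"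
  shows "integrable (M1 \<Otimes>\<^sub>M M2) (case_prod f)"
proof (rule integrableI_bounded)
  show "(\<integral>\<^sup>+p. ennreal (norm (case_prod f p)) \<partial>(M1 \<Otimes>\<^sub>M M2)) < \<infinity>"
    using fin by (subst nn_integral_snd[symmetric]) (simp_all add: case_prod_beta')
qed fact

lemma pair_sigma_finite_leb:
  "A \<in> sets borel \<Longrightarrow> B \<in> sets borel \<Longrightarrow> pair_sigma_finite (leb A) (leb B)"
  by (simp add: pair_sigma_finite_def sigma_finite_leb)

section \<open>The exponential functions\<close>

definition expfun :: "complex \<Rightarrow> real \<Rightarrow> complex" where
  "expfun w t = exp (- (w * complex_of_real t))"

lemma expfun_measurable [measurable]: "expfun w \<in> borel_measurable borel"
  unfolding expfun_def by measurable

lemma measurable_expfun [measurable (raw)]: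
  assumes [measurable]: "g \<in> borel_measurable M" "h \<in> borel_measurable M"
  shows "(\<lambda>x. expfun (g x) (h x)) \<in> borel_measurable M"
  unfolding expfun_def by measurable

lemma expfun_pos_measurable [measurable]: "expfun w \<in> borel_measurable (leb A)"
  by (intro measurable_restrict_space1) simp

lemma cmod_expfun: "cmod (expfun w t) = exp (- (Re w * t))"
  by (simp add: expfun_def)

lemma cnj_expfun: "cnj (expfun w t) = expfun (cnj w) t"
  by (simp add: expfun_def exp_cnj)

lemma expfun_of_real: "expfun (of_real c) t = of_real (exp (- (c * t)))"
  by (simp add: expfun_def exp_of_real[symmetric])

lemma expfun_mult: "expfun w t * expfun v t = expfun (w + v) t"
  by (simp add: expfun_def exp_add[symmetric] algebra_simps)

lemma has_bochner_integral_exp_pos: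
  assumes "0 < a"
  shows "has_bochner_integral pos (\<lambda>t. exp (- (a * t)) :: real) (1 / a)"
proof -
  have "((\<lambda>x::real. exp (-a*x)) has_integral exp (-a*0)/a) {0..}"
    using assms by (rule has_integral_exp_minus_to_infinity)
  then have "((\<lambda>x::real. exp (-(a*x))) has_integral 1/a) {0..}"
    by (simp only: mult_minus_left mult_zero_right minus_zero exp_zero)
  then have "((\<lambda>x::real. exp (-(a*x))) has_integral 1/a) {0<..}"
    by (subst has_integral_spike_set_eq[of _ "{0..}"])
      (rule negligible_subset[OF negligible_sing[of 0]], force)+
  then show ?thesis
    by (intro has_bochner_integral_leb_nonneg) auto
qed

lemma integrable_expfun: "0 < Re w \<Longrightarrow> integrable pos (expfun w)"
  by (rule Bochner_Integration.integrable_bound[OF has_bochner_integral_exp_pos[THEN integrable.intros]])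
    (auto simp: cmod_expfun)

lemma integral_expfun:
  assumes "0 < Re w"
  shows "(LINT t|pos. expfun w t) = 1 / w"
proof -
  have w: "w \<noteq> 0" using assms by auto
  have "(LBINT t=0..\<infinity>. expfun w t) = 0 - (- 1 / w)"
  proof (rule interval_integral_FTC_integrable)
    show "((\<lambda>t. - expfun w t / w) has_vector_derivative expfun w t) (at t)" for t
    proof -
      have "((\<lambda>z. - exp (- (w * z)) / w) has_field_derivative exp (- (w * complex_of_real t))) (at (of_real t))"
        using w by (auto intro!: derivative_eq_intros)
      then show ?thesis
        unfolding expfun_def by (rule has_vector_derivative_real_field)
    qed
    show "isCont (expfun w) t" for t
      unfolding expfun_def by (intro continuous_intros)
    show "set_integrable lborel (einterval 0 \<infinity>) (expfun w)"
      using integrable_expfun[OF assms]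
      by (simp add: set_integrable_leb zero_ereal_def[symmetric] einterval_def greaterThan_def[symmetric])
    show "(((\<lambda>t. - expfun w t / w) \<circ> real_of_ereal) \<longlongrightarrow> - 1 / w) (at_right 0)"
      unfolding zero_ereal_def ereal_tendsto_simps1 expfun_def
      by (auto intro!: tendsto_eq_intros simp: w)
    have "((\<lambda>t. exp (- (Re w * t))) \<longlongrightarrow> 0) at_top"
      using assms by real_asymp
    then have "((\<lambda>t. expfun w t) \<longlongrightarrow> 0) at_top"
      by (intro tendsto_norm_zero_cancel[of "expfun w"]) (simp add: cmod_expfun)
    then show "(((\<lambda>t. - expfun w t / w) \<circ> real_of_ereal) \<longlongrightarrow> 0) (at_left \<infinity>)"
      unfolding ereal_tendsto_simps1 by (auto intro!: tendsto_eq_intros simp: w)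
  qed simp
  then show ?thesis
    by (simp add: interval_lebesgue_integral_def set_integral_leb zero_ereal_def[symmetric] einterval_def greaterThan_def[symmetric])
qed

lemma expfun_L2: "0 < Re w \<Longrightarrow> expfun w \<in> L2 pos"
  using has_bochner_integral_exp_pos[THEN integrable.intros, of "2 * Re w"]
  by (intro L2I) (auto simp: cmod_expfun power2_eq_square exp_add[symmetric] algebra_simps)

text \<open>The right-hand side is the reproducing kernel of the Hardy space: exponentials on the
  half-line correspond to its kernel functions, and their Gram matrix is the bridge to Cauchy
  kernels on vertical lines.\<close>

lemma expfun_inner:
  "0 < Re w \<Longrightarrow> 0 < Re v \<Longrightarrow> l2_inner pos (expfun w) (expfun v) = 1 / (w + cnj v)"
  by (simp add: l2_inner_def cnj_expfun expfun_mult integral_expfun)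

lemma expfun_norm: "0 < Re w \<Longrightarrow> l2_norm pos (expfun w) = 1 / sqrt (2 * Re w)"
  using has_bochner_integral_exp_pos[of "2 * Re w", THEN has_bochner_integral_integral_eq]
  by (simp add: l2_norm_def cmod_expfun power2_eq_square exp_add[symmetric] algebra_simps
      real_sqrt_divide real_sqrt_mult)

lemma laplace_eq: "0 < Re z \<Longrightarrow> laplace f z = (LINT t|pos. f t * expfun z t)"
  by (simp add: laplace_def zero_ext_def right_half_plane_def set_integral_leb expfun_def)

lemma laplace_outside: "\<not> 0 < Re z \<Longrightarrow> laplace f z = 0"
  by (simp add: laplace_def zero_ext_def right_half_plane_def)

lemma laplace_inner: "0 < Re z \<Longrightarrow> laplace f z = l2_inner pos f (expfun (cnj z))"
  by (simp add: laplace_eq l2_inner_def cnj_expfun)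

lemma laplace_bound:
  "f \<in> L2 pos \<Longrightarrow> 0 < Re z \<Longrightarrow> cmod (laplace f z) \<le> l2_norm pos f / sqrt (2 * Re z)"
  using l2_cauchy_schwarz[of f pos "expfun (cnj z)"] by (simp add: laplace_inner expfun_L2 expfun_norm)

lemma laplace_lincomb:
  assumes "f \<in> L2 pos" "g \<in> L2 pos"
  shows "laplace (\<lambda>t. a * f t + b * g t) z = a * laplace f z + b * laplace g z"
proof (cases "0 < Re z")
  case True
  then show ?thesis
    using assms by (simp add: laplace_inner l2_inner_lincomb_left expfun_L2)
qed (simp add: laplace_outside)

lemma laplace_cong_AE:
  assumes "f \<in> borel_measurable pos" "g \<in> borel_measurable pos" "AE t in pos. f t = g t"
  shows "laplace f = laplace g"
proof
  fix z
  show "laplace f z = laplace g z"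
  proof (cases "0 < Re z")
    case True
    have "(LINT t|pos. f t * expfun z t) = (LINT t|pos. g t * expfun z t)"
    proof (rule integral_cong_AE)
      show "AE t in pos. f t * expfun z t = g t * expfun z t"
        using assms(3) by eventually_elim simp
    qed (use assms in measurable)
    then show ?thesis
      using True by (simp add: laplace_eq)
  qed (simp add: laplace_outside)
qed

section \<open>Injectivity of the Laplace transform\<close>

text \<open>The positive and the negative part of g, taken as densities, give finite measures that
  agree on all open upper half-lines. These determine a measure, so the densities agree a.e. The
  parameter s = 1 or s = -1 selects the part.\<close>

lemma AE_zero_if_integral_greaterThan_zero:
  fixes g :: "real \<Rightarrow> real"
  assumes g: "integrable lborel g" and zero: "\<And>x. (LINT t:{x<..}|lborel. g t) = 0"
  shows "AE t in lborel. g t = 0"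
proof -
  have [measurable]: "g \<in> borel_measurable borel"
    using g by (simp add: borel_measurable_integrable[of lborel g, simplified])
  define N where "N s = density lborel (\<lambda>t. ennreal (max 0 (s * g t)))" for s :: real
  have em: "emeasure (N s) A = ennreal (LINT t:A|lborel. max 0 (s * g t))" if "A \<in> sets borel" for s A
  proof -
    have "emeasure (N s) A = (\<integral>\<^sup>+t. ennreal (indicator A t * max 0 (s * g t)) \<partial>lborel)"
      using that by (auto simp: N_def emeasure_density intro!: nn_integral_cong split: split_indicator)
    also have "\<dots> = ennreal (LINT t|lborel. indicator A t * max 0 (s * g t))"
      using integrable_mult_indicator[of A lborel "\<lambda>t. max 0 (s * g t)"] g that
      by (intro nn_integral_eq_integral) auto
    finally show ?thesis
      by (simp add: set_lebesgue_integral_def)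
  qed
  have "N 1 = N (-1)"
  proof (rule measure_eqI_lessThan)
    fix x
    have int: "set_integrable lborel {x<..} (\<lambda>t. max 0 (s * g t))" for s
      using integrable_mult_indicator[of "{x<..}" lborel "\<lambda>t. max 0 (s * g t)"] g
      by (simp add: set_integrable_def)
    have "(LINT t:{x<..}|lborel. max 0 (1 * g t)) - (LINT t:{x<..}|lborel. max 0 (-1 * g t))
        = (LINT t:{x<..}|lborel. max 0 (1 * g t) - max 0 (-1 * g t))"
      by (intro set_integral_diff(2)[symmetric] int)
    also have "(\<lambda>t. max 0 (1 * g t) - max 0 (-1 * g t)) = g"
      by auto
    finally show "emeasure (N 1) {x<..} = emeasure (N (-1)) {x<..}"
      by (simp add: em zero)
  qed (auto simp: N_def[THEN arg_cong[where f=sets]] em)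
  then have "AE t in lborel. ennreal (max 0 (1 * g t)) = ennreal (max 0 (-1 * g t))"
    unfolding N_def by (intro sigma_finite_measure.density_unique[OF lborel.sigma_finite_measure_axioms]) auto
  then show ?thesis
    by eventually_elim (auto simp: max_def split: if_splits)
qed

text \<open>Lerch's theorem: by Weierstrass approximation in the variable \<open>exp (-t)\<close>, vanishing at
  the positive integers already makes all integrals over half-lines vanish.\<close>

lemma lerch_real:
  fixes g :: "real \<Rightarrow> real"
  assumes g: "integrable pos g" and zero: "\<And>n::nat. (LINT t|pos. g t * exp (- t) ^ n) = 0"
  shows "AE t in pos. g t = 0"
proof -
  have [measurable]: "g \<in> borel_measurable pos"
    using g by simp
  have bounded_int: "integrable pos (\<lambda>t. g t * h (exp (- t)))"
    if "h \<in> borel_measurable borel" "\<And>x. x \<in> {0..1} \<Longrightarrow> \<bar>h x\<bar> \<le> B" for h :: "real \<Rightarrow> real" and B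
  proof (rule Bochner_Integration.integrable_bound[of _ "\<lambda>t. g t * B"])
    show "integrable pos (\<lambda>t. g t * B)" using g by simp
    show "(\<lambda>t. g t * h (exp (- t))) \<in> borel_measurable pos"
      using that(1) by measurable
    show "AE t in pos. norm (g t * h (exp (- t))) \<le> norm (g t * B)"
      using that(2) by (intro AE_I2) (auto simp: abs_mult space_restrict_space intro!: mult_left_mono order_trans[OF that(2)])
  qed
  have poly: "(LINT t|pos. g t * p (exp (- t))) = 0" if "real_polynomial_function p" for p
  proof -
    have "\<exists>a n. p = (\<lambda>x. \<Sum>i\<le>n. a i * x ^ i)"
      using that by (simp only: real_polynomial_function_iff_sum)
    then obtain a n where p: "p = (\<lambda>x. \<Sum>i\<le>n. a i * x ^ i)"
      by (elim exE)
    have "integrable pos (\<lambda>t. g t * exp (- t) ^ i)" for i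
      using bounded_int[of "\<lambda>x. x ^ i" 1] by (simp add: power_le_one power_abs)
    then have "(LINT t|pos. (\<Sum>i\<le>n. a i * (g t * exp (- t) ^ i))) = 0"
      by (simp add: zero)
    then show ?thesis
      by (simp add: p sum_distrib_left mult.left_commute)
  qed
  have cont: "(LINT t|pos. g t * h (exp (- t))) = 0" if h: "continuous_on UNIV h" for h :: "real \<Rightarrow> real"
  proof -
    have h': "continuous_on {0..1} h" using h continuous_on_subset by blast
    have hm: "h \<in> borel_measurable borel"
      using h by (rule borel_measurable_continuous_onI)
    obtain B where B: "\<And>x. x \<in> {0..1} \<Longrightarrow> \<bar>h x\<bar> \<le> B"
      using compact_imp_bounded[OF compact_continuous_image[OF h' compact_Icc]]
      unfolding bounded_iff real_norm_def by blast
    have "\<bar>LINT t|pos. g t * h (exp (- t))\<bar> \<le> e * (LINT t|pos. \<bar>g t\<bar>)" if e: "e > 0" for e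
    proof -
      obtain p where p: "real_polynomial_function p" "\<And>x. x \<in> {0..1} \<Longrightarrow> \<bar>h x - p x\<bar> < e"
        using Stone_Weierstrass_real_polynomial_function[OF compact_Icc h' e] by metis
      have pm: "p \<in> borel_measurable borel"
        using p(1) by (intro borel_measurable_continuous_onI continuous_on_polymonial_function)
          (simp add: real_polynomial_function_eq)
      have ip: "integrable pos (\<lambda>t. g t * (h (exp (- t)) - p (exp (- t))))"
        using p(2) hm pm by (intro bounded_int[of "\<lambda>x. h x - p x" e]) (auto intro: less_imp_le)
      have ih: "integrable pos (\<lambda>t. g t * h (exp (- t)))"
        using B hm by (intro bounded_int[of h B])
      have "(LINT t|pos. g t * h (exp (- t))) = (LINT t|pos. g t * h (exp (- t))) - (LINT t|pos. g t * p (exp (- t)))"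
        by (simp add: poly[OF p(1)])
      also have "\<dots> = (LINT t|pos. g t * (h (exp (- t)) - p (exp (- t))))"
        using Bochner_Integration.integral_diff[OF ih Bochner_Integration.integrable_diff[OF ih ip]]
        by (simp add: algebra_simps)
      also have "\<bar>\<dots>\<bar> \<le> (LINT t|pos. e * \<bar>g t\<bar>)"
      proof (rule order_trans[OF integral_abs_bound integral_mono])
        show "integrable pos (\<lambda>t. e * \<bar>g t\<bar>)" using g by simp
        show "\<bar>g t * (h (exp (- t)) - p (exp (- t)))\<bar> \<le> e * \<bar>g t\<bar>" if "t \<in> space pos" for t
          using p(2)[of "exp (- t)"] that
          by (auto simp: abs_mult space_restrict_space mult.commute[of e] intro!: mult_left_mono)
      qed (use ip in simp)
      finally show ?thesis by simp
    qed
    note bound = this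
    have "\<bar>LINT t|pos. g t * h (exp (- t))\<bar> \<le> 0 + e" if e: "e > 0" for e
    proof -
      \<comment> \<open>Dividing by I + 1 keeps the choice of the tolerance valid when I =
        0.\<close>
      define I where "I = (LINT t|pos. \<bar>g t\<bar>)"
      have I: "I \<ge> 0" by (simp add: I_def)
      have "e / (I + 1) * I \<le> e"
        using I e by (simp add: field_simps)
      then show ?thesis
        using bound[of "e / (I + 1)"] I e by (simp add: I_def[symmetric])
    qed
    then have "\<bar>LINT t|pos. g t * h (exp (- t))\<bar> \<le> 0"
      by (rule field_le_epsilon)
    then show ?thesis
      by simp
  qed
  define G where "G t = indicator {0<..} t * g t" for t
  have G: "integrable lborel G"
    using g by (simp add: G_def[abs_def] integrable_restrict_space)
  have "AE t in lborel. G t = 0"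
  proof (rule AE_zero_if_integral_greaterThan_zero[OF G])
    fix x :: real
    define b where "b = exp (- x)"
    \<comment> \<open>Continuous ramps in the variable y = exp (- t) that converge to the indicator
      of y < b, that is, of t > x. At t = x all of them vanish, in agreement with the open
      half-line.\<close>
    define h where "h k y = max 0 (min 1 (real k * (b - y)))" for k y
    have "(\<lambda>k. LINT t|pos. g t * h k (exp (- t))) \<longlonglongrightarrow> (LINT t|pos. g t * indicator {x<..} t)"
    proof (rule integral_dominated_convergence)
      show "integrable pos (\<lambda>t. \<bar>g t\<bar>)" using g by simp
      show "AE t in pos. (\<lambda>k. g t * h k (exp (- t))) \<longlonglongrightarrow> g t * indicator {x<..} t"
      proof (intro AE_I2 tendsto_intros)
        fix t :: real
        show "(\<lambda>k. h k (exp (- t))) \<longlonglongrightarrow> indicator {x<..} t"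
        proof (cases "t > x")
          case True
          then have pos: "b - exp (- t) > 0" by (simp add: b_def)
          then obtain K where K: "real K * (b - exp (- t)) > 1"
            using reals_Archimedean3 by blast
          have "h k (exp (- t)) = 1" if "k \<ge> K" for k
          proof -
            have "real K * (b - exp (- t)) \<le> real k * (b - exp (- t))"
              using that pos by (intro mult_right_mono) auto
            then show ?thesis using K by (simp add: h_def)
          qed
          then have "eventually (\<lambda>k. h k (exp (- t)) = 1) sequentially"
            by (auto simp: eventually_sequentially)
          then show ?thesis
            using True by (simp add: tendsto_eventually)
        next
          case False
          then have "b - exp (- t) \<le> 0" by (simp add: b_def)
          then have "real k * (b - exp (- t)) \<le> 0" for k
            by (intro mult_nonneg_nonpos) auto
          then have "h k (exp (- t)) = 0" for k
            by (simp add: h_def min.coboundedI2)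
          then show ?thesis using False by simp
        qed
      qed
      show "AE t in pos. norm (g t * h k (exp (- t))) \<le> \<bar>g t\<bar>" for k
        by (intro AE_I2) (auto simp: h_def abs_mult intro!: mult_left_le)
    qed (simp_all add: h_def)
    moreover have "(LINT t|pos. g t * h k (exp (- t))) = 0" for k
      unfolding h_def by (intro cont continuous_intros)
    ultimately have "(LINT t|pos. g t * indicator {x<..} t) = 0"
      by (simp add: LIMSEQ_const_iff)
    then show "(LINT t:{x<..}|lborel. G t) = 0"
      by (simp add: integral_restrict_space set_lebesgue_integral_def G_def mult_ac)
  qed
  then show ?thesis
    unfolding AE_pos_iff by eventually_elim (auto simp: G_def)
qed

text \<open>The real version is applied to the parts of f * exp (- t), which moves the exponents n
  \<ge> 1 to n \<ge> 0. Integrability is asked of that product and not of f, so that the lemma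
  covers the averages and the images of the operator on the half-line.\<close>

lemma lerch:
  fixes f :: "real \<Rightarrow> complex"
  assumes f: "integrable pos (\<lambda>t. f t * expfun 1 t)"
    and zero: "\<And>n::nat. n \<ge> 1 \<Longrightarrow> (LINT t|pos. f t * expfun (of_nat n) t) = 0"
  shows "AE t in pos. f t = 0"
proof -
  have eq: "f t * expfun (of_nat (Suc n)) t = f t * expfun 1 t * of_real (exp (- t) ^ n)" for n t
    by (simp add: expfun_def exp_of_real[symmetric] exp_add[symmetric] exp_of_nat_mult[symmetric] algebra_simps)
  have int: "integrable pos (\<lambda>t. f t * expfun 1 t * of_real (exp (- t) ^ n))" for n
    by (rule Bochner_Integration.integrable_bound[OF f])
       (use f in \<open>auto simp: norm_mult norm_power power_le_one space_restrict_space intro!: AE_I2 mult_left_le\<close>)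
  have z: "(LINT t|pos. f t * expfun 1 t * of_real (exp (- t) ^ n)) = 0" for n
    using zero[of "Suc n"] unfolding eq by simp
  have "AE t in pos. Re (f t * expfun 1 t) = 0"
  proof (rule lerch_real)
    show "(LINT t|pos. Re (f t * expfun 1 t) * exp (- t) ^ n) = 0" for n
      using integral_Re[OF int[of n]] z[of n] by (simp only: Re_complex_of_real times_complex.sel) simp
  qed (rule integrable_Re[OF f])
  moreover have "AE t in pos. Im (f t * expfun 1 t) = 0"
  proof (rule lerch_real)
    show "(LINT t|pos. Im (f t * expfun 1 t) * exp (- t) ^ n) = 0" for n
      using integral_Im[OF int[of n]] z[of n] by (simp only: Re_complex_of_real times_complex.sel) simp
  qed (rule integrable_Im[OF f])
  ultimately show ?thesis
  proof eventually_elim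
    case (elim t)
    then have "f t * expfun 1 t = 0"
      by (intro complex_eqI) simp_all
    then show ?case
      by (simp add: expfun_def)
  qed
qed

lemma laplace_inj:
  assumes f: "f \<in> L2 pos" and g: "g \<in> L2 pos" and eq: "laplace f = laplace g"
  shows "AE t in pos. f t = g t"
proof -
  have "AE t in pos. f t - g t = 0"
  proof (rule lerch)
    show "integrable pos (\<lambda>t. (f t - g t) * expfun 1 t)"
      using f g by (intro L2_integrable_mult L2_diff expfun_L2) auto
    show "(LINT t|pos. (f t - g t) * expfun (of_nat n) t) = 0" if "n \<ge> 1" for n
      using laplace_lincomb[OF f g, of 1 "-1" "of_nat n"] eq that by (simp add: laplace_eq)
  qed
  then show ?thesis
    by eventually_elim simp
qed

section \<open>Cauchy's formula on vertical lines\<close>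

lemma has_contour_integral_linepath_same_Im_iff:
  assumes "a < b"
  shows "(f has_contour_integral I) (linepath (Complex a c) (Complex b c)) \<longleftrightarrow>
    ((\<lambda>x. f (Complex x c)) has_integral I) {a..b}"
proof -
  have "linepath (Complex a c) (Complex b c) x = linepath (of_real a) (of_real b) x + \<i> * of_real c" for x
    by (simp add: linepath_def complex_eq_iff algebra_simps)
  moreover have "Complex b c - Complex a c = of_real b - of_real a"
    by (simp add: complex_eq_iff)
  ultimately have "(f has_contour_integral I) (linepath (Complex a c) (Complex b c)) \<longleftrightarrow>
      ((\<lambda>z. f (z + \<i> * of_real c)) has_contour_integral I) (linepath (of_real a) (of_real b))"
    by (simp add: has_contour_integral_linepath)
  also have "\<dots> \<longleftrightarrow> ((\<lambda>x. f (of_real x + \<i> * of_real c)) has_integral I) {a..b}"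
    using assms by (subst has_contour_integral_linepath_Reals_iff) auto
  finally show ?thesis
    by (simp add: Complex_eq)
qed

lemma contour_integrable_linepath:
  "continuous_on (closed_segment a b) f \<Longrightarrow> (f has_contour_integral contour_integral (linepath a b) f) (linepath a b)"
  by (rule has_contour_integral_integral[OF contour_integrable_continuous_linepath])

text \<open>The kernel is written with w - \<zeta>, which reverses the usual sign: the left edge,
  the one that survives when the rectangle grows, then carries a plus sign.\<close>

lemma Cauchy_integral_rectangle:
  fixes F :: "complex \<Rightarrow> complex"
  assumes hol: "F holomorphic_on right_half_plane"
    and x: "0 < x0" "x0 < Re w" "Re w < X" and R: "\<bar>Im w\<bar> < R"
  shows "2 * pi * F w =
     (LBINT y:{-R..R}. F (Complex x0 y) / (w - Complex x0 y))
   - (LBINT y:{-R..R}. F (Complex X y) / (w - Complex X y))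
   + \<i> * (LBINT s:{x0..X}. F (Complex s (-R)) / (w - Complex s (-R)))
   - \<i> * (LBINT s:{x0..X}. F (Complex s R) / (w - Complex s R))"
proof -
  define f where "f z = F z / (z - w)" for z
  define a1 a2 a3 a4 where "a1 = Complex x0 (-R)" and "a2 = Complex X (-R)"
    and "a3 = Complex X R" and "a4 = Complex x0 R"
  have R0: "R > 0" using R by linarith
  have w: "w \<in> box a1 a3"
    using x R by (auto simp: in_box_complex_iff a1_def a3_def)
  have sub: "cbox a1 a3 \<subseteq> right_half_plane"
    using x by (auto simp: in_cbox_complex_iff a1_def right_half_plane_def)
  have pim: "path_image (rectpath a1 a3) = cbox a1 a3 - box a1 a3"
    using x R0 by (intro path_image_rectpath_cbox_minus_box) (auto simp: a1_def a3_def)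
  have cauchy: "(f has_contour_integral (2 * pi * \<i> * winding_number (rectpath a1 a3) w * F w)) (rectpath a1 a3)"
    unfolding f_def
  proof (rule Cauchy_integral_formula_convex_simple)
    show "convex (cbox a1 a3)" by (rule convex_box)
    show "F holomorphic_on cbox a1 a3"
      using hol sub holomorphic_on_subset by blast
    show "w \<in> interior (cbox a1 a3)" using w by (simp add: interior_cbox)
    show "path_image (rectpath a1 a3) \<subseteq> cbox a1 a3 - {w}"
      using pim w by auto
  qed auto
  have cont: "continuous_on (cbox a1 a3 - {w}) f"
    unfolding f_def using hol sub
    by (intro continuous_intros holomorphic_on_imp_continuous_on) (auto intro: holomorphic_on_subset)
  have seg: "closed_segment a1 a2 \<subseteq> cbox a1 a3 - {w}" "closed_segment a2 a3 \<subseteq> cbox a1 a3 - {w}"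
     "closed_segment a3 a4 \<subseteq> cbox a1 a3 - {w}" "closed_segment a4 a1 \<subseteq> cbox a1 a3 - {w}"
    using x R R0
    by (auto simp: closed_segment_same_Re closed_segment_same_Im closed_segment_eq_real_ivl
        in_cbox_complex_iff a1_def a2_def a3_def a4_def)
  have ci: "(f has_contour_integral contour_integral (linepath a b) f) (linepath a b)"
    if "closed_segment a b \<subseteq> cbox a1 a3 - {w}" for a b
    using cont that continuous_on_subset by (intro contour_integrable_linepath) blast
  have "(f has_contour_integral (contour_integral (linepath a1 a2) f + (contour_integral (linepath a2 a3) f
      + (contour_integral (linepath a3 a4) f + contour_integral (linepath a4 a1) f)))) (rectpath a1 a3)"
  proof -
    have "rectpath a1 a3 = linepath a1 a2 +++ linepath a2 a3 +++ linepath a3 a4 +++ linepath a4 a1"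
      by (simp add: rectpath_def Let_def a1_def a2_def a3_def a4_def)
    then show ?thesis
      by (simp only:) (intro has_contour_integral_join ci seg valid_path_join valid_path_linepath, simp_all)
  qed
  from has_contour_integral_unique[OF this cauchy]
  have total: "contour_integral (linepath a1 a2) f + contour_integral (linepath a2 a3) f
      + contour_integral (linepath a3 a4) f + contour_integral (linepath a4 a1) f = 2 * pi * \<i> * F w"
    using winding_number_rectpath[OF w] by (simp add: add.assoc)
  have set_eq: "(LBINT y:{a..b}. g y) = I"
    if "(g has_integral I) {a..b}" "continuous_on {a..b} g" for g :: "real \<Rightarrow> complex" and a b I
    using borel_integrable_atLeastAtMost'[OF that(2)] that(1)
    by (metis integral_unique set_borel_integral_eq_integral(2))
  have contv: "continuous_on A (\<lambda>y. F (Complex s y) / (Complex s y - w))"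
    if "\<And>y. y \<in> A \<Longrightarrow> Complex s y \<in> cbox a1 a3 - {w}" for A s
  proof -
    have "continuous_on A (\<lambda>y. Complex s y)"
      unfolding Complex_eq by (intro continuous_intros)
    then have "continuous_on A (\<lambda>y. f (Complex s y))"
      by (rule continuous_on_compose2[OF cont]) (use that in blast)
    then show ?thesis
      by (simp add: f_def)
  qed
  have conth: "continuous_on A (\<lambda>s. F (Complex s y) / (Complex s y - w))"
    if "\<And>s. s \<in> A \<Longrightarrow> Complex s y \<in> cbox a1 a3 - {w}" for A y
  proof -
    have "continuous_on A (\<lambda>s. Complex s y)"
      unfolding Complex_eq by (intro continuous_intros)
    then have "continuous_on A (\<lambda>s. f (Complex s y))"
      by (rule continuous_on_compose2[OF cont]) (use that in blast)
    then show ?thesis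
      by (simp add: f_def)
  qed
  \<comment> \<open>On a vertical edge d\<zeta> = \<i> dy, whence the factor - \<i>.\<close>
  have v: "(LBINT y:{-R..R}. F (Complex s y) / (Complex s y - w)) = - \<i> * contour_integral (linepath (Complex s (-R)) (Complex s R)) f"
    if s: "s = x0 \<or> s = X" for s
  proof (rule set_eq)
    have "(f has_contour_integral contour_integral (linepath (Complex s (-R)) (Complex s R)) f) (linepath (Complex s (-R)) (Complex s R))"
      using seg s by (intro ci) (auto simp: a1_def a2_def a3_def a4_def closed_segment_commute)
    then show "((\<lambda>y. F (Complex s y) / (Complex s y - w)) has_integral - \<i> * contour_integral (linepath (Complex s (-R)) (Complex s R)) f) {-R..R}"
      using R0 by (subst (asm) has_contour_integral_linepath_same_Re_iff) (auto simp: f_def)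
    show "continuous_on {-R..R} (\<lambda>y. F (Complex s y) / (Complex s y - w))"
      using s x by (intro contv) (auto simp: in_cbox_complex_iff a1_def a3_def)
  qed
  have h: "(LBINT s:{x0..X}. F (Complex s y) / (Complex s y - w)) = contour_integral (linepath (Complex x0 y) (Complex X y)) f"
    if y: "y = R \<or> y = - R" for y
  proof (rule set_eq)
    have "(f has_contour_integral contour_integral (linepath (Complex x0 y) (Complex X y)) f) (linepath (Complex x0 y) (Complex X y))"
      using seg y by (intro ci) (auto simp: a1_def a2_def a3_def a4_def closed_segment_commute)
    then show "((\<lambda>s. F (Complex s y) / (Complex s y - w)) has_integral contour_integral (linepath (Complex x0 y) (Complex X y)) f) {x0..X}"
      using x by (subst (asm) has_contour_integral_linepath_same_Im_iff) (auto simp: f_def)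
    show "continuous_on {x0..X} (\<lambda>s. F (Complex s y) / (Complex s y - w))"
      using y x R by (intro conth) (auto simp: in_cbox_complex_iff a1_def a3_def)
  qed
  \<comment> \<open>The top and left edges are integrated in the direction of increasing real or
    imaginary part, against the orientation of the boundary.\<close>
  have rev: "contour_integral (linepath a3 a4) f = - contour_integral (linepath a4 a3) f"
     "contour_integral (linepath a4 a1) f = - contour_integral (linepath a1 a4) f"
    using contour_integral_reverse_linepath cont seg continuous_on_subset
    by metis+
  have neg: "F z / (w - z) = - (F z / (z - w))" for z
    by (metis minus_diff_eq minus_divide_right)
  define A B C D where "A = contour_integral (linepath a1 a2) f" and "B = contour_integral (linepath a2 a3) f"
    and "C = contour_integral (linepath a4 a3) f" and "D = contour_integral (linepath a1 a4) f"
  have tot: "A + B - C - D = 2 * pi * \<i> * F w"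
    using total by (simp add: rev A_def B_def C_def D_def)
  have set_neg: "(LBINT y:S. - g y) = - (LBINT y:S. g y)" for S :: "real set" and g :: "real \<Rightarrow> complex"
    by (simp add: set_lebesgue_integral_def)
  have "2 * pi * F w = - \<i> * (A + B - C - D)"
    by (simp add: tot)
  also have "\<dots> = \<i> * D - \<i> * B - \<i> * A + \<i> * C"
    by (simp add: algebra_simps)
  finally show ?thesis
    unfolding neg set_neg v[OF disjI1[OF refl]] v[OF disjI2[OF refl]] h[OF disjI1[OF refl]] h[OF disjI2[OF refl]]
    by (simp add: A_def B_def C_def D_def a1_def a2_def a3_def a4_def)
qed

lemma has_bochner_integral_inverse_square_line:
  assumes "a \<noteq> 0"
  shows "has_bochner_integral lborel (\<lambda>y. 1 / (a\<^sup>2 + (y - b)\<^sup>2)) (pi / \<bar>a\<bar>)"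
proof -
  define c where "c = \<bar>a\<bar>"
  have c: "c > 0" "a\<^sup>2 = c\<^sup>2" using assms by (auto simp: c_def)
  have nz: "c\<^sup>2 + (y - b)\<^sup>2 \<noteq> 0" for y
    using c by (smt (verit) zero_le_power2 zero_less_power)
  have der: "((\<lambda>y. arctan ((y - b) / c) / c) has_real_derivative 1 / (c\<^sup>2 + (y - b)\<^sup>2)) (at y)" for y
  proof -
    have "1 + ((y - b) / c)\<^sup>2 = (c\<^sup>2 + (y - b)\<^sup>2) / c\<^sup>2"
      using c by (simp add: power_divide add_divide_distrib)
    then have "inverse (1 + ((y - b) / c)\<^sup>2) * (1 / c) / c = 1 / (c\<^sup>2 + (y - b)\<^sup>2)"
      using c(1) by (simp add: power2_eq_square)
    moreover have "((\<lambda>y. arctan ((y - b) / c) / c) has_real_derivative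
        inverse (1 + ((y - b) / c)\<^sup>2) * (1 / c) / c) (at y)"
      using c(1) by (auto intro!: derivative_eq_intros)
    ultimately show ?thesis by simp
  qed
  have cont: "isCont (\<lambda>y. 1 / (c\<^sup>2 + (y - b)\<^sup>2)) y" for y
    using nz by (intro continuous_intros) auto
  have "((\<lambda>y. arctan ((y - b) / c)) \<longlongrightarrow> pi / 2) at_top"
    using c by real_asymp
  then have top: "(((\<lambda>y. arctan ((y - b) / c) / c) \<circ> real_of_ereal) \<longlongrightarrow> pi / 2 / c) (at_left \<infinity>)"
    unfolding ereal_tendsto_simps1 using c by (intro tendsto_divide) auto
  have "((\<lambda>y. arctan ((y - b) / c)) \<longlongrightarrow> - (pi / 2)) at_bot"
    using c by real_asymp
  then have bot: "(((\<lambda>y. arctan ((y - b) / c) / c) \<circ> real_of_ereal) \<longlongrightarrow> - (pi / 2) / c) (at_right (-\<infinity>))"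
    unfolding ereal_tendsto_simps1 using c by (intro tendsto_divide) auto
  have "set_integrable lborel (einterval (-\<infinity>) \<infinity>) (\<lambda>y. 1 / (c\<^sup>2 + (y - b)\<^sup>2))"
    and "(LBINT y=-\<infinity>..\<infinity>. 1 / (c\<^sup>2 + (y - b)\<^sup>2)) = pi / 2 / c - (- (pi / 2) / c)"
    by (rule interval_integral_FTC_nonneg[OF _ der cont _ bot top]; simp)+
  then show ?thesis
    unfolding c(2) c_def[symmetric] has_bochner_integral_iff
    by (simp add: set_integrable_def interval_lebesgue_integral_def set_lebesgue_integral_def field_simps)
qed


section \<open>The Hardy space on vertical lines\<close>

lemma hardy_holomorphic: "F \<in> hardy \<Longrightarrow> F holomorphic_on right_half_plane"
  by (simp add: hardy_def)

lemma open_right_half_plane: "open right_half_plane"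
  unfolding right_half_plane_def by (rule open_halfspace_Re_gt)

text \<open>F is continuous on an open set and zero elsewhere. Measurability on the whole plane is
  what Fubini on a strip requires.\<close>

lemma hardy_measurable:
  assumes "F \<in> hardy"
  shows "F \<in> borel_measurable borel"
proof -
  have "(\<lambda>z. if z \<in> right_half_plane then F z else 0) \<in> borel_measurable borel"
    using assms open_right_half_plane
    by (intro borel_measurable_continuous_on_if holomorphic_on_imp_continuous_on hardy_holomorphic
        continuous_on_const borel_open)
  moreover have "(\<lambda>z. if z \<in> right_half_plane then F z else 0) = F"
    using assms by (auto simp: hardy_def)
  ultimately show ?thesis by simp
qed

lemma measurable_Complex [measurable (raw)]:
  assumes "f \<in> borel_measurable M" "g \<in> borel_measurable M"
  shows "(\<lambda>x. Complex (f x) (g x)) \<in> borel_measurable M"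
proof -
  have of_real: "(\<lambda>x. complex_of_real (h x)) \<in> borel_measurable M" if "h \<in> borel_measurable M" for h
    by (rule borel_measurable_continuous_on[where f = complex_of_real])
      (intro that continuous_on_of_real continuous_on_id)+
  then show ?thesis
    unfolding Complex_eq
    by (intro borel_measurable_add borel_measurable_times borel_measurable_const of_real assms)
qed

lemma hardy_line_L2:
  assumes "F \<in> hardy" "0 < x"
  shows "(\<lambda>y. F (Complex x y)) \<in> L2 lborel"
proof (rule L2I)
  show "(\<lambda>y. F (Complex x y)) \<in> borel_measurable lborel"
    by (intro measurable_compose[OF _ hardy_measurable[OF assms(1)]] measurable_Complex) auto
qed (use assms in \<open>simp add: hardy_def\<close>)

lemma hardy_line_norm:
  assumes "F \<in> hardy" "0 < x"
  shows "l2_norm lborel (\<lambda>y. F (Complex x y)) \<le> sqrt (2 * pi) * hardy_norm F"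
proof -
  have "sqrt (1 / (2 * pi) * (LINT y|lborel. (cmod (F (Complex x y)))\<^sup>2)) \<le> hardy_norm F"
    unfolding hardy_norm_def using assms by (intro cSUP_upper) (auto simp: hardy_def)
  then show ?thesis
    by (simp add: l2_norm_def real_sqrt_mult real_sqrt_divide field_simps)
qed

lemma hardyI:
  assumes "F holomorphic_on right_half_plane" "\<And>z. z \<notin> right_half_plane \<Longrightarrow> F z = 0"
    and "\<And>x. 0 < x \<Longrightarrow> (\<lambda>y. F (Complex x y)) \<in> L2 lborel"
    and "\<And>x. 0 < x \<Longrightarrow> l2_norm lborel (\<lambda>y. F (Complex x y)) \<le> sqrt (2 * pi) * B"
  shows "F \<in> hardy" "hardy_norm F \<le> B"
proof -
  have le: "sqrt (1 / (2 * pi) * (LINT y|lborel. (cmod (F (Complex x y)))\<^sup>2)) \<le> B" if "0 < x" for x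
    using assms(4)[OF that] by (simp add: l2_norm_def real_sqrt_mult real_sqrt_divide field_simps)
  then show "F \<in> hardy"
    using assms by (auto simp: hardy_def L2_def intro!: bdd_aboveI2[where M = B])
  show "hardy_norm F \<le> B"
    unfolding hardy_norm_def using le by (intro cSUP_least) auto
qed

lemma hardy_norm_nonneg: "F \<in> hardy \<Longrightarrow> 0 \<le> hardy_norm F"
  using order_trans[OF l2_norm_nonneg hardy_line_norm[of F 1]] pi_gt_zero by (auto simp: zero_le_mult_iff)

text \<open>The Cauchy kernel on the imaginary axis. On the line Re \<zeta> = s the kernel 1 / (w -
  \<zeta>) is \<open>line_kernel (w - of_real s)\<close>, so a translation of w replaces the choice
  of a line.\<close>

definition line_kernel :: "complex \<Rightarrow> real \<Rightarrow> complex" where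
  "line_kernel w y = 1 / (w - \<i> * complex_of_real y)"

lemma cmod_line_kernel: "(cmod (line_kernel w y))\<^sup>2 = 1 / ((Re w)\<^sup>2 + (y - Im w)\<^sup>2)"
  by (simp add: line_kernel_def norm_divide power_divide cmod_power2 power2_commute)

lemma line_kernel_measurable [measurable]: "line_kernel w \<in> borel_measurable borel"
  unfolding line_kernel_def by measurable

lemma line_kernel_L2: "Re w \<noteq> 0 \<Longrightarrow> line_kernel w \<in> L2 lborel"
  using has_bochner_integral_inverse_square_line[of "Re w" "Im w"]
  by (intro L2I) (auto simp: cmod_line_kernel has_bochner_integral_iff)

lemma line_kernel_norm: "Re w \<noteq> 0 \<Longrightarrow> l2_norm lborel (line_kernel w) = sqrt (pi / \<bar>Re w\<bar>)"
  using has_bochner_integral_inverse_square_line[of "Re w" "Im w"]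
  by (simp add: l2_norm_def cmod_line_kernel has_bochner_integral_iff)

text \<open>By Fubini's theorem on the strip, the heights violating the bound have finite measure.\<close>

lemma hardy_strip_heights:
  assumes F: "F \<in> hardy" and x: "0 < x0" "x0 < X"
  shows "\<exists>R\<ge>real n. (LBINT s:{x0..X}. (cmod (F (Complex s R)))\<^sup>2) \<le> 1
    \<and> (LBINT s:{x0..X}. (cmod (F (Complex s (- R))))\<^sup>2) \<le> 1"
proof (rule ccontr)
  assume neg: "\<not> ?thesis"
  have [measurable]: "F \<in> borel_measurable borel" using F by (rule hardy_measurable)
  define H where "H y = (\<integral>\<^sup>+s. ennreal (indicator {x0..X} s * (cmod (F (Complex s y)))\<^sup>2) \<partial>lborel)" for y
  have [measurable]: "H \<in> borel_measurable borel"
    unfolding H_def by measurable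
  have real_le: "(LBINT s:{x0..X}. (cmod (F (Complex s y)))\<^sup>2) \<le> 1" if "H y \<le> 1" for y
  proof -
    have "continuous_on {x0..X} (\<lambda>s. F (Complex s y))"
      by (rule continuous_on_compose2[OF holomorphic_on_imp_continuous_on[OF hardy_holomorphic[OF F]]])
        (use x in \<open>auto simp: Complex_eq right_half_plane_def intro!: continuous_intros\<close>)
    then have "set_integrable lborel {x0..X} (\<lambda>s. (cmod (F (Complex s y)))\<^sup>2)"
      by (intro borel_integrable_atLeastAtMost' continuous_intros)
    then have "H y = ennreal (LBINT s:{x0..X}. (cmod (F (Complex s y)))\<^sup>2)"
      unfolding H_def set_lebesgue_integral_def set_integrable_def
      by (subst nn_integral_eq_integral) auto
    then show ?thesis
      using that by (simp add: ennreal_le_1)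
  qed
  have "(\<integral>\<^sup>+y. H y \<partial>lborel)
      = (\<integral>\<^sup>+s. (\<integral>\<^sup>+y. ennreal (indicator {x0..X} s * (cmod (F (Complex s y)))\<^sup>2) \<partial>lborel) \<partial>lborel)"
    unfolding H_def by (rule lborel_pair.Fubini') measurable
  also have "\<dots> \<le> (\<integral>\<^sup>+s. ennreal (2 * pi * (hardy_norm F)\<^sup>2) * indicator {x0..X} s \<partial>lborel)"
  proof (rule nn_integral_mono)
    fix s :: real
    show "(\<integral>\<^sup>+y. ennreal (indicator {x0..X} s * (cmod (F (Complex s y)))\<^sup>2) \<partial>lborel)
        \<le> ennreal (2 * pi * (hardy_norm F)\<^sup>2) * indicator {x0..X} s"
    proof (cases "s \<in> {x0..X}")
      case True
      then have s: "s > 0" using x by auto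
      have "(\<integral>\<^sup>+y. ennreal ((cmod (F (Complex s y)))\<^sup>2) \<partial>lborel) = ennreal ((l2_norm lborel (\<lambda>y. F (Complex s y)))\<^sup>2)"
        using hardy_line_L2[OF F s] by (subst nn_integral_eq_integral) (auto simp: L2_def l2_norm_sq)
      also have "\<dots> \<le> ennreal ((sqrt (2 * pi) * hardy_norm F)\<^sup>2)"
        using hardy_line_norm[OF F s] by (intro ennreal_leI power_mono) auto
      finally show ?thesis
        using True by (simp add: power_mult_distrib)
    qed simp
  qed
  also have "\<dots> < \<infinity>"
    using x by (simp add: nn_integral_cmult_indicator ennreal_mult_less_top)
  finally have fin: "(\<integral>\<^sup>+y. H y \<partial>lborel) < \<infinity>" .
  have "(\<integral>\<^sup>+y. H (- y) \<partial>lborel) = (\<integral>\<^sup>+y. H y \<partial>lborel)"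
    using nn_integral_real_affine[of H "-1" 0] by simp
  then have "(\<integral>\<^sup>+y. H y + H (- y) \<partial>lborel) < \<infinity>"
    using fin by (subst nn_integral_add) (auto simp: ennreal_add_less_top)
  \<comment> \<open>For y \<ge> n at least one of the heights y and - y violates its bound, so the
    sum is at least 1 on a half-line of infinite measure. Both signs occur because a rectangle has
    two horizontal edges.\<close>
  moreover have "(\<integral>\<^sup>+y. indicator {real n..} y \<partial>lborel) \<le> (\<integral>\<^sup>+y. H y + H (- y) \<partial>lborel)"
  proof (rule nn_integral_mono)
    fix y :: real
    show "indicator {real n..} y \<le> H y + H (- y)"
    proof (cases "y \<ge> real n")
      case True
      then have "\<not> (H y \<le> 1 \<and> H (- y) \<le> 1)"
        using neg real_le by blast
      then have "1 \<le> H y + H (- y)"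
        by (metis add_increasing add_increasing2 linear zero_le)
      then show ?thesis using True by simp
    qed simp
  qed
  ultimately have "emeasure lborel {real n..} < \<infinity>"
    by (simp add: less_le_trans le_less_trans)
  then obtain k :: nat where "emeasure lborel {real n..} < of_nat k"
    using ennreal_Ex_less_of_nat by auto
  moreover have "emeasure lborel {real n..real n + real k} \<le> emeasure lborel {real n..}"
    by (intro emeasure_mono) auto
  ultimately show False
    by (simp add: ennreal_of_nat_eq_real_of_nat)
qed

text \<open>Only the left edge survives. The horizontal edges vanish along the heights of
  \<open>hardy_strip_heights\<close>, where the mean square of F is bounded while the kernel is at
  most 1 / (R - \<bar>Im w\<bar>). The right edge is of order (X - Re w)^(-1/2) by Cauchy-Schwarz,
  since the norms of F on lines are bounded.\<close>

lemma cauchy_line: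
  fixes F :: "complex \<Rightarrow> complex"
  assumes F: "F \<in> hardy" and x: "0 < x0" "x0 < Re w"
  shows "2 * pi * F w = (LBINT y. F (Complex x0 y) / (w - Complex x0 y))"
proof -
  have [measurable]: "F \<in> borel_measurable borel" using F by (rule hardy_measurable)
  define I where "I s = (LBINT y. F (Complex s y) / (w - Complex s y))" for s
  have kern: "F (Complex s y) / (w - Complex s y) = F (Complex s y) * line_kernel (w - of_real s) y" for s y
    by (simp add: line_kernel_def Complex_eq algebra_simps)
  have int: "integrable lborel (\<lambda>y. F (Complex s y) / (w - Complex s y))" if "0 < s" "s \<noteq> Re w" for s
    unfolding kern using that by (intro L2_integrable_mult hardy_line_L2[OF F] line_kernel_L2) auto
  \<comment> \<open>The heights depend on the strip, hence on X: X stays fixed while they tend to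
    infinity, and only the resulting estimate is sent to the limit in X.\<close>
  have bound: "cmod (2 * pi * F w - I x0) \<le> sqrt (2 * pi) * hardy_norm F * sqrt (pi / (X - Re w))"
    if X: "Re w < X" for X
  proof -
    have x0X: "x0 < X" using x X by simp
    obtain R where R: "\<And>n. R n \<ge> real n"
        "\<And>n. (LBINT s:{x0..X}. (cmod (F (Complex s (R n))))\<^sup>2) \<le> 1"
        "\<And>n. (LBINT s:{x0..X}. (cmod (F (Complex s (- R n))))\<^sup>2) \<le> 1"
      using hardy_strip_heights[OF F x(1) x0X] by metis
    have Rlim: "filterlim R at_top sequentially"
      using R(1) by (intro filterlim_at_top_mono[OF filterlim_real_sequentially]) auto
    have vert: "(\<lambda>n. LBINT y:{-R n..R n}. F (Complex s y) / (w - Complex s y)) \<longlonglongrightarrow> I s"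
      if "0 < s" "s \<noteq> Re w" for s
      unfolding I_def set_lebesgue_integral_def
    proof (rule integral_dominated_convergence[where w = "\<lambda>y. cmod (F (Complex s y) / (w - Complex s y))"])
      show "AE y in lborel. (\<lambda>n. indicat_real {-R n..R n} y *\<^sub>R (F (Complex s y) / (w - Complex s y)))
          \<longlonglongrightarrow> F (Complex s y) / (w - Complex s y)"
      proof (rule AE_I2)
        fix y :: real
        have "eventually (\<lambda>n. \<bar>y\<bar> \<le> R n) sequentially"
          using Rlim by (simp add: filterlim_at_top)
        then have "eventually (\<lambda>n. indicat_real {-R n..R n} y *\<^sub>R (F (Complex s y) / (w - Complex s y))
            = F (Complex s y) / (w - Complex s y)) sequentially"
          by eventually_elim (auto simp: abs_le_iff split: split_indicator)
        then show "(\<lambda>n. indicat_real {-R n..R n} y *\<^sub>R (F (Complex s y) / (w - Complex s y)))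
            \<longlonglongrightarrow> F (Complex s y) / (w - Complex s y)"
          by (rule tendsto_eventually)
      qed
      show "integrable lborel (\<lambda>y. cmod (F (Complex s y) / (w - Complex s y)))"
        using int[OF that] by (rule integrable_norm)
    qed (auto split: split_indicator)
    have hor: "(\<lambda>n. LBINT s:{x0..X}. F (Complex s (k * R n)) / (w - Complex s (k * R n))) \<longlonglongrightarrow> 0"
      if k: "k = 1 \<or> k = - 1" for k
    proof (rule Lim_null_comparison)
      show "eventually (\<lambda>n. norm (LBINT s:{x0..X}. F (Complex s (k * R n)) / (w - Complex s (k * R n)))
          \<le> (X - x0 + 1) / (R n - \<bar>Im w\<bar>)) sequentially"
        using filterlim_at_top_dense[THEN iffD1, OF Rlim, rule_format, of "\<bar>Im w\<bar>"]
      proof eventually_elim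
        case (elim n)
        define q where "q = R n - \<bar>Im w\<bar>"
        have q: "q > 0" using elim by (simp add: q_def)
        have den: "cmod (w - Complex s (k * R n)) \<ge> q" for s
          using abs_Im_le_cmod[of "w - Complex s (k * R n)"] k by (auto simp: q_def)
        have den0: "w - Complex s (k * R n) \<noteq> 0" for s
          using den[of s] q by auto
        have cont: "continuous_on {x0..X} (\<lambda>s. F (Complex s y))" for y
          by (rule continuous_on_compose2[OF holomorphic_on_imp_continuous_on[OF hardy_holomorphic[OF F]]])
            (use x in \<open>auto simp: Complex_eq right_half_plane_def intro!: continuous_intros\<close>)
        have contC: "continuous_on {x0..X} (\<lambda>s. Complex s y)" for y
          unfolding Complex_eq by (intro continuous_intros)
        have i1: "set_integrable lborel {x0..X} (\<lambda>s. F (Complex s (k * R n)) / (w - Complex s (k * R n)))"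
          by (intro borel_integrable_atLeastAtMost' continuous_on_divide cont continuous_on_diff
              continuous_on_const contC) (use den0 in auto)
        have i2: "set_integrable lborel {x0..X} (\<lambda>s. (1 + (cmod (F (Complex s (k * R n))))\<^sup>2) / q)"
          using cont q by (intro borel_integrable_atLeastAtMost' continuous_intros) auto
        have i3: "set_integrable lborel {x0..X} (\<lambda>s. (cmod (F (Complex s (k * R n))))\<^sup>2)"
          using cont by (intro borel_integrable_atLeastAtMost' continuous_intros)
        have i4: "set_integrable lborel {x0..X} (\<lambda>s. 1::real)"
          by (intro borel_integrable_atLeastAtMost' continuous_intros)
        have "norm (LBINT s:{x0..X}. F (Complex s (k * R n)) / (w - Complex s (k * R n)))
            \<le> (LBINT s:{x0..X}. cmod (F (Complex s (k * R n)) / (w - Complex s (k * R n))))"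
          by (rule set_integral_norm_bound[OF i1])
        also have "\<dots> \<le> (LBINT s:{x0..X}. (1 + (cmod (F (Complex s (k * R n))))\<^sup>2) / q)"
        proof (rule set_integral_mono[OF set_integrable_norm[OF i1] i2])
          fix s
          \<comment> \<open>Bounds the modulus by its square, since it is the mean square over the
            edge that is controlled.\<close>
          have "a \<le> 1 + a\<^sup>2" for a :: real
          proof -
            have "2 * a \<le> a\<^sup>2 + 1" "0 \<le> a\<^sup>2"
              using sum_squares_bound[of a 1] by simp_all
            then show ?thesis by linarith
          qed
          then show "cmod (F (Complex s (k * R n)) / (w - Complex s (k * R n))) \<le> (1 + (cmod (F (Complex s (k * R n))))\<^sup>2) / q"
            unfolding norm_divide using q den by (intro frac_le) auto
        qed
        also have "\<dots> = ((LBINT s:{x0..X}. 1) + (LBINT s:{x0..X}. (cmod (F (Complex s (k * R n))))\<^sup>2)) / q"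
          using set_integral_add(2)[OF i4 i3] by simp
        also have "\<dots> \<le> (X - x0 + 1) / q"
          using q R(2)[of n] R(3)[of n] k x0X
          by (intro divide_right_mono) (auto simp: set_lebesgue_integral_def)
        finally show ?case by (simp add: q_def)
      qed
      have "filterlim (\<lambda>n. R n - \<bar>Im w\<bar>) at_top sequentially"
        using filterlim_tendsto_add_at_top[OF tendsto_const Rlim, of "- \<bar>Im w\<bar>"] by simp
      then show "(\<lambda>n. (X - x0 + 1) / (R n - \<bar>Im w\<bar>)) \<longlonglongrightarrow> 0"
        by (intro real_tendsto_divide_at_top[OF tendsto_const])
    qed
    have "(\<lambda>n. (LBINT y:{-R n..R n}. F (Complex x0 y) / (w - Complex x0 y))
       - (LBINT y:{-R n..R n}. F (Complex X y) / (w - Complex X y))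
       + \<i> * (LBINT s:{x0..X}. F (Complex s (-1 * R n)) / (w - Complex s (-1 * R n)))
       - \<i> * (LBINT s:{x0..X}. F (Complex s (1 * R n)) / (w - Complex s (1 * R n))))
       \<longlonglongrightarrow> I x0 - I X + \<i> * 0 - \<i> * 0"
      using x X by (intro tendsto_intros vert hor) auto
    moreover have "eventually (\<lambda>n. (LBINT y:{-R n..R n}. F (Complex x0 y) / (w - Complex x0 y))
       - (LBINT y:{-R n..R n}. F (Complex X y) / (w - Complex X y))
       + \<i> * (LBINT s:{x0..X}. F (Complex s (-1 * R n)) / (w - Complex s (-1 * R n)))
       - \<i> * (LBINT s:{x0..X}. F (Complex s (1 * R n)) / (w - Complex s (1 * R n))) = 2 * pi * F w) sequentially"
      using filterlim_at_top_dense[THEN iffD1, OF Rlim, rule_format, of "\<bar>Im w\<bar>"]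
      by eventually_elim (use Cauchy_integral_rectangle[OF hardy_holomorphic[OF F] x X] in simp)
    ultimately have "(\<lambda>n. 2 * pi * F w) \<longlonglongrightarrow> I x0 - I X + \<i> * 0 - \<i> * 0"
      by (rule Lim_transform_eventually)
    then have "2 * pi * F w = I x0 - I X"
      by (simp add: LIMSEQ_const_iff)
    then have "cmod (2 * pi * F w - I x0) = cmod (I X)"
      by simp
    also have "I X = l2_inner lborel (\<lambda>y. F (Complex X y)) (\<lambda>y. cnj (line_kernel (w - of_real X) y))"
      by (simp add: I_def kern l2_inner_def)
    also have "cmod \<dots> \<le> l2_norm lborel (\<lambda>y. F (Complex X y)) * l2_norm lborel (\<lambda>y. cnj (line_kernel (w - of_real X) y))"
      using x X by (intro l2_cauchy_schwarz hardy_line_L2[OF F] L2_cnj line_kernel_L2) auto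
    also have "\<dots> = l2_norm lborel (\<lambda>y. F (Complex X y)) * sqrt (pi / (X - Re w))"
      using X by (simp add: l2_norm_cnj line_kernel_norm)
    also have "\<dots> \<le> sqrt (2 * pi) * hardy_norm F * sqrt (pi / (X - Re w))"
      using x X by (intro mult_right_mono hardy_line_norm[OF F]) auto
    finally show ?thesis .
  qed
  have "((\<lambda>X. sqrt (2 * pi) * hardy_norm F * sqrt (pi / (X - Re w))) \<longlongrightarrow> 0) at_top"
  proof -
    have "((\<lambda>X. pi / (X - Re w)) \<longlongrightarrow> 0) at_top"
      by real_asymp
    then have "((\<lambda>X. sqrt (pi / (X - Re w))) \<longlongrightarrow> 0) at_top"
      using tendsto_real_sqrt[of "\<lambda>X. pi / (X - Re w)" 0 at_top] by simp
    then show ?thesis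
      by (rule tendsto_mult_right_zero)
  qed
  moreover have "eventually (\<lambda>X. cmod (2 * pi * F w - I x0) \<le> sqrt (2 * pi) * hardy_norm F * sqrt (pi / (X - Re w))) at_top"
    using eventually_gt_at_top[of "Re w"] by eventually_elim (rule bound)
  ultimately have "cmod (2 * pi * F w - I x0) \<le> 0"
    by (intro tendsto_lowerbound) auto
  then show ?thesis
    by (simp add: I_def)
qed

section \<open>Norms of linear combinations and Gram matrices\<close>

lemma l2_norm_sum_sq:
  assumes "\<And>i. i \<in> I \<Longrightarrow> b i \<in> L2 M"
  shows "complex_of_real ((l2_norm M (\<lambda>t. \<Sum>i\<in>I. c i * b i t))\<^sup>2)
    = (\<Sum>i\<in>I. \<Sum>j\<in>I. c i * cnj (c j) * l2_inner M (b i) (b j))"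
  using assms
  by (simp add: l2_inner_self[symmetric] l2_inner_sum_left l2_inner_sum_right L2_sum
      sum_distrib_left mult.assoc del: of_real_power)

text \<open>The norm of a finite combination depends on the Gram matrix alone. With k = 2 * pi this
  exchanges Cauchy kernels on a line for exponentials, with k = 1 one family of averages for the
  other.\<close>

lemma l2_norm_sum_gram:
  assumes b: "\<And>i. i \<in> I \<Longrightarrow> b i \<in> L2 M" and b': "\<And>i. i \<in> I \<Longrightarrow> b' i \<in> L2 M'"
    and gram: "\<And>i j. i \<in> I \<Longrightarrow> j \<in> I \<Longrightarrow> l2_inner M (b i) (b j) = of_real k * l2_inner M' (b' i) (b' j)"
    and k: "0 \<le> k"
  shows "l2_norm M (\<lambda>t. \<Sum>i\<in>I. c i * b i t) = sqrt k * l2_norm M' (\<lambda>t. \<Sum>i\<in>I. c i * b' i t)"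
proof -
  have sums: "complex_of_real ((l2_norm M (\<lambda>t. \<Sum>i\<in>I. c i * b i t))\<^sup>2)
      = (\<Sum>i\<in>I. \<Sum>j\<in>I. c i * cnj (c j) * l2_inner M (b i) (b j))"
    "complex_of_real ((l2_norm M' (\<lambda>t. \<Sum>i\<in>I. c i * b' i t))\<^sup>2)
      = (\<Sum>i\<in>I. \<Sum>j\<in>I. c i * cnj (c j) * l2_inner M' (b' i) (b' j))"
    using l2_norm_sum_sq[of I b M c] l2_norm_sum_sq[of I b' M' c] b b' by blast+
  have "complex_of_real ((l2_norm M (\<lambda>t. \<Sum>i\<in>I. c i * b i t))\<^sup>2)
      = of_real k * complex_of_real ((l2_norm M' (\<lambda>t. \<Sum>i\<in>I. c i * b' i t))\<^sup>2)"
    unfolding sums sum_distrib_left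
  proof (rule sum.cong[OF refl], rule sum.cong[OF refl])
    fix i j assume "i \<in> I" "j \<in> I"
    then have "l2_inner M (b i) (b j) = of_real k * l2_inner M' (b' i) (b' j)"
      by (rule gram)
    then show "c i * cnj (c j) * l2_inner M (b i) (b j) = of_real k * (c i * cnj (c j) * l2_inner M' (b' i) (b' j))"
      by (simp only: mult_ac)
  qed
  then have "(l2_norm M (\<lambda>t. \<Sum>i\<in>I. c i * b i t))\<^sup>2 = k * (l2_norm M' (\<lambda>t. \<Sum>i\<in>I. c i * b' i t))\<^sup>2"
    by (simp only: of_real_eq_iff flip: of_real_mult)
  then have "sqrt ((l2_norm M (\<lambda>t. \<Sum>i\<in>I. c i * b i t))\<^sup>2)
      = sqrt (k * (l2_norm M' (\<lambda>t. \<Sum>i\<in>I. c i * b' i t))\<^sup>2)"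
    by simp
  then show ?thesis
    by (simp add: real_sqrt_mult)
qed

lemma kernel_hardy:
  assumes "0 < Re v"
  shows "zero_ext right_half_plane (\<lambda>z. 1 / (z + v)) \<in> hardy"
proof (rule hardyI(1))
  have nz: "z + v \<noteq> 0" if "0 < Re z" for z
  proof
    assume "z + v = 0"
    then have "Re z + Re v = 0" by (metis plus_complex.sel(1) zero_complex.sel(1))
    then show False using that assms by simp
  qed
  have "(\<lambda>z. 1 / (z + v)) holomorphic_on right_half_plane"
    by (intro holomorphic_intros) (use nz in \<open>auto simp: right_half_plane_def\<close>)
  then show "zero_ext right_half_plane (\<lambda>z. 1 / (z + v)) holomorphic_on right_half_plane"
    by (rule holomorphic_transform) (simp add: zero_ext_def)
  fix x :: real assume x: "0 < x"
  have eq: "zero_ext right_half_plane (\<lambda>z. 1 / (z + v)) (Complex x y) = cnj (line_kernel (of_real x + cnj v) y)" for y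
    using x by (simp add: zero_ext_def right_half_plane_def line_kernel_def Complex_eq add_ac)
  show "(\<lambda>y. zero_ext right_half_plane (\<lambda>z. 1 / (z + v)) (Complex x y)) \<in> L2 lborel"
    unfolding eq using x assms by (intro L2_cnj line_kernel_L2) auto
  have "l2_norm lborel (\<lambda>y. zero_ext right_half_plane (\<lambda>z. 1 / (z + v)) (Complex x y)) = sqrt (pi / (x + Re v))"
    unfolding eq l2_norm_cnj using x assms by (subst line_kernel_norm) auto
  \<comment> \<open>A crude bound, uniform in x; only membership is at stake.\<close>
  also have "\<dots> \<le> sqrt (2 * pi * (1 / Re v))"
    using x assms by (intro real_sqrt_le_mono) (auto simp: field_simps)
  finally show "l2_norm lborel (\<lambda>y. zero_ext right_half_plane (\<lambda>z. 1 / (z + v)) (Complex x y))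
      \<le> sqrt (2 * pi) * sqrt (1 / Re v)"
    by (simp only: real_sqrt_mult)
qed (simp add: zero_ext_def)

lemma line_kernel_inner:
  assumes w: "0 < Re w" and v: "0 < Re v"
  shows "l2_inner lborel (line_kernel w) (line_kernel v) = of_real (2 * pi) * l2_inner pos (expfun w) (expfun v)"
proof -
  \<comment> \<open>Half of Re v leaves room on both sides: the line Re z = x0 lies in the
    half-plane, and the pole of F stays to the left of the imaginary axis. On that line F is the
    conjugate of \<open>line_kernel v\<close>, so Cauchy's formula at w + x0 is the inner
    product.\<close>
  define x0 where "x0 = Re v / 2"
  define F where "F = zero_ext right_half_plane (\<lambda>z. 1 / (z + (cnj v - of_real x0)))"
  have x0: "0 < x0" using v by (simp add: x0_def)
  have F: "F \<in> hardy"
    unfolding F_def using v by (intro kernel_hardy) (simp add: x0_def)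
  have "2 * pi * F (w + of_real x0) = (LBINT y. F (Complex x0 y) / (w + of_real x0 - Complex x0 y))"
    using w x0 by (intro cauchy_line[OF F]) auto
  also have "(\<lambda>y. F (Complex x0 y) / (w + of_real x0 - Complex x0 y)) = (\<lambda>y. line_kernel w y * cnj (line_kernel v y))"
    using x0 by (simp add: F_def zero_ext_def right_half_plane_def line_kernel_def Complex_eq algebra_simps)
  finally have "2 * pi * F (w + of_real x0) = l2_inner lborel (line_kernel w) (line_kernel v)"
    by (simp add: l2_inner_def)
  moreover have "F (w + of_real x0) = 1 / (w + cnj v)"
    using w x0 by (simp add: F_def zero_ext_def right_half_plane_def)
  ultimately show ?thesis
    using w v by (simp add: expfun_inner)
qed

section \<open>The Paley--Wiener theorem\<close>

text \<open>Evaluating at w + x by Cauchy's formula on the line Re z = x involves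
  \<open>line_kernel w\<close>, which does not depend on x. The estimate is therefore uniform in x,
  and continuity of F gives it at x = 0. The two factors sqrt (2 * pi), from the norm of F on the
  line and from the Gram matrix, cancel the 2 * pi of the formula.\<close>

lemma hardy_combination_bound:
  assumes F: "F \<in> hardy" and S: "finite S" "S \<subseteq> right_half_plane"
  shows "cmod (\<Sum>w\<in>S. c w * F w) \<le> hardy_norm F * l2_norm pos (\<lambda>t. \<Sum>w\<in>S. c w * expfun w t)"
proof -
  have Re: "0 < Re w" if "w \<in> S" for w using S(2) that by (auto simp: right_half_plane_def)
  have kernel_L2: "line_kernel w \<in> L2 lborel" and exp_L2: "expfun w \<in> L2 pos" if "w \<in> S" for w
    using Re[OF that] by (auto intro: line_kernel_L2 expfun_L2)
  define E where "E = hardy_norm F * l2_norm pos (\<lambda>t. \<Sum>w\<in>S. c w * expfun w t)"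
  have shifted: "cmod (\<Sum>w\<in>S. c w * F (w + of_real x)) \<le> E" if x: "0 < x" for x
  proof -
    define K where "K y = (\<Sum>w\<in>S. c w * line_kernel w y)" for y
    have K: "K \<in> L2 lborel"
      unfolding K_def by (intro L2_sum kernel_L2)
    have Knorm: "l2_norm lborel K = sqrt (2 * pi) * l2_norm pos (\<lambda>t. \<Sum>w\<in>S. c w * expfun w t)"
      unfolding K_def
      by (rule l2_norm_sum_gram[OF kernel_L2 exp_L2 line_kernel_inner[OF Re Re]]) auto
    have "2 * pi * F (w + of_real x) = (LBINT y. F (Complex x y) * line_kernel w y)" if "w \<in> S" for w
    proof -
      have "F (Complex x y) / (w + of_real x - Complex x y) = F (Complex x y) * line_kernel w y" for y
        by (simp add: line_kernel_def Complex_eq algebra_simps)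
      then show ?thesis
        using cauchy_line[OF F x, of "w + of_real x"] Re[OF that] by simp
    qed
    then have "2 * pi * (\<Sum>w\<in>S. c w * F (w + of_real x)) = (\<Sum>w\<in>S. c w * (LBINT y. F (Complex x y) * line_kernel w y))"
      by (simp add: sum_distrib_left mult.left_commute)
    also have "\<dots> = (LBINT y. (\<Sum>w\<in>S. c w * (F (Complex x y) * line_kernel w y)))"
    proof -
      have "integrable lborel (\<lambda>y. c w * (F (Complex x y) * line_kernel w y))" if "w \<in> S" for w
        using L2_integrable_mult[OF hardy_line_L2[OF F x] kernel_L2[OF that]] by simp
      then show ?thesis
        by (subst Bochner_Integration.integral_sum) auto
    qed
    also have "\<dots> = l2_inner lborel (\<lambda>y. F (Complex x y)) (\<lambda>y. cnj (K y))"
      by (simp add: l2_inner_def K_def sum_distrib_left mult.left_commute)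
    finally have "cmod (2 * pi * (\<Sum>w\<in>S. c w * F (w + of_real x))) = cmod (l2_inner lborel (\<lambda>y. F (Complex x y)) (\<lambda>y. cnj (K y)))"
      by (rule arg_cong)
    then have "2 * pi * cmod (\<Sum>w\<in>S. c w * F (w + of_real x)) = cmod (l2_inner lborel (\<lambda>y. F (Complex x y)) (\<lambda>y. cnj (K y)))"
      by (simp add: norm_mult)
    also have "\<dots> \<le> l2_norm lborel (\<lambda>y. F (Complex x y)) * l2_norm lborel (\<lambda>y. cnj (K y))"
      by (intro l2_cauchy_schwarz hardy_line_L2[OF F x] L2_cnj K)
    also have "\<dots> \<le> sqrt (2 * pi) * hardy_norm F * l2_norm lborel K"
      unfolding l2_norm_cnj by (intro mult_right_mono hardy_line_norm[OF F x] l2_norm_nonneg)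
    also have "\<dots> = 2 * pi * E"
      by (simp add: Knorm E_def mult_ac flip: real_sqrt_mult)
    finally show ?thesis
      by simp
  qed
  have lim: "((\<lambda>x. \<Sum>w\<in>S. c w * F (w + of_real x)) \<longlongrightarrow> (\<Sum>w\<in>S. c w * F (w + of_real 0))) (at_right 0)"
  proof (intro tendsto_intros)
    fix w assume w: "w \<in> S"
    have "isCont F w"
      using hardy_holomorphic[OF F] open_right_half_plane S(2) w
      by (metis continuous_on_eq_continuous_at holomorphic_on_imp_continuous_on subsetD)
    moreover have "((\<lambda>x::real. w + of_real x) \<longlongrightarrow> w) (at_right 0)"
      by (auto intro!: tendsto_eq_intros)
    ultimately show "((\<lambda>x. F (w + of_real x)) \<longlongrightarrow> F (w + of_real 0)) (at_right 0)"
      by (simp add: isCont_tendsto_compose[where g = F])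
  qed
  have "cmod (\<Sum>w\<in>S. c w * F (w + of_real 0)) \<le> E"
  proof (rule tendsto_upperbound[OF tendsto_norm[OF lim]])
    show "eventually (\<lambda>x. cmod (\<Sum>w\<in>S. c w * F (w + of_real x)) \<le> E) (at_right 0)"
      using eventually_at_right_less[of 0] by eventually_elim (rule shifted)
  qed simp
  then show ?thesis
    by (simp add: E_def)
qed

text \<open>The duality criterion used for surjectivity, for the lower bound of the Hardy norm, for
  square-integrability of the averages and for means of Hardy functions. The representing vector is
  conjugated because it stands in the second slot of the inner product.\<close>

lemma laplace_representation:
  assumes bound: "\<And>S c. finite S \<Longrightarrow> S \<subseteq> right_half_plane \<Longrightarrow>
      cmod (\<Sum>w\<in>S. c w * F w) \<le> C * l2_norm pos (\<lambda>t. \<Sum>w\<in>S. c w * expfun w t)"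
    and C: "0 \<le> C" and outside: "\<And>z. z \<notin> right_half_plane \<Longrightarrow> F z = 0"
  obtains f where "f \<in> L2 pos" "laplace f = F" "l2_norm pos f \<le> C"
proof -
  have e: "\<And>i. i \<in> right_half_plane \<Longrightarrow> expfun i \<in> L2 pos"
    by (simp add: expfun_L2 right_half_plane_def)
  obtain h where h: "h \<in> L2 pos" "l2_norm pos h \<le> C"
      "\<And>w. w \<in> right_half_plane \<Longrightarrow> l2_inner pos (expfun w) h = F w"
    by (rule L2_riesz_family[where I = right_half_plane and b = expfun and lam = F and M = pos and C = C])
      (assumption | rule e C bound that)+
  have "laplace (\<lambda>t. cnj (h t)) = F"
  proof
    fix z
    show "laplace (\<lambda>t. cnj (h t)) z = F z"
      using h(3)[of z] outside[of z]
      by (cases "0 < Re z") (auto simp: laplace_eq laplace_outside l2_inner_def right_half_plane_def mult.commute)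
  qed
  then show ?thesis
    using that[of "\<lambda>t. cnj (h t)"] h by (simp add: L2_cnj l2_norm_cnj)
qed

text \<open>The representation theorem is applied to the functional of f itself. Its vector h is by
  construction a limit of combinations of exponentials and has the same Laplace transform as f, so
  injectivity identifies the two.\<close>

lemma expfun_dense:
  assumes f: "f \<in> L2 pos"
  obtains S c where "\<And>n::nat. finite (S n)" "\<And>n. S n \<subseteq> right_half_plane"
    "(\<lambda>n. l2_norm pos (\<lambda>t. (\<Sum>w\<in>S n. c n w * expfun w t) - f t)) \<longlonglongrightarrow> 0"
proof -
  have e: "\<And>i. i \<in> right_half_plane \<Longrightarrow> expfun i \<in> L2 pos"
    by (simp add: expfun_L2 right_half_plane_def)
  have bound: "cmod (\<Sum>w\<in>S. c w * l2_inner pos (expfun w) f) \<le> l2_norm pos f * l2_norm pos (\<lambda>t. \<Sum>w\<in>S. c w * expfun w t)"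
    if "finite S" "S \<subseteq> right_half_plane" for S c
  proof -
    have "(\<Sum>w\<in>S. c w * l2_inner pos (expfun w) f) = l2_inner pos (\<lambda>t. \<Sum>w\<in>S. c w * expfun w t) f"
      using that e f by (subst l2_inner_sum_left) auto
    also have "cmod \<dots> \<le> l2_norm pos (\<lambda>t. \<Sum>w\<in>S. c w * expfun w t) * l2_norm pos f"
      using that e f by (intro l2_cauchy_schwarz L2_sum) auto
    finally show ?thesis by (simp add: mult.commute)
  qed
  obtain h S c where h: "h \<in> L2 pos"
      "\<And>w. w \<in> right_half_plane \<Longrightarrow> l2_inner pos (expfun w) h = l2_inner pos (expfun w) f"
      "\<And>n::nat. finite (S n)" "\<And>n. S n \<subseteq> right_half_plane"
      "(\<lambda>n. l2_norm pos (\<lambda>t. (\<Sum>i\<in>S n. c n i * expfun i t) - h t)) \<longlonglongrightarrow> 0"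
    by (rule L2_riesz_family[where I = right_half_plane and b = expfun and M = pos
          and lam = "\<lambda>w. l2_inner pos (expfun w) f" and C = "l2_norm pos f"])
      (assumption | rule e l2_norm_nonneg bound that)+
  have "laplace h = laplace f"
  proof
    fix z
    show "laplace h z = laplace f z"
    proof (cases "0 < Re z")
      case True
      then have "l2_inner pos (expfun (cnj z)) h = l2_inner pos (expfun (cnj z)) f"
        by (intro h) (simp add: right_half_plane_def)
      then show ?thesis
        using True by (metis laplace_inner l2_inner_cnj)
    qed (simp add: laplace_outside)
  qed
  then have ae: "AE t in pos. h t = f t"
    by (rule laplace_inj[OF h(1) f])
  have "l2_norm pos (\<lambda>t. (\<Sum>i\<in>S n. c n i * expfun i t) - h t) = l2_norm pos (\<lambda>t. (\<Sum>i\<in>S n. c n i * expfun i t) - f t)" for n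
  proof (rule l2_norm_cong_AE)
    show "AE t in pos. (\<Sum>i\<in>S n. c n i * expfun i t) - h t = (\<Sum>i\<in>S n. c n i * expfun i t) - f t"
      using ae by eventually_elim simp
  qed (use h(1) f in \<open>auto intro!: borel_measurable_diff borel_measurable_sum borel_measurable_times dest: L2_measurable\<close>)
  then show ?thesis
    using h(3-5) that[of S c] by simp
qed

lemma laplace_combination:
  assumes "finite S" "S \<subseteq> right_half_plane" "0 < Re z"
  shows "laplace (\<lambda>t. \<Sum>w\<in>S. c w * expfun w t) z = (\<Sum>w\<in>S. c w / (z + w))"
proof -
  have "laplace (\<lambda>t. \<Sum>w\<in>S. c w * expfun w t) z = (\<Sum>w\<in>S. c w * l2_inner pos (expfun w) (expfun (cnj z)))"
    using assms unfolding laplace_inner[OF assms(3)]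
    by (subst l2_inner_sum_left) (auto intro!: expfun_L2 simp: right_half_plane_def)
  also have "\<dots> = (\<Sum>w\<in>S. c w / (z + w))"
    using assms by (intro sum.cong refl) (auto simp: expfun_inner right_half_plane_def add.commute subset_iff)
  finally show ?thesis .
qed

text \<open>On the line Re z = x the transform is the conjugate of a combination of Cauchy kernels
  at cnj w + x. The Gram matrix turns it into exponentials with the same shift, that is, into exp (-
  x t) times the conjugate of v, and this damping factor is at most 1.\<close>

lemma laplace_combination_line:
  fixes c :: "complex \<Rightarrow> complex"
  assumes S: "finite S" "S \<subseteq> right_half_plane" and x: "0 < x"
  defines "v \<equiv> \<lambda>t. \<Sum>w\<in>S. c w * expfun w t"
  shows "(\<lambda>y. laplace v (Complex x y)) \<in> L2 lborel"
    and "l2_norm lborel (\<lambda>y. laplace v (Complex x y)) \<le> sqrt (2 * pi) * l2_norm pos v"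
proof -
  have Re: "0 < Re w" if "w \<in> S" for w using S(2) that by (auto simp: right_half_plane_def)
  have Re': "Re (cnj w + of_real x) > 0" if "w \<in> S" for w using Re[OF that] x by simp
  then have Re0: "Re (cnj w + of_real x) \<noteq> 0" if "w \<in> S" for w using that by force
  have eq: "laplace v (Complex x y) = cnj (\<Sum>w\<in>S. cnj (c w) * line_kernel (cnj w + of_real x) y)" for y
    unfolding v_def using S x
    by (subst laplace_combination) (auto simp: line_kernel_def Complex_eq add_ac intro!: sum.cong)
  show "(\<lambda>y. laplace v (Complex x y)) \<in> L2 lborel"
    unfolding eq by (intro L2_cnj L2_sum line_kernel_L2) (rule Re0)
  have "l2_norm lborel (\<lambda>y. laplace v (Complex x y))
      = sqrt (2 * pi) * l2_norm pos (\<lambda>t. \<Sum>w\<in>S. cnj (c w) * expfun (cnj w + of_real x) t)"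
    unfolding eq l2_norm_cnj
    by (rule l2_norm_sum_gram[OF line_kernel_L2[OF Re0] expfun_L2[OF Re'] line_kernel_inner[OF Re' Re']]) auto
  also have "(\<lambda>t. \<Sum>w\<in>S. cnj (c w) * expfun (cnj w + of_real x) t) = (\<lambda>t. expfun (of_real x) t * cnj (v t))"
    by (simp add: v_def cnj_expfun sum_distrib_left expfun_mult[symmetric] mult_ac)
  also have "l2_norm pos \<dots> \<le> l2_norm pos v"
  proof -
    have v: "v \<in> L2 pos"
      unfolding v_def using Re by (intro L2_sum expfun_L2) auto
    have le: "cmod (expfun (of_real x) t * cnj (v t)) \<le> cmod (v t)" if "t \<in> space pos" for t
      using x that by (auto simp: norm_mult cmod_expfun space_restrict_space intro!: mult_left_le_one_le)
    have "integrable pos (\<lambda>t. (cmod (expfun (of_real x) t * cnj (v t)))\<^sup>2)"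
    proof (rule Bochner_Integration.integrable_bound[OF L2_integrable_square[OF v]])
      show "(\<lambda>t. (cmod (expfun (of_real x) t * cnj (v t)))\<^sup>2) \<in> borel_measurable pos"
        using v[THEN L2_measurable] by measurable
    qed (use le in \<open>auto intro!: AE_I2 power_mono\<close>)
    then show ?thesis
      unfolding l2_norm_def using le
      by (intro real_sqrt_le_mono integral_mono L2_integrable_square[OF v] power_mono) auto
  qed
  finally show "l2_norm lborel (\<lambda>y. laplace v (Complex x y)) \<le> sqrt (2 * pi) * l2_norm pos v"
    by simp
qed

lemma laplace_diff_bound:
  assumes "f \<in> L2 pos" "g \<in> L2 pos" "0 < Re z"
  shows "cmod (laplace f z - laplace g z) \<le> l2_norm pos (\<lambda>t. f t - g t) / sqrt (2 * Re z)"
  using laplace_bound[OF L2_diff[OF assms(1,2)] assms(3)] laplace_lincomb[OF assms(1,2), of 1 "-1" z] by simp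

text \<open>Both assertions pass through combinations of exponentials, whose transforms are
  rational. Point evaluations are bounded uniformly where Re z is bounded below, so holomorphy
  survives the limit; Fatou carries over the norms on each line.\<close>

lemma laplace_in_hardy:
  assumes f: "f \<in> L2 pos"
  shows "laplace f \<in> hardy" "hardy_norm (laplace f) \<le> l2_norm pos f"
proof -
  obtain S c where S: "\<And>n::nat. finite (S n)" "\<And>n. S n \<subseteq> right_half_plane"
    and lim: "(\<lambda>n. l2_norm pos (\<lambda>t. (\<Sum>w\<in>S n. c n w * expfun w t) - f t)) \<longlonglongrightarrow> 0"
    by (rule expfun_dense[OF f]) (assumption | rule that)+
  define v where "v n t = (\<Sum>w\<in>S n. c n w * expfun w t)" for n t
  have v: "v n \<in> L2 pos" for n
    unfolding v_def using S(2)[of n] by (intro L2_sum expfun_L2) (auto simp: right_half_plane_def)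
  have lim: "(\<lambda>n. l2_norm pos (\<lambda>t. v n t - f t)) \<longlonglongrightarrow> 0"
    using lim by (simp add: v_def)
  have pt: "(\<lambda>n. laplace (v n) z) \<longlonglongrightarrow> laplace f z" if z: "0 < Re z" for z
  proof (rule Lim_null[THEN iffD2], rule Lim_null_comparison)
    show "eventually (\<lambda>n. norm (laplace (v n) z - laplace f z) \<le> l2_norm pos (\<lambda>t. v n t - f t) / sqrt (2 * Re z)) sequentially"
      using laplace_diff_bound[OF v f z] by simp
    show "(\<lambda>n. l2_norm pos (\<lambda>t. v n t - f t) / sqrt (2 * Re z)) \<longlonglongrightarrow> 0"
      using tendsto_divide_zero[OF lim] .
  qed
  have hol_v: "laplace (v n) holomorphic_on right_half_plane" for n
  proof (rule holomorphic_transform)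
    show "(\<lambda>z. \<Sum>w\<in>S n. c n w / (z + w)) holomorphic_on right_half_plane"
    proof (intro holomorphic_intros)
      fix w z assume "w \<in> S n" "z \<in> right_half_plane"
      then have "0 < Re (z + w)" using S(2)[of n] by (auto simp: right_half_plane_def subset_iff add_pos_pos)
      then show "z + w \<noteq> 0" by (auto simp del: plus_complex.sel)
    qed
    show "(\<Sum>w\<in>S n. c n w / (z + w)) = laplace (v n) z" if "z \<in> right_half_plane" for z
      using that laplace_combination[OF S(1)[of n] S(2)[of n], of z "c n"] by (simp add: v_def[abs_def] right_half_plane_def)
  qed
  have hol: "laplace f holomorphic_on right_half_plane"
  proof (rule holomorphic_uniform_sequence[OF open_right_half_plane hol_v])
    fix z assume z: "z \<in> right_half_plane"
    \<comment> \<open>On the ball of this radius the real part stays above d, away from the boundary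
      where the evaluation bound blows up.\<close>
    define d where "d = Re z / 2"
    have d: "d > 0" using z by (simp add: d_def right_half_plane_def)
    have ball: "Re u \<ge> d" if "u \<in> cball z d" for u
    proof -
      have "Re z - Re u \<le> d"
        using that complex_Re_le_cmod[of "z - u"] by (simp add: dist_norm)
      then show ?thesis by (simp add: d_def)
    qed
    have "uniform_limit (cball z d) (\<lambda>n. laplace (v n)) (laplace f) sequentially"
    proof (rule uniform_limitI)
      fix e :: real assume e: "e > 0"
      have "eventually (\<lambda>n. l2_norm pos (\<lambda>t. v n t - f t) < e * sqrt (2 * d)) sequentially"
        using lim e d by (intro order_tendstoD(2)[OF lim]) simp
      then show "eventually (\<lambda>n. \<forall>u\<in>cball z d. dist (laplace (v n) u) (laplace f u) < e) sequentially"
      proof eventually_elim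
        case (elim n)
        show ?case
        proof
          fix u assume u: "u \<in> cball z d"
          have "dist (laplace (v n) u) (laplace f u) \<le> l2_norm pos (\<lambda>t. v n t - f t) / sqrt (2 * Re u)"
            unfolding dist_norm using ball[OF u] d by (intro laplace_diff_bound v f) simp
          also have "\<dots> \<le> l2_norm pos (\<lambda>t. v n t - f t) / sqrt (2 * d)"
            using ball[OF u] d by (intro divide_left_mono) auto
          also have "\<dots> < e"
            using elim d by (simp add: field_simps)
          finally show "dist (laplace (v n) u) (laplace f u) < e" .
        qed
      qed
    qed
    moreover have "cball z d \<subseteq> right_half_plane"
    proof
      fix u assume "u \<in> cball z d"
      from ball[OF this] d show "u \<in> right_half_plane"
        by (simp add: right_half_plane_def)
    qed
    ultimately show "\<exists>d>0. cball z d \<subseteq> right_half_plane \<and> uniform_limit (cball z d) (\<lambda>n. laplace (v n)) (laplace f) sequentially"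
      using d by blast
  qed
  have norm_lim: "(\<lambda>n. l2_norm pos (v n)) \<longlonglongrightarrow> l2_norm pos f"
    by (rule l2_norm_tendsto[OF v f lim])
  \<comment> \<open>Fatou is applied with a fixed bound, while the norms of the approximants may
    exceed that of f before the limit; hence the slack e.\<close>
  have line: "(\<lambda>y. laplace f (Complex x y)) \<in> L2 lborel \<and>
      l2_norm lborel (\<lambda>y. laplace f (Complex x y)) \<le> sqrt (2 * pi) * (l2_norm pos f + e)"
    if x: "0 < x" and e: "0 < e" for x e
  proof -
    have vl: "(\<lambda>y. laplace (v n) (Complex x y)) \<in> L2 lborel"
        "l2_norm lborel (\<lambda>y. laplace (v n) (Complex x y)) \<le> sqrt (2 * pi) * l2_norm pos (v n)" for n
      using laplace_combination_line[OF S(1)[of n] S(2)[of n] x, of "c n"] by (simp_all add: v_def[abs_def])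
    have meas: "(\<lambda>y. laplace f (Complex x y)) \<in> borel_measurable lborel"
      by (rule borel_measurable_LIMSEQ_metric[where f = "\<lambda>n y. laplace (v n) (Complex x y)"])
        (use pt x L2_measurable[OF vl(1)] in simp_all)
    have "eventually (\<lambda>n. l2_norm lborel (\<lambda>y. laplace (v n) (Complex x y)) \<le> sqrt (2 * pi) * (l2_norm pos f + e)) sequentially"
    proof -
      have "eventually (\<lambda>n. l2_norm pos (v n) < l2_norm pos f + e) sequentially"
        using e by (intro order_tendstoD(2)[OF norm_lim]) simp
      then show ?thesis
      proof eventually_elim
        case (elim n)
        then have "sqrt (2 * pi) * l2_norm pos (v n) \<le> sqrt (2 * pi) * (l2_norm pos f + e)"
          by (intro mult_left_mono) auto
        with vl(2)[of n] show ?case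
          by (rule order_trans)
      qed
    qed
    note ev = this
    have ae: "AE y in lborel. (\<lambda>n. laplace (v n) (Complex x y)) \<longlonglongrightarrow> laplace f (Complex x y)"
      using pt x by simp
    show ?thesis
      using L2_fatou[OF vl(1) meas ae ev] by blast
  qed
  have out: "laplace f z = 0" if "z \<notin> right_half_plane" for z
    using that by (simp add: laplace_def zero_ext_def)
  have *: "laplace f \<in> hardy \<and> hardy_norm (laplace f) \<le> l2_norm pos f + e" if "e > 0" for e
    using hardyI[OF hol out, of "l2_norm pos f + e"] line[OF _ that] by simp
  show "laplace f \<in> hardy"
    using *[of 1] by simp
  show "hardy_norm (laplace f) \<le> l2_norm pos f"
    by (rule field_le_epsilon) (use * in simp)
qed

theorem paley_wiener:
  assumes F: "F \<in> hardy"
  obtains f where "f \<in> L2 pos" "laplace f = F"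
  by (rule laplace_representation[OF hardy_combination_bound[OF F] hardy_norm_nonneg[OF F]])
    (use F in \<open>auto simp: hardy_def\<close>)

text \<open>The lower bound comes by duality rather than from the supremum: the transform has a
  preimage of norm at most its Hardy norm, and injectivity identifies that preimage with f.\<close>

theorem hardy_norm_laplace:
  assumes f: "f \<in> L2 pos"
  shows "hardy_norm (laplace f) = l2_norm pos f"
proof (rule antisym)
  show "hardy_norm (laplace f) \<le> l2_norm pos f"
    by (rule laplace_in_hardy[OF f])
  have H: "laplace f \<in> hardy"
    by (rule laplace_in_hardy[OF f])
  have out: "\<And>z. z \<notin> right_half_plane \<Longrightarrow> laplace f z = 0"
    by (simp add: laplace_def zero_ext_def)
  obtain g where g: "g \<in> L2 pos" "laplace g = laplace f" "l2_norm pos g \<le> hardy_norm (laplace f)"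
    by (rule laplace_representation[OF hardy_combination_bound[OF H] hardy_norm_nonneg[OF H] out])
  have "l2_norm pos g = l2_norm pos f"
    using laplace_inj[OF g(1) f g(2)] g(1) f by (intro l2_norm_cong_AE) (auto dest: L2_measurable)
  then show "l2_norm pos f \<le> hardy_norm (laplace f)"
    using g(3) by simp
qed

lemma hardy_inner_laplace:
  assumes f: "f \<in> L2 pos" and g: "g \<in> L2 pos"
  shows "hardy_inner (laplace f) (laplace g) = l2_inner pos f g"
proof -
  have "hardy_norm (\<lambda>z. laplace f z + \<i> ^ k * laplace g z) = l2_norm pos (\<lambda>t. f t + \<i> ^ k * g t)" for k
  proof -
    have "(\<lambda>z. laplace f z + \<i> ^ k * laplace g z) = laplace (\<lambda>t. f t + \<i> ^ k * g t)"
      using laplace_lincomb[OF f g, of 1 "\<i> ^ k"] by (simp add: fun_eq_iff)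
    then show ?thesis
      using f g by (simp add: hardy_norm_laplace L2_add L2_scale)
  qed
  moreover have "(l2_norm pos (\<lambda>t. f t + \<i> ^ k * g t))\<^sup>2
      = (l2_norm pos f)\<^sup>2 + (l2_norm pos g)\<^sup>2 + 2 * Re (cnj (\<i> ^ k) * l2_inner pos f g)" for k
    using f g
    by (simp add: l2_norm_add_sq L2_scale l2_norm_scale l2_inner_scale_right norm_power)
  ultimately have sq: "(hardy_norm (\<lambda>z. laplace f z + \<i> ^ k * laplace g z))\<^sup>2
      = (l2_norm pos f)\<^sup>2 + (l2_norm pos g)\<^sup>2 + 2 * Re (cnj (\<i> ^ k) * l2_inner pos f g)" for k
    by simp
  \<comment> \<open>A does not depend on k and disappears because the four powers of \<i> sum to 0;
    the real parts recombine to the inner product.\<close>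
  define A where "A = (l2_norm pos f)\<^sup>2 + (l2_norm pos g)\<^sup>2"
  show ?thesis
    unfolding hardy_inner_def sq A_def[symmetric]
    by (simp add: eval_nat_numeral complex_eq_iff)
qed

section \<open>Averages over dilations\<close>

abbreviation unit_leb :: "real measure" where
  "unit_leb \<equiv> leb {0<..<1}"

lemma integrable_L2_expfun: "f \<in> L2 pos \<Longrightarrow> 0 < Re w \<Longrightarrow> integrable pos (\<lambda>t. f t * expfun w t)"
  by (intro L2_integrable_mult expfun_L2)

text \<open>The modulus of the integrand is the one for \<bar>f\<bar> at the real point Re w, so
  \<open>laplace_bound\<close> there controls the absolute integral.\<close>

lemma integral_norm_expfun_le:
  assumes f: "f \<in> L2 pos" and w: "0 < Re w"
  shows "(\<integral>\<^sup>+t. ennreal (cmod (expfun w t * f t)) \<partial>pos) \<le> ennreal (l2_norm pos f / sqrt (2 * Re w))"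
proof -
  define g where "g t = complex_of_real (cmod (f t))" for t
  have g: "g \<in> L2 pos" "l2_norm pos g = l2_norm pos f"
    using f by (auto simp: L2_def g_def[abs_def] l2_norm_def)
  have eq: "g t * expfun (of_real (Re w)) t = of_real (cmod (expfun w t * f t))" for t
    by (simp add: g_def norm_mult cmod_expfun expfun_def exp_of_real[symmetric])
  have int: "integrable pos (\<lambda>t. cmod (expfun w t * f t))"
    using integrable_L2_expfun[OF f w] by (auto simp: mult.commute intro: integrable_norm)
  have "(\<integral>\<^sup>+t. ennreal (cmod (expfun w t * f t)) \<partial>pos) = ennreal (LINT t|pos. cmod (expfun w t * f t))"
    using int by (intro nn_integral_eq_integral) auto
  also have "(LINT t|pos. cmod (expfun w t * f t)) = cmod (laplace g (of_real (Re w)))"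
    using w by (simp add: laplace_eq eq)
  also have "\<dots> \<le> l2_norm pos f / sqrt (2 * Re w)"
    using laplace_bound[OF g(1), of "of_real (Re w)"] w g(2) by simp
  finally show ?thesis
    by (simp add: ennreal_leI)
qed

text \<open>The choice \<open>m x = 1\<close> yields the Laplace transform composed with the operator on the half-line, and
  \<open>m x = 1 / x\<close> the operator on the Hardy space composed with the Laplace transform.\<close>

locale averaging =
  fixes \<alpha> :: real and m :: "real \<Rightarrow> real"
  assumes alpha: "0 < \<alpha>"
    and m_pos: "0 < x \<Longrightarrow> x < 1 \<Longrightarrow> 0 < m x"
    and m_measurable [measurable]: "m \<in> borel_measurable borel"
begin

definition weight :: "real \<Rightarrow> real" where
  "weight x = \<alpha> * (1 - x) powr (\<alpha> - 1) * m x"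

text \<open>Equal to x for m x = 1 and to 1 / x for m x = 1 / x. The quadratic form makes
  \<open>weight x / sqrt (rate x)\<close> independent of m, so that both families share their
  estimates.\<close>

definition rate :: "real \<Rightarrow> real" where
  "rate x = (m x)\<^sup>2 * x"

definition avg :: "complex \<Rightarrow> real \<Rightarrow> complex" where
  "avg w s = (LINT x|unit_leb. of_real (weight x) * expfun (w * of_real (rate x)) s)"

text \<open>The Beta integral \<alpha> * B(1/2, \<alpha>), the constant in the estimates of both
  families.\<close>

definition mass :: real where
  "mass = (LINT x|unit_leb. \<alpha> * (1 - x) powr (\<alpha> - 1) * x powr (- 1 / 2))"

lemma measurable_weight [measurable]: "weight \<in> borel_measurable borel"
  and measurable_rate [measurable]: "rate \<in> borel_measurable borel"
  unfolding weight_def rate_def by measurable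

lemma weight_nonneg: "x \<in> space unit_leb \<Longrightarrow> 0 \<le> weight x"
  and rate_pos: "x \<in> space unit_leb \<Longrightarrow> 0 < rate x"
  using alpha m_pos[of x] by (auto simp: weight_def rate_def space_restrict_space less_imp_le)

text \<open>Since \<open>(m x)\<^sup>2 * x = rate x\<close>, the factor \<open>m x\<close> cancels.\<close>

lemma weight_over_sqrt_rate:
  assumes "x \<in> space unit_leb" "0 < c"
  shows "weight x * (C / sqrt (2 * (c * rate x))) = \<alpha> * (1 - x) powr (\<alpha> - 1) * x powr (- 1 / 2) * (C / sqrt (2 * c))"
proof -
  have x: "0 < x" "0 < m x" using assms m_pos[of x] by (auto simp: space_restrict_space)
  have "sqrt (2 * (c * rate x)) = sqrt (2 * c) * (m x * sqrt x)"
    using x by (simp add: rate_def real_sqrt_mult)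
  moreover have "x powr (- 1 / 2) = 1 / sqrt x"
    using x by (simp add: powr_minus_divide powr_half_sqrt)
  ultimately show ?thesis
    using x by (simp add: weight_def mult_ac)
qed

lemma integrable_mass: "integrable unit_leb (\<lambda>x. \<alpha> * (1 - x) powr (\<alpha> - 1) * x powr (- 1 / 2))"
proof -
  have "set_integrable lborel {0..1} (\<lambda>t::real. t powr (1/2 - 1) * (1 - t) powr (\<alpha> - 1))"
    using alpha by (intro integrable_Beta) auto
  then have "set_integrable lborel {0<..<1} (\<lambda>t::real. t powr (1/2 - 1) * (1 - t) powr (\<alpha> - 1))"
    by (rule set_integrable_subset) auto
  then have "integrable unit_leb (\<lambda>t::real. \<alpha> * (t powr (1/2 - 1) * (1 - t) powr (\<alpha> - 1)))"
    by (simp add: set_integrable_leb)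
  then show ?thesis
    by (simp add: mult_ac)
qed

lemma mass_nonneg: "0 \<le> mass"
  unfolding mass_def using alpha by (intro Bochner_Integration.integral_nonneg) auto

lemma pair_pos_unit: "pair_sigma_finite pos unit_leb"
  by (rule pair_sigma_finite_leb) auto

text \<open>Integration over s first yields the norm of f divided by sqrt (2 * Re w * rate x), and
  the weight over the root of the rate is the integrable Beta density.\<close>

lemma avg_integrable_pair:
  assumes f: "f \<in> L2 pos" and w: "0 < Re w"
  shows "integrable (pos \<Otimes>\<^sub>M unit_leb) (\<lambda>(s, x). of_real (weight x) * expfun (w * of_real (rate x)) s * f s)"
proof -
  interpret pair_sigma_finite pos unit_leb by (rule pair_pos_unit)
  have [measurable]: "f \<in> borel_measurable pos" using f by (rule L2_measurable)
  note measurable_leb_id [measurable]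
  show ?thesis
  proof (rule integrable_pairI)
    show "(\<lambda>(s, x). of_real (weight x) * expfun (w * of_real (rate x)) s * f s) \<in> borel_measurable (pos \<Otimes>\<^sub>M unit_leb)"
      by measurable
    have "(\<integral>\<^sup>+x. \<integral>\<^sup>+s. ennreal (cmod (of_real (weight x) * expfun (w * of_real (rate x)) s * f s)) \<partial>pos \<partial>unit_leb)
        \<le> (\<integral>\<^sup>+x. ennreal (\<alpha> * (1 - x) powr (\<alpha> - 1) * x powr (- 1 / 2) * (l2_norm pos f / sqrt (2 * Re w))) \<partial>unit_leb)"
    proof (rule nn_integral_mono)
      fix x assume x: "x \<in> space unit_leb"
      have "(\<integral>\<^sup>+s. ennreal (cmod (of_real (weight x) * expfun (w * of_real (rate x)) s * f s)) \<partial>pos)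
          = ennreal (weight x) * (\<integral>\<^sup>+s. ennreal (cmod (expfun (w * of_real (rate x)) s * f s)) \<partial>pos)"
        using weight_nonneg[OF x]
        by (subst nn_integral_cmult[symmetric]) (auto simp: norm_mult ennreal_mult mult.assoc)
      also have "\<dots> \<le> ennreal (weight x) * ennreal (l2_norm pos f / sqrt (2 * Re (w * of_real (rate x))))"
        using rate_pos[OF x] w by (intro mult_left_mono integral_norm_expfun_le f) auto
      also have "\<dots> = ennreal (weight x * (l2_norm pos f / sqrt (2 * (Re w * rate x))))"
        using weight_nonneg[OF x] rate_pos[OF x] w by (subst ennreal_mult) auto
      finally show "(\<integral>\<^sup>+s. ennreal (cmod (of_real (weight x) * expfun (w * of_real (rate x)) s * f s)) \<partial>pos)
          \<le> ennreal (\<alpha> * (1 - x) powr (\<alpha> - 1) * x powr (- 1 / 2) * (l2_norm pos f / sqrt (2 * Re w)))"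
        by (simp only: weight_over_sqrt_rate[OF x w])
    qed
    also have "\<dots> < \<infinity>"
      using integrable_mult_left[OF integrable_mass, of "l2_norm pos f / sqrt (2 * Re w)"] alpha w
      by (subst nn_integral_eq_integral) auto
    finally show "(\<integral>\<^sup>+x. \<integral>\<^sup>+s. ennreal (norm (of_real (weight x) * expfun (w * of_real (rate x)) s * f s)) \<partial>pos \<partial>unit_leb) < \<infinity>" .
  qed
qed

lemma avg_eq: "(LINT x|unit_leb. of_real (weight x) * expfun (w * of_real (rate x)) s * f s) = f s * avg w s"
  by (simp add: avg_def)

lemma avg_mult_integrable:
  assumes "f \<in> L2 pos" "0 < Re w"
  shows "integrable pos (\<lambda>s. f s * avg w s)"
proof -
  interpret pair_sigma_finite pos unit_leb by (rule pair_pos_unit)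
  show ?thesis
    using integrable_fst[OF avg_integrable_pair[OF assms]] by (simp only: avg_eq)
qed

lemma inner_rate:
  assumes "x \<in> space unit_leb" "0 < Re w"
  shows "(LINT s|pos. of_real (weight x) * expfun (w * of_real (rate x)) s * f s)
    = of_real (weight x) * laplace f (w * of_real (rate x))"
proof -
  have "0 < Re (w * of_real (rate x))" using rate_pos[OF assms(1)] assms(2) by simp
  then have "laplace f (w * of_real (rate x)) = (LINT s|pos. expfun (w * of_real (rate x)) s * f s)"
    by (subst laplace_eq) (auto simp: mult.commute)
  then show ?thesis
    by (simp add: mult.assoc)
qed

lemma avg_integral:
  assumes f: "f \<in> L2 pos" and w: "0 < Re w"
  shows "(LINT s|pos. f s * avg w s) = (LINT x|unit_leb. of_real (weight x) * laplace f (w * of_real (rate x)))"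
    and "integrable unit_leb (\<lambda>x. of_real (weight x) * laplace f (w * of_real (rate x)))"
proof -
  interpret pair_sigma_finite pos unit_leb by (rule pair_pos_unit)
  note int = avg_integrable_pair[OF f w]
  have "(LINT s|pos. f s * avg w s) = (LINT x|unit_leb. LINT s|pos. of_real (weight x) * expfun (w * of_real (rate x)) s * f s)"
    using Fubini_integral[OF int] by (simp only: avg_eq)
  also have "\<dots> = (LINT x|unit_leb. of_real (weight x) * laplace f (w * of_real (rate x)))"
    by (intro Bochner_Integration.integral_cong refl) (rule inner_rate[OF _ w])
  finally show "(LINT s|pos. f s * avg w s) = (LINT x|unit_leb. of_real (weight x) * laplace f (w * of_real (rate x)))" .
  have "integrable unit_leb (\<lambda>x. LINT s|pos. of_real (weight x) * expfun (w * of_real (rate x)) s * f s)"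
    by (rule integrable_snd[OF int])
  moreover have "integrable unit_leb (\<lambda>x. LINT s|pos. of_real (weight x) * expfun (w * of_real (rate x)) s * f s)
      \<longleftrightarrow> integrable unit_leb (\<lambda>x. of_real (weight x) * laplace f (w * of_real (rate x)))"
    by (intro Bochner_Integration.integrable_cong refl) (rule inner_rate[OF _ w])
  ultimately show "integrable unit_leb (\<lambda>x. of_real (weight x) * laplace f (w * of_real (rate x)))"
    by simp
qed

lemma weight_laplace_bound:
  assumes "f \<in> L2 pos" "0 < Re w" "x \<in> space unit_leb"
  shows "cmod (of_real (weight x) * laplace f (w * of_real (rate x)))
    \<le> \<alpha> * (1 - x) powr (\<alpha> - 1) * x powr (- 1 / 2) * (l2_norm pos f / sqrt (2 * Re w))"
proof -
  have "cmod (laplace f (w * of_real (rate x))) \<le> l2_norm pos f / sqrt (2 * Re (w * of_real (rate x)))"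
    using assms rate_pos[OF assms(3)] by (intro laplace_bound) auto
  then have "weight x * cmod (laplace f (w * of_real (rate x))) \<le> weight x * (l2_norm pos f / sqrt (2 * (Re w * rate x)))"
    using weight_nonneg[OF assms(3)] by (intro mult_left_mono) auto
  then show ?thesis
    using weight_nonneg[OF assms(3)] by (simp only: weight_over_sqrt_rate[OF assms(3,2)] norm_mult norm_of_real abs_of_nonneg)
qed

lemma avg_integral_bound:
  assumes "f \<in> L2 pos" "0 < Re w"
  shows "cmod (LINT s|pos. f s * avg w s) \<le> mass / sqrt (2 * Re w) * l2_norm pos f"
proof -
  have "cmod (LINT s|pos. f s * avg w s) \<le> (LINT x|unit_leb. \<alpha> * (1 - x) powr (\<alpha> - 1) * x powr (- 1 / 2) * (l2_norm pos f / sqrt (2 * Re w)))"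
    unfolding avg_integral(1)[OF assms]
    by (intro order_trans[OF integral_norm_bound] integral_mono integrable_norm avg_integral(2) assms
        weight_laplace_bound integrable_mult_left integrable_mass)
  then show ?thesis
    by (simp add: mass_def)
qed

text \<open>Square-integrability comes by duality: the pairings with exponentials exist and are
  bounded on combinations, hence are represented by some square-integrable h, and Lerch's theorem
  identifies h with the average.\<close>

lemma avg_L2:
  assumes w: "0 < Re w"
  shows "avg w \<in> L2 pos"
proof -
  define F where "F = zero_ext right_half_plane (\<lambda>v. LINT s|pos. expfun v s * avg w s)"
  have e: "v \<in> right_half_plane \<Longrightarrow> expfun v \<in> L2 pos" for v
    by (simp add: expfun_L2 right_half_plane_def)
  have "cmod (\<Sum>v\<in>S. c v * F v) \<le> mass / sqrt (2 * Re w) * l2_norm pos (\<lambda>t. \<Sum>v\<in>S. c v * expfun v t)"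
    if S: "finite S" "S \<subseteq> right_half_plane" for S c
  proof -
    have int: "integrable pos (\<lambda>s. c v * (expfun v s * avg w s))" if "v \<in> S" for v
      using S(2) that by (intro integrable_mult_right avg_mult_integrable e w) auto
    have "(\<Sum>v\<in>S. c v * F v) = (\<Sum>v\<in>S. LINT s|pos. c v * (expfun v s * avg w s))"
      using S by (intro sum.cong refl) (auto simp: F_def zero_ext_def)
    also have "\<dots> = (LINT s|pos. (\<Sum>v\<in>S. c v * expfun v s) * avg w s)"
      using int by (subst Bochner_Integration.integral_sum[symmetric]) (auto simp: sum_distrib_right mult.assoc)
    also have "cmod \<dots> \<le> mass / sqrt (2 * Re w) * l2_norm pos (\<lambda>t. \<Sum>v\<in>S. c v * expfun v t)"
      using S by (intro avg_integral_bound w L2_sum e) auto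
    finally show ?thesis .
  qed
  then obtain h where h: "h \<in> L2 pos" "laplace h = F"
    by (rule laplace_representation[where F = F and C = "mass / sqrt (2 * Re w)"])
      (use mass_nonneg w in \<open>auto simp: F_def zero_ext_def\<close>)
  have meas: "avg w \<in> borel_measurable pos"
  proof -
    interpret pair_sigma_finite pos unit_leb by (rule pair_pos_unit)
    note measurable_leb_id [measurable]
    show ?thesis
      unfolding avg_def by (rule M2.borel_measurable_lebesgue_integral) measurable
  qed
  have "AE s in pos. h s - avg w s = 0"
  proof (rule lerch)
    have i: "integrable pos (\<lambda>s. h s * expfun (of_nat n) s)" "integrable pos (\<lambda>s. avg w s * expfun (of_nat n) s)"
      if "n \<ge> 1" for n :: nat
      using that integrable_L2_expfun[OF h(1), of "of_nat n"] avg_mult_integrable[OF expfun_L2 w, of "of_nat n"]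
      by (auto simp: mult.commute)
    show "integrable pos (\<lambda>s. (h s - avg w s) * expfun 1 s)"
      using Bochner_Integration.integrable_diff[OF i[of 1]] by (simp add: left_diff_distrib)
    show "(LINT s|pos. (h s - avg w s) * expfun (of_nat n) s) = 0" if n: "n \<ge> 1" for n :: nat
    proof -
      have "(LINT s|pos. h s * expfun (of_nat n) s) = (LINT s|pos. avg w s * expfun (of_nat n) s)"
        using h(2) n laplace_eq[of "of_nat n" h]
        by (simp add: F_def zero_ext_def right_half_plane_def mult.commute)
      then show ?thesis
        using Bochner_Integration.integral_diff[OF i[OF n]] by (simp add: left_diff_distrib)
    qed
  qed
  then have "AE s in pos. h s = avg w s"
    by eventually_elim simp
  then show ?thesis
    by (rule L2_cong_AE[OF h(1) meas])
qed

lemma cnj_avg: "cnj (avg w s) = avg (cnj w) s"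
proof -
  have "cnj (avg w s) = (LINT x|unit_leb. cnj (of_real (weight x) * expfun (w * of_real (rate x)) s))"
    unfolding avg_def by (rule Bochner_Integration.integral_cnj[symmetric])
  then show ?thesis
    by (simp add: avg_def cnj_expfun)
qed

lemma laplace_avg:
  assumes v: "0 < Re v" and z: "0 < Re z"
  shows "laplace (avg v) z = (LINT y|unit_leb. of_real (weight y) / (v * of_real (rate y) + z))"
proof -
  have "laplace (avg v) z = (LINT s|pos. expfun z s * avg v s)"
    using z by (simp add: laplace_eq mult.commute)
  also have "\<dots> = (LINT y|unit_leb. of_real (weight y) * laplace (expfun z) (v * of_real (rate y)))"
    using v z by (intro avg_integral(1) expfun_L2)
  also have "\<dots> = (LINT y|unit_leb. of_real (weight y) / (v * of_real (rate y) + z))"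
  proof (rule Bochner_Integration.integral_cong[OF refl])
    fix y assume "y \<in> space unit_leb"
    then have "0 < Re (v * of_real (rate y))" using rate_pos v by simp
    then show "of_real (weight y) * laplace (expfun z) (v * of_real (rate y)) = of_real (weight y) / (v * of_real (rate y) + z)"
      using z by (simp add: laplace_eq expfun_mult integral_expfun add.commute)
  qed
  finally show ?thesis .
qed

text \<open>Bilinear on purpose: \<open>cnj_avg\<close> moves conjugation into the parameter, so
  inner products are the case of one conjugated parameter. The outer variable x belongs to the
  second factor.\<close>

lemma avg_gram:
  assumes v: "0 < Re v" and w: "0 < Re w"
  shows "(LINT s|pos. avg v s * avg w s) = (LINT x|unit_leb. of_real (weight x) *
    (LINT y|unit_leb. of_real (weight y) / (v * of_real (rate y) + w * of_real (rate x))))"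
  unfolding avg_integral(1)[OF avg_L2[OF v] w]
proof (rule Bochner_Integration.integral_cong[OF refl])
  fix x assume "x \<in> space unit_leb"
  then have "0 < Re (w * of_real (rate x))" using rate_pos w by simp
  then show "of_real (weight x) * laplace (avg v) (w * of_real (rate x)) = of_real (weight x) *
      (LINT y|unit_leb. of_real (weight y) / (v * of_real (rate y) + w * of_real (rate x)))"
    by (simp add: laplace_avg[OF v])
qed

definition transform :: "(real \<Rightarrow> complex) \<Rightarrow> complex \<Rightarrow> complex" where
  "transform f = zero_ext right_half_plane (\<lambda>w. LINT s|pos. f s * avg w s)"

lemma transform_eq: "0 < Re w \<Longrightarrow> transform f w = (LINT s|pos. f s * avg w s)"
  by (simp add: transform_def zero_ext_def right_half_plane_def)

lemma transform_outside: "\<not> 0 < Re w \<Longrightarrow> transform f w = 0"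
  by (simp add: transform_def zero_ext_def right_half_plane_def)

lemma transform_inner: "0 < Re w \<Longrightarrow> transform f w = l2_inner pos f (avg (cnj w))"
  by (simp add: transform_eq l2_inner_def cnj_avg)

lemma transform_lincomb:
  assumes "f \<in> L2 pos" "g \<in> L2 pos"
  shows "transform (\<lambda>t. a * f t + b * g t) w = a * transform f w + b * transform g w"
proof (cases "0 < Re w")
  case True
  then show ?thesis
    using assms by (simp add: transform_inner l2_inner_lincomb_left avg_L2)
qed (simp add: transform_outside)

lemma transform_cong_AE:
  assumes "f \<in> L2 pos" "g \<in> L2 pos" "AE t in pos. f t = g t"
  shows "transform f = transform g"
proof
  fix w
  have "l2_norm pos (\<lambda>t. f t - g t) = 0"
    using assms by (subst l2_norm_eq_0_iff) (auto intro: L2_diff)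
  then have "l2_inner pos (\<lambda>t. f t - g t) (avg (cnj w)) = 0" if "0 < Re w"
    using l2_cauchy_schwarz[OF L2_diff[OF assms(1,2)] avg_L2, of "cnj w"] that by simp
  then show "transform f w = transform g w"
    using assms(1,2) l2_inner_lincomb_left[OF assms(1,2) avg_L2, of "cnj w" 1 "-1"]
    by (cases "0 < Re w") (auto simp: transform_inner transform_outside)
qed

end

section \<open>Injectivity of Riemann-Liouville averages\<close>

lemma has_bochner_integral_Gamma_pos:
  assumes a: "0 < a" and c: "0 < c"
  shows "has_bochner_integral pos (\<lambda>t. t powr (a - 1) * exp (- (c * t))) (Gamma a / c powr a)"
proof -
  define g where "g t = indicator {0<..} t * (t powr (a - 1) * exp (- t))" for t :: real
  have "((\<lambda>t. t powr (a - 1) / exp t) has_integral Gamma a) {0..}"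
    using a by (rule Gamma_integral_real)
  then have "((\<lambda>t. t powr (a - 1) / exp t) has_integral Gamma a) {0<..}"
    by (subst has_integral_spike_set_eq[of _ "{0..}"])
      (rule negligible_subset[OF negligible_sing[of 0]], force)+
  then have "has_bochner_integral pos (\<lambda>t. t powr (a - 1) / exp t) (Gamma a)"
    by (intro has_bochner_integral_leb_nonneg) auto
  then have g: "has_bochner_integral lborel g (Gamma a)"
    by (simp add: has_bochner_integral_iff integrable_restrict_space integral_restrict_space g_def[abs_def]
        exp_minus divide_inverse)
  have "has_bochner_integral lborel (\<lambda>t. g (0 + c * t)) (Gamma a /\<^sub>R \<bar>c\<bar>)"
    using g c by (subst lborel_has_bochner_integral_real_affine_iff[symmetric]) auto
  moreover have "g (0 + c * t) = c powr (a - 1) * (indicator {0<..} t * (t powr (a - 1) * exp (- (c * t))))" for t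
    using c by (simp add: g_def powr_mult zero_less_mult_iff split: split_indicator)
  ultimately have "has_bochner_integral lborel
      (\<lambda>t. c powr (a - 1) * (indicator {0<..} t * (t powr (a - 1) * exp (- (c * t))))) (Gamma a / c)"
    using c by (simp add: divide_inverse mult.commute)
  then have "has_bochner_integral lborel
      (\<lambda>t. inverse (c powr (a - 1)) * (c powr (a - 1) * (indicator {0<..} t * (t powr (a - 1) * exp (- (c * t))))))
      (inverse (c powr (a - 1)) * (Gamma a / c))"
    by (rule has_bochner_integral_mult_right)
  moreover have "inverse (c powr (a - 1)) * (Gamma a / c) = Gamma a / c powr a"
    using c powr_add[of c "a - 1" 1] by (simp add: field_simps)
  ultimately have "has_bochner_integral lborel (\<lambda>t. indicator {0<..} t * (t powr (a - 1) * exp (- (c * t)))) (Gamma a / c powr a)"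
    using c by (simp add: mult.assoc[symmetric])
  then show ?thesis
    by (simp add: has_bochner_integral_iff integrable_restrict_space integral_restrict_space)
qed

text \<open>The hypothesis says that a Riemann--Liouville convolution vanishes; its Laplace transform is
  a product with one non-vanishing factor.\<close>

lemma riemann_liouville_injective:
  fixes \<phi> :: "real \<Rightarrow> complex"
  assumes alpha: "0 < \<alpha>" and phi [measurable]: "\<phi> \<in> borel_measurable borel"
    and bound: "\<And>y. 0 < y \<Longrightarrow> cmod (\<phi> y) \<le> C * y powr (- 1 / 2)"
    and zero: "\<And>\<tau>. 0 < \<tau> \<Longrightarrow> (LINT x|unit_leb. of_real ((1 - x) powr (\<alpha> - 1)) * \<phi> (\<tau> * x)) = 0"
  shows "AE y in pos. \<phi> y = 0"
proof (rule lerch)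
  have int_phi: "integrable pos (\<lambda>y. \<phi> y * expfun (of_nat n) y)" if "n \<ge> 1" for n :: nat
  proof (rule Bochner_Integration.integrable_bound)
    show "integrable pos (\<lambda>y. C * (y powr (1/2 - 1) * exp (- (real n * y))))"
      using has_bochner_integral_Gamma_pos[of "1/2" "real n"] that
      by (intro integrable_mult_right) (auto simp: has_bochner_integral_iff)
    show "(\<lambda>y. \<phi> y * expfun (of_nat n) y) \<in> borel_measurable pos"
      by (intro measurable_restrict_space1) simp
    show "AE y in pos. norm (\<phi> y * expfun (of_nat n) y) \<le> norm (C * (y powr (1/2 - 1) * exp (- (real n * y))))"
    proof (rule AE_I2)
      fix y assume "y \<in> space pos"
      then have "cmod (\<phi> y) \<le> C * y powr (1/2 - 1)"
        using bound[of y] by (simp add: space_restrict_space)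
      then have "cmod (\<phi> y) * exp (- (real n * y)) \<le> C * y powr (1/2 - 1) * exp (- (real n * y))"
        by (intro mult_right_mono) auto
      then show "norm (\<phi> y * expfun (of_nat n) y) \<le> norm (C * (y powr (1/2 - 1) * exp (- (real n * y))))"
        unfolding norm_mult[of "\<phi> y"] cmod_expfun real_norm_def
        by (intro order_trans[OF _ abs_ge_self]) (simp add: mult.assoc)
    qed
  qed
  show "integrable pos (\<lambda>y. \<phi> y * expfun 1 y)"
    using int_phi[of 1] by simp
  show "(LINT y|pos. \<phi> y * expfun (of_nat n) y) = 0" if n: "n \<ge> 1" for n :: nat
  proof -
    \<comment> \<open>The integrand for the Laplace transform at n of the convolution of \<phi> with
      a power. Splitting exp (- n \<tau>) into exp (- n y) * exp (- n (\<tau> - y)) factors it as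
      \<open>\<psi> y * k (\<tau> - y)\<close>: over y it integrates to 0 by hypothesis, over \<tau>
      to K times \<open>\<psi> y\<close>.\<close>
    define G where "G y \<tau> = (if 0 < y \<and> y < \<tau>
        then \<phi> y * of_real (exp (- (real n * \<tau>)) * (\<tau> - y) powr (\<alpha> - 1)) else 0)" for y \<tau> :: real
    define k where "k \<sigma> = (if 0 < \<sigma> then \<sigma> powr (\<alpha> - 1) * exp (- (real n * \<sigma>)) else 0)" for \<sigma> :: real
    define \<psi> where "\<psi> y = (if 0 < y then \<phi> y * expfun (of_nat n) y else 0)" for y
    \<comment> \<open>The Laplace transform of the power at n, the factor that does not
      vanish.\<close>
    define K where "K = Gamma \<alpha> / real n powr \<alpha>"
    have K: "K > 0" using n alpha by (simp add: K_def Gamma_real_pos)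
    have k: "integrable lborel k" "(LINT \<sigma>|lborel. k \<sigma>) = K"
    proof -
      have eq: "k = (\<lambda>\<sigma>. indicator {0<..} \<sigma> *\<^sub>R (\<sigma> powr (\<alpha> - 1) * exp (- (real n * \<sigma>))))"
        by (auto simp: k_def fun_eq_iff split: split_indicator)
      show "integrable lborel k" "(LINT \<sigma>|lborel. k \<sigma>) = K"
        unfolding eq using has_bochner_integral_Gamma_pos[OF alpha, of "real n"] n
        by (auto simp: has_bochner_integral_iff integrable_restrict_space integral_restrict_space K_def)
    qed
    have psi: "integrable lborel \<psi>" "(LINT y|lborel. \<psi> y) = (LINT y|pos. \<phi> y * expfun (of_nat n) y)"
    proof -
      have eq: "\<psi> = (\<lambda>y. indicator {0<..} y *\<^sub>R (\<phi> y * expfun (of_nat n) y))"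
        by (auto simp: \<psi>_def fun_eq_iff split: split_indicator)
      show "integrable lborel \<psi>" "(LINT y|lborel. \<psi> y) = (LINT y|pos. \<phi> y * expfun (of_nat n) y)"
        unfolding eq using int_phi[OF n] by (simp_all add: integrable_restrict_space integral_restrict_space)
    qed
    have Gk: "G y \<tau> = \<psi> y * of_real (k (- y + 1 * \<tau>))" for y \<tau>
    proof (cases "0 < y \<and> y < \<tau>")
      case True
      have "expfun (of_nat n) y = of_real (exp (- (real n * y)))"
        using expfun_of_real[of "real n" y] by simp
      moreover have "exp (- (real n * \<tau>)) = exp (- (real n * y)) * exp (- (real n * (\<tau> - y)))"
        by (simp add: exp_add[symmetric] algebra_simps)
      ultimately show ?thesis
        using True by (simp add: G_def k_def \<psi>_def)
    qed (auto simp: G_def k_def \<psi>_def)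
    have [measurable]: "\<psi> \<in> borel_measurable borel" "k \<in> borel_measurable borel"
      unfolding \<psi>_def k_def by measurable
    have norm_G: "(\<integral>\<^sup>+\<tau>. ennreal (norm (G y \<tau>)) \<partial>lborel) = ennreal (cmod (\<psi> y)) * ennreal K" for y
    proof -
      have k0: "k \<sigma> \<ge> 0" for \<sigma> by (simp add: k_def)
      have "(\<integral>\<^sup>+\<tau>. ennreal (norm (G y \<tau>)) \<partial>lborel) = (\<integral>\<^sup>+\<tau>. ennreal (cmod (\<psi> y)) * ennreal (k (- y + 1 * \<tau>)) \<partial>lborel)"
        using k0 by (simp add: Gk norm_mult ennreal_mult)
      also have "\<dots> = ennreal (cmod (\<psi> y)) * (\<integral>\<^sup>+\<tau>. ennreal (k (- y + 1 * \<tau>)) \<partial>lborel)"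
        by (rule nn_integral_cmult) measurable
      also have "(\<integral>\<^sup>+\<tau>. ennreal (k (- y + 1 * \<tau>)) \<partial>lborel) = (\<integral>\<^sup>+\<tau>. ennreal (k \<tau>) \<partial>lborel)"
        using nn_integral_real_affine[of "\<lambda>\<tau>. ennreal (k \<tau>)" 1 "- y"] by simp
      also have "\<dots> = ennreal K"
        using k k0 by (subst nn_integral_eq_integral) auto
      finally show ?thesis .
    qed
    have int_G: "integrable (lborel \<Otimes>\<^sub>M lborel) (\<lambda>(\<tau>, y). G y \<tau>)"
    proof (rule lborel_pair.integrable_pairI)
      show "(\<lambda>(\<tau>, y). G y \<tau>) \<in> borel_measurable (lborel \<Otimes>\<^sub>M lborel)"
        unfolding Gk by measurable
      show "(\<integral>\<^sup>+y. \<integral>\<^sup>+\<tau>. ennreal (norm (G y \<tau>)) \<partial>lborel \<partial>lborel) < \<infinity>"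
        unfolding norm_G using psi(1) K
        by (subst nn_integral_multc) (auto simp: integrable_iff_bounded ennreal_mult_less_top)
    qed
    have "(LINT y|lborel. LINT \<tau>|lborel. G y \<tau>) = (LINT \<tau>|lborel. LINT y|lborel. G y \<tau>)"
      by (rule lborel_pair.Fubini_integral[OF int_G])
    moreover have "(LINT \<tau>|lborel. G y \<tau>) = \<psi> y * of_real K" for y
      using lborel_integral_real_affine[of 1 "\<lambda>\<sigma>. complex_of_real (k \<sigma>)" "- y"] k(2)
      by (simp add: Gk)
    moreover have "(LINT y|lborel. G y \<tau>) = 0" for \<tau>
    proof (cases "0 < \<tau>")
      case True
      \<comment> \<open>The substitution y = \<tau> * x brings the inner integral to the form of the
        hypothesis.\<close>
      have "(LINT y|lborel. G y \<tau>) = \<bar>\<tau>\<bar> *\<^sub>R (LINT x|lborel. G (0 + \<tau> * x) \<tau>)"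
        using True by (intro lborel_integral_real_affine) simp
      also have "(\<lambda>x. G (0 + \<tau> * x) \<tau>) = (\<lambda>x. of_real (exp (- (real n * \<tau>)) * \<tau> powr (\<alpha> - 1)) *
          (indicator {0<..<1} x *\<^sub>R (of_real ((1 - x) powr (\<alpha> - 1)) * \<phi> (\<tau> * x))))"
      proof
        fix x
        have "(\<tau> - \<tau> * x) powr (\<alpha> - 1) = \<tau> powr (\<alpha> - 1) * (1 - x) powr (\<alpha> - 1)" if "0 < x" "x < 1"
          using that True powr_mult[of \<tau> "1 - x" "\<alpha> - 1"] by (simp add: algebra_simps)
        then show "G (0 + \<tau> * x) \<tau> = of_real (exp (- (real n * \<tau>)) * \<tau> powr (\<alpha> - 1)) *
            (indicator {0<..<1} x *\<^sub>R (of_real ((1 - x) powr (\<alpha> - 1)) * \<phi> (\<tau> * x)))"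
          using True by (auto simp: G_def zero_less_mult_iff split: split_indicator)
      qed
      also have "(LINT x|lborel. of_real (exp (- (real n * \<tau>)) * \<tau> powr (\<alpha> - 1)) *
          (indicator {0<..<1} x *\<^sub>R (of_real ((1 - x) powr (\<alpha> - 1)) * \<phi> (\<tau> * x)))) = 0"
        using zero[OF True] unfolding integral_mult_right_zero
        by (subst (asm) integral_restrict_space) auto
      finally show ?thesis by simp
    next
      case False
      then have "G y \<tau> = 0" for y by (simp add: G_def)
      then show ?thesis by simp
    qed
    ultimately have "(LINT y|lborel. \<psi> y) = 0"
      using K by simp
    then show ?thesis
      by (simp add: psi(2))
  qed
qed

text \<open>The points of the half-line where \<phi> is non-zero form an open set, and a non-empty
  open set is not negligible.\<close>

lemma continuous_AE_zero_pos:
  fixes \<phi> :: "real \<Rightarrow> complex"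
  assumes cont: "continuous_on {0<..} \<phi>" and ae: "AE y in pos. \<phi> y = 0" and y: "0 < y"
  shows "\<phi> y = 0"
proof (rule ccontr)
  assume nz: "\<phi> y \<noteq> 0"
  define U where "U = {0<..} \<inter> \<phi> -` (- {0})"
  have U: "open U" "y \<in> U"
    using continuous_open_preimage[OF cont open_greaterThan, of "- {0}"] nz y by (auto simp: U_def)
  have "AE t in lborel. t \<notin> U"
    using ae unfolding AE_pos_iff by eventually_elim (auto simp: U_def)
  then have "U \<in> null_sets lborel"
    using U(1) by (subst AE_iff_null_sets) auto
  then have "negligible U"
    by (simp add: negligible_iff_null_sets null_sets_completionI)
  then show False
    using open_not_negligible[OF U(1)] U(2) by auto
qed

lemma laplace_zero_if_zero_on_positive:
  assumes f: "f \<in> L2 pos" and zero: "\<And>y. 0 < y \<Longrightarrow> laplace f (of_real y) = 0"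
  shows "AE t in pos. f t = 0"
proof (rule lerch)
  show "integrable pos (\<lambda>t. f t * expfun 1 t)"
    using f by (intro integrable_L2_expfun) auto
  show "(LINT t|pos. f t * expfun (of_nat n) t) = 0" if "n \<ge> 1" for n :: nat
    using zero[of "real n"] that by (simp add: laplace_eq)
qed

lemma laplace_continuous_on_positive:
  assumes f: "f \<in> L2 pos"
  shows "continuous_on {0<..} (\<lambda>y. laplace f (of_real y))"
proof -
  have "continuous_on right_half_plane (laplace f)"
    using laplace_in_hardy(1)[OF f] by (intro holomorphic_on_imp_continuous_on hardy_holomorphic)
  then show ?thesis
    by (rule continuous_on_compose2) (auto simp: right_half_plane_def intro!: continuous_intros)
qed

lemma laplace_positive_bound:
  assumes f: "f \<in> L2 pos" and y: "0 < y"
  shows "cmod (laplace f (of_real y)) \<le> l2_norm pos f * y powr (- 1 / 2)"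
proof -
  have "cmod (laplace f (of_real y)) \<le> l2_norm pos f / sqrt (2 * y)"
    using laplace_bound[OF f, of "of_real y"] y by simp
  also have "\<dots> \<le> l2_norm pos f / sqrt y"
    using y by (intro divide_left_mono) auto
  finally show ?thesis
    using y by (simp add: powr_minus_divide powr_half_sqrt)
qed

lemma continuous_on_if_measurable:
  fixes \<phi> :: "real \<Rightarrow> complex"
  assumes "continuous_on {0<..} \<phi>"
  shows "(\<lambda>y. if y \<in> {0<..} then \<phi> y else 0) \<in> borel_measurable borel"
  using assms by (intro borel_measurable_continuous_on_if) auto

section \<open>The two families of averages and their common Gram matrix\<close>

locale cesaro =
  fixes \<alpha> :: real
  assumes alpha: "0 < \<alpha>"
begin

sublocale q: averaging \<alpha> "\<lambda>_. 1"
  by (rule averaging.intro) (use alpha in simp_all)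

sublocale p: averaging \<alpha> "\<lambda>x. 1 / x"
  by (rule averaging.intro) (use alpha in simp_all)

text \<open>The kernel of the theorem multiplied by the square of
  \<open>Gamma (\<alpha> + 1)\<close>; the weights are those of the averages.\<close>

definition kernel :: "complex \<Rightarrow> complex \<Rightarrow> complex" where
  "kernel z w = (LINT x|unit_leb. of_real (\<alpha> * (1 - x) powr (\<alpha> - 1)) *
     (LINT y|unit_leb. of_real (\<alpha> * (1 - y) powr (\<alpha> - 1)) * (1 / (x *\<^sub>R z + y *\<^sub>R cnj w))))"

lemma q_rate: "q.rate x = x" and q_weight: "q.weight x = \<alpha> * (1 - x) powr (\<alpha> - 1)"
  by (simp_all add: q.rate_def q.weight_def)

lemma p_rate: "0 < x \<Longrightarrow> p.rate x = 1 / x" and p_weight: "p.weight x = \<alpha> * (1 - x) powr (\<alpha> - 1) / x"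
  by (simp_all add: p.rate_def p.weight_def power2_eq_square)

lemma q_inner:
  assumes "0 < Re z" "0 < Re w"
  shows "l2_inner pos (q.avg z) (q.avg w) = kernel z w"
proof -
  \<comment> \<open>The factors are swapped because \<open>avg_gram\<close> attaches the outer
    variable to the second factor, which has to be the one with z.\<close>
  have "l2_inner pos (q.avg z) (q.avg w) = (LINT s|pos. q.avg (cnj w) s * q.avg z s)"
    by (simp add: l2_inner_def q.cnj_avg mult.commute)
  also have "\<dots> = (LINT x|unit_leb. of_real (q.weight x) *
      (LINT y|unit_leb. of_real (q.weight y) / (cnj w * of_real (q.rate y) + z * of_real (q.rate x))))"
    using assms by (intro q.avg_gram) auto
  also have "\<dots> = kernel z w"
    by (simp add: kernel_def q_rate q_weight scaleR_conv_of_real) (simp only: add.commute mult.commute)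
  finally show ?thesis .
qed

text \<open>With rates 1 / x and 1 / y, and weights carrying 1 / x and 1 / y, the integrand contains
  1 / (x * y) divided by z / y + cnj w / x, which is 1 / (x * z + y * cnj w). Inverting the rates
  exchanges the roles of x and y, so here the factors keep their order.\<close>

lemma p_inner:
  assumes z: "0 < Re z" and w: "0 < Re w"
  shows "l2_inner pos (p.avg z) (p.avg w) = kernel z w"
proof -
  have "l2_inner pos (p.avg z) (p.avg w) = (LINT s|pos. p.avg z s * p.avg (cnj w) s)"
    by (simp add: l2_inner_def p.cnj_avg)
  also have "\<dots> = (LINT x|unit_leb. of_real (p.weight x) *
      (LINT y|unit_leb. of_real (p.weight y) / (z * of_real (p.rate y) + cnj w * of_real (p.rate x))))"
    using assms by (intro p.avg_gram) auto
  also have "\<dots> = kernel z w"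
    unfolding kernel_def
  proof (rule Bochner_Integration.integral_cong[OF refl])
    fix x assume "x \<in> space unit_leb"
    then have x: "0 < x" by (simp add: space_restrict_space)
    have "(LINT y|unit_leb. of_real (p.weight y) / (z * of_real (p.rate y) + cnj w * of_real (p.rate x)))
        = (LINT y|unit_leb. of_real x * (of_real (\<alpha> * (1 - y) powr (\<alpha> - 1)) * (1 / (x *\<^sub>R z + y *\<^sub>R cnj w))))"
    proof (rule Bochner_Integration.integral_cong[OF refl])
      fix y assume "y \<in> space unit_leb"
      then have y: "0 < y" by (simp add: space_restrict_space)
      have nz: "of_real x * z + of_real y * cnj w \<noteq> 0"
      proof
        assume "of_real x * z + of_real y * cnj w = 0"
        then have "Re (of_real x * z + of_real y * cnj w) = 0" by simp
        moreover have "0 < x * Re z + y * Re w" using x y z w by (intro add_pos_pos) auto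
        ultimately show False by simp
      qed
      have eq: "z * of_real (p.rate y) + cnj w * of_real (p.rate x) = (of_real x * z + of_real y * cnj w) / (of_real x * of_real y)"
        using x y by (simp add: p_rate field_simps)
      show "of_real (p.weight y) / (z * of_real (p.rate y) + cnj w * of_real (p.rate x))
          = of_real x * (of_real (\<alpha> * (1 - y) powr (\<alpha> - 1)) * (1 / (x *\<^sub>R z + y *\<^sub>R cnj w)))"
        unfolding eq p_weight scaleR_conv_of_real using x y nz by (simp add: field_simps)
    qed
    also have "\<dots> = of_real x * (LINT y|unit_leb. of_real (\<alpha> * (1 - y) powr (\<alpha> - 1)) * (1 / (x *\<^sub>R z + y *\<^sub>R cnj w)))"
      by (rule integral_mult_right_zero)
    finally show "of_real (p.weight x) * (LINT y|unit_leb. of_real (p.weight y) / (z * of_real (p.rate y) + cnj w * of_real (p.rate x)))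
      = of_real (\<alpha> * (1 - x) powr (\<alpha> - 1)) *
        (LINT y|unit_leb. of_real (\<alpha> * (1 - y) powr (\<alpha> - 1)) * (1 / (x *\<^sub>R z + y *\<^sub>R cnj w)))"
      using x by (simp only: p_weight) simp
  qed
  finally show ?thesis .
qed

text \<open>Continuity upgrades the a.e. conclusion to every point; extension by zero supplies
  measurability on the whole line.\<close>

lemma riemann_liouville_continuous:
  fixes \<phi> :: "real \<Rightarrow> complex"
  assumes cont: "continuous_on {0<..} \<phi>"
    and bound: "\<And>y. 0 < y \<Longrightarrow> cmod (\<phi> y) \<le> C * y powr (- 1 / 2)"
    and zero: "\<And>\<tau>. 0 < \<tau> \<Longrightarrow> (LINT x|unit_leb. of_real ((1 - x) powr (\<alpha> - 1)) * \<phi> (\<tau> * x)) = 0"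
    and y: "0 < y"
  shows "\<phi> y = 0"
proof -
  define \<psi> where "\<psi> y = (if y \<in> {0<..} then \<phi> y else 0)" for y
  have "AE y in pos. \<psi> y = 0"
  proof (rule riemann_liouville_injective[OF alpha])
    show "\<psi> \<in> borel_measurable borel"
      unfolding \<psi>_def by (rule continuous_on_if_measurable[OF cont])
    show "cmod (\<psi> y) \<le> C * y powr (- 1 / 2)" if "0 < y" for y
      using bound[OF that] that by (simp add: \<psi>_def)
    show "(LINT x|unit_leb. of_real ((1 - x) powr (\<alpha> - 1)) * \<psi> (\<tau> * x)) = 0" if "0 < \<tau>" for \<tau>
    proof -
      have "(LINT x|unit_leb. of_real ((1 - x) powr (\<alpha> - 1)) * \<psi> (\<tau> * x))
          = (LINT x|unit_leb. of_real ((1 - x) powr (\<alpha> - 1)) * \<phi> (\<tau> * x))"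
        using that by (intro Bochner_Integration.integral_cong refl) (auto simp: \<psi>_def space_restrict_space)
      then show ?thesis using zero[OF that] by simp
    qed
  qed
  then have "AE y in pos. \<phi> y = 0"
    unfolding AE_pos_iff by eventually_elim (simp add: \<psi>_def)
  then show ?thesis
    using continuous_AE_zero_pos[OF cont] y by blast
qed

text \<open>On the positive axis the transform at \<tau> is, up to a factor, the Riemann-Liouville
  average of \<open>laplace f\<close> over (0, \<tau>), so its vanishing annihilates
  \<open>laplace f\<close> on that axis.\<close>

lemma q_total:
  assumes f: "f \<in> L2 pos" and zero: "\<And>w. q.transform f w = 0"
  shows "AE t in pos. f t = 0"
proof (rule laplace_zero_if_zero_on_positive[OF f])
  fix y :: real assume y: "0 < y"
  show "laplace f (of_real y) = 0"
  proof (rule riemann_liouville_continuous[OF laplace_continuous_on_positive[OF f] laplace_positive_bound[OF f] _ y])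
    fix \<tau> :: real assume tau: "0 < \<tau>"
    have "0 = (LINT x|unit_leb. of_real (q.weight x) * laplace f (of_real \<tau> * of_real (q.rate x)))"
      using zero[of "of_real \<tau>"] tau q.avg_integral(1)[OF f, of "of_real \<tau>"] by (simp add: q.transform_eq)
    also have "\<dots> = (LINT x|unit_leb. of_real \<alpha> * (of_real ((1 - x) powr (\<alpha> - 1)) * laplace f (of_real (\<tau> * x))))"
      by (simp add: q_weight q_rate mult.assoc)
    finally show "(LINT x|unit_leb. of_real ((1 - x) powr (\<alpha> - 1)) * laplace f (of_real (\<tau> * x))) = 0"
      using alpha by simp
  qed
qed

lemma p_total:
  assumes f: "f \<in> L2 pos" and zero: "\<And>w. p.transform f w = 0"
  shows "AE t in pos. f t = 0"
proof (rule laplace_zero_if_zero_on_positive[OF f])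
  fix y :: real assume y: "0 < y"
  \<comment> \<open>Inverting the argument turns the rate 1 / x into x; the division by t absorbs
    the additional 1 / x of the weight, and a bound of order -1/2 is preserved.\<close>
  define \<phi> where "\<phi> t = laplace f (of_real (1 / t)) / of_real t" for t :: real
  have "\<phi> (1 / y) = 0"
  proof (rule riemann_liouville_continuous)
    have "continuous_on {0<..} (\<lambda>t. laplace f (of_real (1 / t)))"
      by (rule continuous_on_compose2[OF laplace_continuous_on_positive[OF f]]) (auto intro!: continuous_intros)
    then show "continuous_on {0<..} \<phi>"
      unfolding \<phi>_def by (intro continuous_intros) auto
    show "cmod (\<phi> t) \<le> l2_norm pos f * t powr (- 1 / 2)" if t: "0 < t" for t
    proof -
      have "cmod (\<phi> t) = cmod (laplace f (of_real (1 / t))) / t"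
        using t by (simp add: \<phi>_def norm_divide)
      also have "\<dots> \<le> l2_norm pos f * (1 / t) powr (- 1 / 2) / t"
        using t by (intro divide_right_mono laplace_positive_bound f) auto
      also have "\<dots> = l2_norm pos f * ((1 / t) powr (- 1 / 2) / t)"
        by simp
      also have "(1 / t) powr (- 1 / 2) / t = t powr (- 1 / 2)"
        using t by (simp add: powr_minus_divide powr_half_sqrt powr_divide real_sqrt_divide field_simps)
      finally show ?thesis .
    qed
    fix \<tau> :: real assume tau: "0 < \<tau>"
    have "0 = (LINT x|unit_leb. of_real (p.weight x) * laplace f (of_real (1 / \<tau>) * of_real (p.rate x)))"
      using zero[of "of_real (1 / \<tau>)"] tau p.avg_integral(1)[OF f, of "of_real (1 / \<tau>)"] by (simp add: p.transform_eq)
    also have "\<dots> = (LINT x|unit_leb. of_real (\<alpha> * \<tau>) * (of_real ((1 - x) powr (\<alpha> - 1)) * \<phi> (\<tau> * x)))"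
      using tau by (intro Bochner_Integration.integral_cong refl)
        (auto simp: p_weight p_rate \<phi>_def space_restrict_space field_simps)
    finally show "(LINT x|unit_leb. of_real ((1 - x) powr (\<alpha> - 1)) * \<phi> (\<tau> * x)) = 0"
      using alpha tau by simp
  qed (use y in simp)
  then show "laplace f (of_real y) = 0"
    using y by (simp add: \<phi>_def)
qed

end

text \<open>Since the Gram matrices agree, the pairings of the first family with f define a bounded
  functional on combinations of the second. The norm may drop, because a part of f orthogonal to the
  first family is invisible.\<close>

lemma gram_transfer:
  assumes b: "\<And>i. i \<in> I \<Longrightarrow> b i \<in> L2 M" and b': "\<And>i. i \<in> I \<Longrightarrow> b' i \<in> L2 M"
    and gram: "\<And>i j. i \<in> I \<Longrightarrow> j \<in> I \<Longrightarrow> l2_inner M (b i) (b j) = l2_inner M (b' i) (b' j)"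
    and f: "f \<in> L2 M"
  obtains g where "g \<in> L2 M" "l2_norm M g \<le> l2_norm M f"
    "\<And>i. i \<in> I \<Longrightarrow> l2_inner M (b' i) g = l2_inner M (b i) f"
proof -
  have bound: "cmod (\<Sum>i\<in>S. c i * l2_inner M (b i) f) \<le> l2_norm M f * l2_norm M (\<lambda>t. \<Sum>i\<in>S. c i * b' i t)"
    if S: "finite S" "S \<subseteq> I" for S c
  proof -
    have bS: "i \<in> S \<Longrightarrow> b i \<in> L2 M" and bS': "i \<in> S \<Longrightarrow> b' i \<in> L2 M" for i
      using S(2) b b' by auto
    have "(\<Sum>i\<in>S. c i * l2_inner M (b i) f) = l2_inner M (\<lambda>t. \<Sum>i\<in>S. c i * b i t) f"
      by (rule l2_inner_sum_left[symmetric, OF bS f])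
    also have "cmod \<dots> \<le> l2_norm M (\<lambda>t. \<Sum>i\<in>S. c i * b i t) * l2_norm M f"
      by (intro l2_cauchy_schwarz L2_sum bS f)
    also have "l2_norm M (\<lambda>t. \<Sum>i\<in>S. c i * b i t) = sqrt 1 * l2_norm M (\<lambda>t. \<Sum>i\<in>S. c i * b' i t)"
      using S(2) by (intro l2_norm_sum_gram bS bS') (auto intro: gram)
    finally show ?thesis by (simp add: mult.commute)
  qed
  show ?thesis
    by (rule L2_riesz_family[where I = I and b = b' and M = M and lam = "\<lambda>i. l2_inner M (b i) f" and C = "l2_norm M f"])
      (assumption | rule b' l2_norm_nonneg bound that)+
qed

context cesaro
begin

lemma transform_exchange:
  assumes f: "f \<in> L2 pos"
  shows "\<exists>g\<in>L2 pos. l2_norm pos g \<le> l2_norm pos f \<and> p.transform g = q.transform f"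
    and "\<exists>g\<in>L2 pos. l2_norm pos g \<le> l2_norm pos f \<and> q.transform g = p.transform f"
proof -
  have pL: "w \<in> right_half_plane \<Longrightarrow> p.avg w \<in> L2 pos" and qL: "w \<in> right_half_plane \<Longrightarrow> q.avg w \<in> L2 pos" for w
    by (auto simp: right_half_plane_def intro: p.avg_L2 q.avg_L2)
  have gram: "l2_inner pos (q.avg z) (q.avg w) = l2_inner pos (p.avg z) (p.avg w)"
    if "z \<in> right_half_plane" "w \<in> right_half_plane" for z w
    using that by (simp add: right_half_plane_def q_inner p_inner)
  obtain g where g: "g \<in> L2 pos" "l2_norm pos g \<le> l2_norm pos f"
      "\<And>w. w \<in> right_half_plane \<Longrightarrow> l2_inner pos (p.avg w) g = l2_inner pos (q.avg w) f"
    by (rule gram_transfer[where I = right_half_plane and b = q.avg and b' = p.avg and M = pos and f = f])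
      (assumption | rule qL pL gram f that)+
  have "p.transform g = q.transform f"
  proof
    fix w
    show "p.transform g w = q.transform f w"
    proof (cases "0 < Re w")
      case True
      then have "l2_inner pos (p.avg (cnj w)) g = l2_inner pos (q.avg (cnj w)) f"
        by (intro g(3)) (simp add: right_half_plane_def)
      then show ?thesis
        using True l2_inner_cnj[of pos g "p.avg (cnj w)"] l2_inner_cnj[of pos f "q.avg (cnj w)"]
        by (simp add: p.transform_inner q.transform_inner)
    qed (simp add: p.transform_outside q.transform_outside)
  qed
  with g show "\<exists>g\<in>L2 pos. l2_norm pos g \<le> l2_norm pos f \<and> p.transform g = q.transform f"
    by blast
  obtain h where h: "h \<in> L2 pos" "l2_norm pos h \<le> l2_norm pos f"
      "\<And>w. w \<in> right_half_plane \<Longrightarrow> l2_inner pos (q.avg w) h = l2_inner pos (p.avg w) f"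
    by (rule gram_transfer[where I = right_half_plane and b = p.avg and b' = q.avg and M = pos and f = f])
      (assumption | rule qL pL gram[symmetric] f that)+
  have "q.transform h = p.transform f"
  proof
    fix w
    show "q.transform h w = p.transform f w"
    proof (cases "0 < Re w")
      case True
      then have "l2_inner pos (q.avg (cnj w)) h = l2_inner pos (p.avg (cnj w)) f"
        by (intro h(3)) (simp add: right_half_plane_def)
      then show ?thesis
        using True l2_inner_cnj[of pos h "q.avg (cnj w)"] l2_inner_cnj[of pos f "p.avg (cnj w)"]
        by (simp add: p.transform_inner q.transform_inner)
    qed (simp add: p.transform_outside q.transform_outside)
  qed
  with h show "\<exists>g\<in>L2 pos. l2_norm pos g \<le> l2_norm pos f \<and> q.transform g = p.transform f"
    by blast
qed

lemma p_transform_inj: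
  assumes "f \<in> L2 pos" "g \<in> L2 pos" "p.transform f = p.transform g"
  shows "AE t in pos. f t = g t"
proof -
  have "AE t in pos. f t - g t = 0"
    using p.transform_lincomb[OF assms(1,2), of 1 "-1"] assms
    by (intro p_total L2_diff) auto
  then show ?thesis by eventually_elim simp
qed

lemma q_transform_inj:
  assumes "f \<in> L2 pos" "g \<in> L2 pos" "q.transform f = q.transform g"
  shows "AE t in pos. f t = g t"
proof -
  have "AE t in pos. f t - g t = 0"
    using q.transform_lincomb[OF assms(1,2), of 1 "-1"] assms
    by (intro q_total L2_diff) auto
  then show ?thesis by eventually_elim simp
qed

text \<open>\<open>transform_exchange\<close> gives a contraction in each direction, and injectivity
  of both transforms shows that the two invert each other.\<close>

lemma transform_norm_eq:
  assumes f: "f \<in> L2 pos" and g: "g \<in> L2 pos" and eq: "p.transform g = q.transform f"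
  shows "l2_norm pos g = l2_norm pos f"
proof (rule antisym)
  obtain g' where g': "g' \<in> L2 pos" "l2_norm pos g' \<le> l2_norm pos f" "p.transform g' = q.transform f"
    using transform_exchange(1)[OF f] by blast
  have "l2_norm pos g' = l2_norm pos g"
    using g'(1) g p_transform_inj[OF g'(1) g] g'(3) eq by (intro l2_norm_cong_AE) (auto dest: L2_measurable)
  then show "l2_norm pos g \<le> l2_norm pos f" using g' by simp
  obtain f' where f': "f' \<in> L2 pos" "l2_norm pos f' \<le> l2_norm pos g" "q.transform f' = p.transform g"
    using transform_exchange(2)[OF g] by blast
  have "l2_norm pos f' = l2_norm pos f"
    using f'(1) f q_transform_inj[OF f'(1) f] f'(3) eq by (intro l2_norm_cong_AE) (auto dest: L2_measurable)
  then show "l2_norm pos f \<le> l2_norm pos g" using f' by simp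
qed

end

section \<open>The Laplace transform of the real operator\<close>

lemma integral_pos_below:
  fixes h :: "real \<Rightarrow> complex"
  assumes u: "0 < u"
  shows "(LINT s|pos. (if s < u then h s else 0)) = u *\<^sub>R (LINT x|unit_leb. h (u * x))"
proof -
  have "(LINT s|pos. (if s < u then h s else 0)) = (LINT s|lborel. indicator {0<..} s *\<^sub>R (if s < u then h s else 0))"
    by (simp add: integral_restrict_space)
  also have "\<dots> = \<bar>u\<bar> *\<^sub>R (LINT x|lborel. indicator {0<..} (0 + u * x) *\<^sub>R (if 0 + u * x < u then h (0 + u * x) else 0))"
    using u by (intro lborel_integral_real_affine) simp
  also have "(\<lambda>x. indicator {0<..} (0 + u * x) *\<^sub>R (if 0 + u * x < u then h (0 + u * x) else 0))
      = (\<lambda>x. indicator {0<..<1} x *\<^sub>R h (u * x))"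
    using u by (auto simp: fun_eq_iff zero_less_mult_iff split: split_indicator)
  finally show ?thesis
    using u by (simp add: integral_restrict_space)
qed

lemma nn_integral_pos_below:
  fixes h :: "real \<Rightarrow> ennreal"
  assumes u: "0 < u" and [measurable]: "h \<in> borel_measurable borel"
  shows "(\<integral>\<^sup>+s. (if s < u then h s else 0) \<partial>pos) = ennreal u * (\<integral>\<^sup>+x. h (u * x) \<partial>unit_leb)"
proof -
  have "(\<integral>\<^sup>+s. (if s < u then h s else 0) \<partial>pos) = (\<integral>\<^sup>+s. (if s < u then h s else 0) * indicator {0<..} s \<partial>lborel)"
    by (subst nn_integral_restrict_space) auto
  also have "\<dots> = ennreal \<bar>u\<bar> * (\<integral>\<^sup>+x. (if 0 + u * x < u then h (0 + u * x) else 0) * indicator {0<..} (0 + u * x) \<partial>lborel)"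
    using u by (intro nn_integral_real_affine) auto
  also have "(\<lambda>x. (if 0 + u * x < u then h (0 + u * x) else 0) * indicator {0<..} (0 + u * x)) = (\<lambda>x. h (u * x) * indicator {0<..<1} x)"
    using u by (auto simp: fun_eq_iff zero_less_mult_iff split: split_indicator)
  finally show ?thesis
    using u by (subst nn_integral_restrict_space) auto
qed

context cesaro
begin

definition fractional_kernel :: "real \<Rightarrow> real \<Rightarrow> real" where
  "fractional_kernel s u = (if s < u then \<alpha> * (u - s) powr (\<alpha> - 1) / u powr \<alpha> else 0)"

text \<open>The kernel is homogeneous of degree -1, so the substitution s = u * x leaves a weight in
  x alone, that of the family with m x = 1.\<close>

lemma fractional_kernel_scaled:
  assumes "0 < u" "0 < x" "x < 1"
  shows "u * (\<alpha> * (u - u * x) powr (\<alpha> - 1) / u powr \<alpha>) = q.weight x"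
proof -
  have "(u - u * x) powr (\<alpha> - 1) = u powr (\<alpha> - 1) * (1 - x) powr (\<alpha> - 1)"
    using assms powr_mult[of u "1 - x" "\<alpha> - 1"] by (simp add: algebra_simps)
  moreover have "u powr \<alpha> = u * u powr (\<alpha> - 1)"
    using assms powr_add[of u 1 "\<alpha> - 1"] by simp
  ultimately show ?thesis
    using assms by (simp add: q_weight)
qed

lemma cesaro_star_real_eq:
  assumes "0 < s"
  shows "cesaro_star_real \<alpha> g s = (LINT u|pos. of_real (fractional_kernel s u) * g u)"
proof -
  have "(LINT u|pos. of_real (fractional_kernel s u) * g u)
      = (LINT u|lborel. \<alpha> *\<^sub>R (indicator {s<..} u *\<^sub>R (((u - s) powr (\<alpha> - 1) / u powr \<alpha>) *\<^sub>R g u)))"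
    using assms
    by (subst integral_restrict_space)
      (auto simp: fractional_kernel_def scaleR_conv_of_real intro!: Bochner_Integration.integral_cong split: split_indicator)
  then show ?thesis
    unfolding cesaro_star_real_def set_lebesgue_integral_def by (simp only: integral_scaleR_right)
qed

lemma fractional_measurable:
  assumes g: "g \<in> borel_measurable pos"
  shows "(\<lambda>(s, u). of_real (fractional_kernel s u) * g u * expfun w s) \<in> borel_measurable (pos \<Otimes>\<^sub>M pos)"
proof -
  have [measurable]: "(\<lambda>p. fst p) \<in> borel_measurable (pos \<Otimes>\<^sub>M pos)" "(\<lambda>p. snd p) \<in> borel_measurable (pos \<Otimes>\<^sub>M pos)"
    "(\<lambda>p. g (snd p)) \<in> borel_measurable (pos \<Otimes>\<^sub>M pos)"
    by (rule measurable_compose[OF measurable_fst measurable_leb_id] measurable_compose[OF measurable_snd measurable_leb_id]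
        measurable_compose[OF measurable_snd g])+
  show ?thesis
    unfolding fractional_kernel_def case_prod_beta' by measurable
qed

text \<open>For fixed u the substitution s = u * x turns the inner integral into the one for
  \<open>q.avg\<close>, whose absolute double integral is finite.\<close>

lemma fractional_integrable_pair:
  assumes g: "g \<in> L2 pos" and w: "0 < Re w"
  shows "integrable (pos \<Otimes>\<^sub>M pos) (\<lambda>(s, u). of_real (fractional_kernel s u) * g u * expfun w s)"
proof -
  interpret pair_sigma_finite pos pos by (rule pair_sigma_finite_leb) auto
  interpret U: pair_sigma_finite pos unit_leb by (rule q.pair_pos_unit)
  have g_meas: "g \<in> borel_measurable pos" using g by (rule L2_measurable)
  note q_int = q.avg_integrable_pair[OF g w]
  show ?thesis
  proof (rule integrable_pairI)
    show "(\<lambda>(s, u). of_real (fractional_kernel s u) * g u * expfun w s) \<in> borel_measurable (pos \<Otimes>\<^sub>M pos)"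
      by (rule fractional_measurable[OF g_meas])
    have "(\<integral>\<^sup>+u. \<integral>\<^sup>+s. ennreal (norm (of_real (fractional_kernel s u) * g u * expfun w s)) \<partial>pos \<partial>pos)
        = (\<integral>\<^sup>+u. \<integral>\<^sup>+x. ennreal (norm (of_real (q.weight x) * expfun (w * of_real (q.rate x)) u * g u)) \<partial>unit_leb \<partial>pos)"
    proof (rule nn_integral_cong)
      fix u assume "u \<in> space pos"
      then have u: "0 < u" by (simp add: space_restrict_space)
      have "(\<integral>\<^sup>+s. ennreal (norm (of_real (fractional_kernel s u) * g u * expfun w s)) \<partial>pos)
          = (\<integral>\<^sup>+s. (if s < u then ennreal (norm (of_real (\<alpha> * (u - s) powr (\<alpha> - 1) / u powr \<alpha>) * g u * expfun w s)) else 0) \<partial>pos)"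
        by (auto simp: fractional_kernel_def intro!: nn_integral_cong)
      also have "\<dots> = ennreal u * (\<integral>\<^sup>+x. ennreal (norm (of_real (\<alpha> * (u - u * x) powr (\<alpha> - 1) / u powr \<alpha>) * g u * expfun w (u * x))) \<partial>unit_leb)"
        by (intro nn_integral_pos_below u) measurable
      also have "\<dots> = (\<integral>\<^sup>+x. ennreal u * ennreal (norm (of_real (\<alpha> * (u - u * x) powr (\<alpha> - 1) / u powr \<alpha>) * g u * expfun w (u * x))) \<partial>unit_leb)"
        by (intro nn_integral_cmult[symmetric] measurable_restrict_space1) measurable
      also have "\<dots> = (\<integral>\<^sup>+x. ennreal (norm (of_real (q.weight x) * expfun (w * of_real (q.rate x)) u * g u)) \<partial>unit_leb)"
      proof (rule nn_integral_cong)
        fix x assume "x \<in> space unit_leb"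
        then have x: "0 < x" "x < 1" by (auto simp: space_restrict_space)
        have "ennreal u * ennreal (norm (of_real (\<alpha> * (u - u * x) powr (\<alpha> - 1) / u powr \<alpha>) * g u * expfun w (u * x)))
            = ennreal (norm (of_real (u * (\<alpha> * (u - u * x) powr (\<alpha> - 1) / u powr \<alpha>)) * g u * expfun w (u * x)))"
          using u by (simp add: ennreal_mult[symmetric] norm_mult norm_divide mult.assoc)
        then show "ennreal u * ennreal (norm (of_real (\<alpha> * (u - u * x) powr (\<alpha> - 1) / u powr \<alpha>) * g u * expfun w (u * x)))
            = ennreal (norm (of_real (q.weight x) * expfun (w * of_real (q.rate x)) u * g u))"
          by (simp only: fractional_kernel_scaled[OF u x] q_rate) (simp add: expfun_def norm_mult mult_ac)
      qed
      finally show "(\<integral>\<^sup>+s. ennreal (norm (of_real (fractional_kernel s u) * g u * expfun w s)) \<partial>pos)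
          = (\<integral>\<^sup>+x. ennreal (norm (of_real (q.weight x) * expfun (w * of_real (q.rate x)) u * g u)) \<partial>unit_leb)" .
    qed
    also have "\<dots> = (\<integral>\<^sup>+z. ennreal (norm (case z of (u, x) \<Rightarrow> of_real (q.weight x) * expfun (w * of_real (q.rate x)) u * g u)) \<partial>(pos \<Otimes>\<^sub>M unit_leb))"
      using borel_measurable_integrable[OF q_int]
      by (subst U.M2.nn_integral_fst[symmetric]) (auto simp: case_prod_beta')
    also have "\<dots> < \<infinity>"
      using q_int by (simp add: integrable_iff_bounded)
    finally show "(\<integral>\<^sup>+u. \<integral>\<^sup>+s. ennreal (norm (of_real (fractional_kernel s u) * g u * expfun w s)) \<partial>pos \<partial>pos) < \<infinity>" .
  qed
qed

lemma cesaro_star_real_measurable: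
  assumes "g \<in> L2 pos"
  shows "cesaro_star_real \<alpha> g \<in> borel_measurable pos"
proof -
  \<comment> \<open>The parameter 0 makes the exponential factor equal to 1.\<close>
  have "(\<lambda>(s, u). of_real (fractional_kernel s u) * g u) \<in> borel_measurable (pos \<Otimes>\<^sub>M pos)"
    using fractional_measurable[OF L2_measurable[OF assms], of 0] by (simp add: expfun_def)
  then have "(\<lambda>s. LINT u|pos. of_real (fractional_kernel s u) * g u) \<in> borel_measurable pos"
    by (rule pos.borel_measurable_lebesgue_integral)
  moreover have "(\<lambda>s. LINT u|pos. of_real (fractional_kernel s u) * g u) \<in> borel_measurable pos
      \<longleftrightarrow> cesaro_star_real \<alpha> g \<in> borel_measurable pos"
    by (rule measurable_cong) (simp add: cesaro_star_real_eq space_restrict_space)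
  ultimately show ?thesis by simp
qed

text \<open>Fubini and the substitution s = u * x move the operator onto the exponential, where its
  adjoint produces \<open>q.avg w\<close>. Integrability against exponentials stands in for
  square-integrability of the image in later arguments.\<close>

lemma laplace_cesaro_star_real:
  assumes g: "g \<in> L2 pos" and w: "0 < Re w"
  shows "integrable pos (\<lambda>s. cesaro_star_real \<alpha> g s * expfun w s)"
    and "laplace (cesaro_star_real \<alpha> g) w = q.transform g w"
proof -
  interpret pair_sigma_finite pos pos by (rule pair_sigma_finite_leb) auto
  note int = fractional_integrable_pair[OF g w]
  have fst_eq: "(LINT u|pos. of_real (fractional_kernel s u) * g u * expfun w s) = cesaro_star_real \<alpha> g s * expfun w s"
    if "s \<in> space pos" for s
    using that by (simp add: cesaro_star_real_eq space_restrict_space)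
  have snd_eq: "(LINT s|pos. of_real (fractional_kernel s u) * g u * expfun w s) = g u * q.avg w u"
    if "u \<in> space pos" for u
  proof -
    have u: "0 < u" using that by (simp add: space_restrict_space)
    have "(LINT s|pos. of_real (fractional_kernel s u) * g u * expfun w s)
        = (LINT s|pos. (if s < u then of_real (\<alpha> * (u - s) powr (\<alpha> - 1) / u powr \<alpha>) * g u * expfun w s else 0))"
      by (auto simp: fractional_kernel_def intro!: Bochner_Integration.integral_cong)
    also have "\<dots> = u *\<^sub>R (LINT x|unit_leb. of_real (\<alpha> * (u - u * x) powr (\<alpha> - 1) / u powr \<alpha>) * g u * expfun w (u * x))"
      by (rule integral_pos_below[OF u])
    also have "\<dots> = (LINT x|unit_leb. u *\<^sub>R (of_real (\<alpha> * (u - u * x) powr (\<alpha> - 1) / u powr \<alpha>) * g u * expfun w (u * x)))"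
      by simp
    also have "\<dots> = (LINT x|unit_leb. of_real (q.weight x) * expfun (w * of_real (q.rate x)) u * g u)"
    proof (rule Bochner_Integration.integral_cong[OF refl])
      fix x assume "x \<in> space unit_leb"
      then have x: "0 < x" "x < 1" by (auto simp: space_restrict_space)
      have "u *\<^sub>R (of_real (\<alpha> * (u - u * x) powr (\<alpha> - 1) / u powr \<alpha>) * g u * expfun w (u * x))
          = of_real (u * (\<alpha> * (u - u * x) powr (\<alpha> - 1) / u powr \<alpha>)) * g u * expfun w (u * x)"
        by (simp add: scaleR_conv_of_real)
      then show "u *\<^sub>R (of_real (\<alpha> * (u - u * x) powr (\<alpha> - 1) / u powr \<alpha>) * g u * expfun w (u * x))
          = of_real (q.weight x) * expfun (w * of_real (q.rate x)) u * g u"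
        by (simp only: fractional_kernel_scaled[OF u x] q_rate) (simp add: expfun_def mult_ac)
    qed
    also have "\<dots> = g u * q.avg w u" by (rule q.avg_eq)
    finally show ?thesis .
  qed
  have "integrable pos (\<lambda>s. LINT u|pos. of_real (fractional_kernel s u) * g u * expfun w s)"
    by (rule integrable_fst[OF int])
  moreover have "integrable pos (\<lambda>s. LINT u|pos. of_real (fractional_kernel s u) * g u * expfun w s)
      \<longleftrightarrow> integrable pos (\<lambda>s. cesaro_star_real \<alpha> g s * expfun w s)"
    by (rule Bochner_Integration.integrable_cong[OF refl fst_eq])
  ultimately show "integrable pos (\<lambda>s. cesaro_star_real \<alpha> g s * expfun w s)" by simp
  have "laplace (cesaro_star_real \<alpha> g) w = (LINT s|pos. LINT u|pos. of_real (fractional_kernel s u) * g u * expfun w s)"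
    unfolding laplace_eq[OF w] by (rule Bochner_Integration.integral_cong[OF refl fst_eq[symmetric]])
  also have "\<dots> = (LINT u|pos. LINT s|pos. of_real (fractional_kernel s u) * g u * expfun w s)"
    by (rule Fubini_integral[OF int, symmetric])
  also have "\<dots> = (LINT u|pos. g u * q.avg w u)"
    by (rule Bochner_Integration.integral_cong[OF refl snd_eq])
  finally show "laplace (cesaro_star_real \<alpha> g) w = q.transform g w"
    using w by (simp add: q.transform_eq)
qed

text \<open>An a.e. statement: for small \<alpha> the defining integral may diverge at single points
  s, where the Lebesgue integral takes its default value 0 and additivity can fail.\<close>

lemma cesaro_star_real_lincomb:
  assumes f: "f \<in> L2 pos" and g: "g \<in> L2 pos"
  shows "AE s in pos. cesaro_star_real \<alpha> (\<lambda>t. a * f t + b * g t) s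
    = a * cesaro_star_real \<alpha> f s + b * cesaro_star_real \<alpha> g s"
proof -
  interpret pair_sigma_finite pos pos by (rule pair_sigma_finite_leb) auto
  have int: "AE s in pos. integrable pos (\<lambda>u. of_real (fractional_kernel s u) * h u)" if "h \<in> L2 pos" for h
  proof -
    have "AE s in pos. integrable pos (\<lambda>u. of_real (fractional_kernel s u) * h u * expfun 1 s)"
      using AE_integrable_fst[OF fractional_integrable_pair[OF that, of 1]] by simp
    then show ?thesis
    proof eventually_elim
      case (elim s)
      \<comment> \<open>The exponential vanishes nowhere and can be divided out.\<close>
      show ?case
        using integrable_mult_left[OF elim, of "inverse (expfun 1 s)"] by (simp add: expfun_def mult.assoc)
    qed
  qed
  show ?thesis
    using int[OF f] int[OF g] AE_space
  proof eventually_elim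
    case (elim s)
    then have s: "0 < s" by (simp add: space_restrict_space)
    have "(\<lambda>u. of_real (fractional_kernel s u) * (a * f u + b * g u))
        = (\<lambda>u. a * (of_real (fractional_kernel s u) * f u) + b * (of_real (fractional_kernel s u) * g u))"
      by (simp add: algebra_simps)
    then show ?case
      using elim by (simp add: cesaro_star_real_eq[OF s])
  qed
qed

end

section \<open>Dilations\<close>

lemma integral_pos_scale:
  fixes h :: "real \<Rightarrow> 'a::{banach, second_countable_topology}"
  assumes c: "0 < c"
  shows "(LINT u|pos. h (c * u)) = (1 / c) *\<^sub>R (LINT u|pos. h u)"
    and "integrable pos h \<Longrightarrow> integrable pos (\<lambda>u. h (c * u))"
proof -
  have eq: "(\<lambda>x. indicator {0<..} (0 + c * x) *\<^sub>R h (0 + c * x)) = (\<lambda>x. indicator {0<..} x *\<^sub>R h (c * x))"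
    using c by (auto simp: fun_eq_iff zero_less_mult_iff split: split_indicator)
  have "(LINT u|pos. h u) = (LINT u|lborel. indicator {0<..} u *\<^sub>R h u)"
    by (simp add: integral_restrict_space)
  also have "\<dots> = \<bar>c\<bar> *\<^sub>R (LINT x|lborel. indicator {0<..} (0 + c * x) *\<^sub>R h (0 + c * x))"
    using c by (intro lborel_integral_real_affine) simp
  also have "\<dots> = c *\<^sub>R (LINT u|pos. h (c * u))"
    unfolding eq using c by (simp add: integral_restrict_space)
  finally show "(LINT u|pos. h (c * u)) = (1 / c) *\<^sub>R (LINT u|pos. h u)"
    using c by simp
  assume "integrable pos h"
  then have "integrable lborel (\<lambda>u. indicator {0<..} u *\<^sub>R h u)"
    by (simp add: integrable_restrict_space)
  then have "integrable lborel (\<lambda>x. indicator {0<..} (0 + c * x) *\<^sub>R h (0 + c * x))"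
    using c by (intro lborel_integrable_real_affine) auto
  then show "integrable pos (\<lambda>u. h (c * u))"
    unfolding eq by (simp add: integrable_restrict_space)
qed

lemma measurable_pos_scale:
  assumes "f \<in> borel_measurable pos" "0 < c"
  shows "(\<lambda>u. f (c * u)) \<in> borel_measurable pos"
proof (rule measurable_compose[OF _ assms(1)])
  have "(\<lambda>u. c * u) \<in> borel_measurable (leb {0<..})"
    by (intro measurable_restrict_space1) simp
  then show "(\<lambda>u. c * u) \<in> pos \<rightarrow>\<^sub>M pos"
    using assms(2) by (intro measurable_restrict_space2) (auto simp: space_restrict_space)
qed

definition dil :: "real \<Rightarrow> (real \<Rightarrow> complex) \<Rightarrow> real \<Rightarrow> complex" where
  "dil t f u = of_real (exp (- t / 2)) * f (exp (- t) * u)"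

lemma dil_L2:
  assumes f: "f \<in> L2 pos"
  shows "dil t f \<in> L2 pos" "l2_norm pos (dil t f) = l2_norm pos f"
proof -
  have sq: "(cmod (dil t f u))\<^sup>2 = exp (- t) * (cmod (f (exp (- t) * u)))\<^sup>2" for u
    by (simp add: dil_def norm_mult power_mult_distrib power2_eq_square[of "exp _"] exp_add[symmetric])
  show "dil t f \<in> L2 pos"
  proof (rule L2I)
    show "integrable pos (\<lambda>u. (cmod (dil t f u))\<^sup>2)"
      unfolding sq using integral_pos_scale(2)[OF _ L2_integrable_square[OF f], of "exp (- t)"]
      by (intro integrable_mult_right) simp
    show "dil t f \<in> borel_measurable pos"
      unfolding dil_def[abs_def]
      by (intro borel_measurable_times borel_measurable_const measurable_pos_scale L2_measurable[OF f]) simp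
  qed
  have "(LINT u|pos. (cmod (dil t f u))\<^sup>2) = (LINT u|pos. (cmod (f u))\<^sup>2)"
    unfolding sq using integral_pos_scale(1)[of "exp (- t)" "\<lambda>u. (cmod (f u))\<^sup>2"]
    by (simp add: exp_minus field_simps)
  then show "l2_norm pos (dil t f) = l2_norm pos f"
    by (simp add: l2_norm_def)
qed

text \<open>The Laplace transform reverses the direction of a dilation: compressing the half-line
  stretches the half-plane. This sign is why averages of \<open>dilation (- t)\<close> correspond to
  averages of \<open>dil t\<close>.\<close>

lemma laplace_dil: "laplace (dil t f) z = dilation (- t) (laplace f) z"
proof (cases "0 < Re z")
  case True
  have eq: "dil t f u * expfun z u = of_real (exp (- t / 2)) * (f (exp (- t) * u) * expfun (exp t *\<^sub>R z) (exp (- t) * u))" for u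
  proof -
    have "expfun (exp t *\<^sub>R z) (exp (- t) * u) = expfun z u"
      by (simp add: expfun_def scaleR_conv_of_real exp_of_real[symmetric] mult_ac) (simp add: exp_minus field_simps)
    then show ?thesis by (simp add: dil_def)
  qed
  have "laplace (dil t f) z = of_real (exp (- t / 2)) * (LINT u|pos. f (exp (- t) * u) * expfun (exp t *\<^sub>R z) (exp (- t) * u))"
    using True by (simp add: laplace_eq eq)
  also have "\<dots> = of_real (exp (- t / 2)) * ((1 / exp (- t)) *\<^sub>R laplace f (exp t *\<^sub>R z))"
    using True integral_pos_scale(1)[of "exp (- t)" "\<lambda>v. f v * expfun (exp t *\<^sub>R z) v"] by (simp add: laplace_eq)
  also have "\<dots> = of_real (exp (- t / 2) * exp t) * laplace f (exp t *\<^sub>R z)"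
    by (simp add: scaleR_conv_of_real exp_minus field_simps)
  also have "exp (- t / 2) * exp t = exp (t / 2)"
    by (simp add: exp_add[symmetric])
  finally show ?thesis
    by (simp add: dilation_def scaleR_conv_of_real)
next
  case False
  then show ?thesis
    by (simp add: dilation_def laplace_outside zero_less_mult_iff)
qed

lemma l2_norm_sum_le:
  assumes "\<And>i. i \<in> I \<Longrightarrow> b i \<in> L2 M"
  shows "l2_norm M (\<lambda>t. \<Sum>i\<in>I. c i * b i t) \<le> (\<Sum>i\<in>I. cmod (c i) * l2_norm M (b i))"
  using assms
proof (induction I rule: infinite_finite_induct)
  case (insert i I)
  have "l2_norm M (\<lambda>t. c i * b i t + (\<Sum>i\<in>I. c i * b i t)) \<le> l2_norm M (\<lambda>t. c i * b i t) + l2_norm M (\<lambda>t. \<Sum>i\<in>I. c i * b i t)"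
    using insert.prems by (intro l2_norm_triangle L2_scale L2_sum) auto
  then show ?case
    using insert by (simp add: l2_norm_scale)
qed simp_all

text \<open>Dilations preserve the norm, so the squared distance is 2 * A minus twice the real part
  of an inner product, which for dilated exponentials is the explicit continuous expression
  c.\<close>

lemma dil_expfun_continuous:
  assumes w: "0 < Re w" and lim: "r \<longlonglongrightarrow> t"
  shows "(\<lambda>n. l2_norm pos (\<lambda>u. dil (r n) (expfun w) u - dil t (expfun w) u)) \<longlonglongrightarrow> 0"
proof -
  have e: "expfun w \<in> L2 pos" using w by (rule expfun_L2)
  define A where "A = (l2_norm pos (expfun w))\<^sup>2"
  have A: "A = 1 / (2 * Re w)"
    using w by (simp add: A_def expfun_norm power_divide)
  have dil_exp: "dil s (expfun w) = (\<lambda>u. of_real (exp (- s / 2)) * expfun (exp (- s) *\<^sub>R w) u)" for s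
    by (simp add: dil_def expfun_def scaleR_conv_of_real fun_eq_iff mult_ac)
  define c where "c s = exp (- s / 2) * exp (- t / 2) / (exp (- s) *\<^sub>R w + cnj (exp (- t) *\<^sub>R w))" for s
  have inner: "l2_inner pos (dil s (expfun w)) (dil t (expfun w)) = c s" for s
    using w by (simp add: dil_exp l2_inner_scale_left l2_inner_scale_right expfun_inner c_def)
  have sq: "(l2_norm pos (\<lambda>u. dil s (expfun w) u - dil t (expfun w) u))\<^sup>2 = 2 * A - 2 * Re (c s)" for s
    using l2_norm_add_sq[OF dil_L2(1)[OF e] L2_scale[OF dil_L2(1)[OF e]], of s "-1" t]
      l2_inner_scale_right[of pos "dil s (expfun w)" "-1" "dil t (expfun w)"] l2_norm_scale[of pos "-1" "dil t (expfun w)"]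
    by (simp add: dil_L2(2)[OF e] A_def[symmetric] inner)
  have nz: "exp (- t) *\<^sub>R w + cnj (exp (- t) *\<^sub>R w) \<noteq> 0"
    using w by (simp add: complex_eq_iff)
  have "c t = complex_of_real A"
  proof -
    have "exp (- t) *\<^sub>R w + cnj (exp (- t) *\<^sub>R w) = of_real (exp (- t) * (2 * Re w))"
      by (simp add: complex_eq_iff)
    then have "c t = of_real (exp (- t / 2) * exp (- t / 2) / (exp (- t) * (2 * Re w)))"
      by (simp add: c_def)
    also have "exp (- t / 2) * exp (- t / 2) = exp (- t)"
      by (simp add: exp_add[symmetric])
    finally show ?thesis by (simp add: A)
  qed
  moreover have "(\<lambda>n. c (r n)) \<longlonglongrightarrow> c t"
    unfolding c_def by (intro tendsto_intros lim nz) simp_all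
  ultimately have "(\<lambda>n. sqrt (2 * A - 2 * Re (c (r n)))) \<longlonglongrightarrow> sqrt (2 * A - 2 * Re (complex_of_real A))"
    by (intro tendsto_intros) auto
  moreover have "sqrt (2 * A - 2 * Re (c s)) = l2_norm pos (\<lambda>u. dil s (expfun w) u - dil t (expfun w) u)" for s
    unfolding sq[symmetric] by simp
  ultimately show ?thesis
    by simp
qed

text \<open>Density of the exponentials extends strong continuity from them to f: of the three
  errors, the two outer ones are independent of the parameter because dilations are
  isometries.\<close>

lemma dil_continuous:
  assumes f: "f \<in> L2 pos" and lim: "r \<longlonglongrightarrow> t"
  shows "(\<lambda>n. l2_norm pos (\<lambda>u. dil (r n) f u - dil t f u)) \<longlonglongrightarrow> 0"
proof (rule LIMSEQ_I)
  fix e :: real assume e: "0 < e"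
  obtain S c where S: "\<And>n::nat. finite (S n)" "\<And>n. S n \<subseteq> right_half_plane"
    and dense: "(\<lambda>n. l2_norm pos (\<lambda>t. (\<Sum>w\<in>S n. c n w * expfun w t) - f t)) \<longlonglongrightarrow> 0"
    by (rule expfun_dense[OF f]) (assumption | rule that)+
  have "eventually (\<lambda>n. l2_norm pos (\<lambda>t. (\<Sum>w\<in>S n. c n w * expfun w t) - f t) < e / 3) sequentially"
    using e by (intro order_tendstoD(2)[OF dense]) simp
  then obtain k where k: "l2_norm pos (\<lambda>t. (\<Sum>w\<in>S k. c k w * expfun w t) - f t) < e / 3"
    by (auto simp: eventually_sequentially)
  define v where "v t = (\<Sum>w\<in>S k. c k w * expfun w t)" for t
  have Re: "0 < Re w" if "w \<in> S k" for w
    using that S(2)[of k] by (auto simp: right_half_plane_def)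
  have v: "v \<in> L2 pos"
    unfolding v_def by (intro L2_sum expfun_L2 Re)
  have near: "l2_norm pos (\<lambda>u. v u - f u) < e / 3"
    using k by (simp add: v_def)
  have dil_diff: "l2_norm pos (\<lambda>u. dil s v u - dil s f u) = l2_norm pos (\<lambda>u. v u - f u)" for s
    using dil_L2(2)[OF L2_diff[OF v f], of s] by (simp add: dil_def[abs_def] right_diff_distrib)
  have "(\<lambda>n. \<Sum>w\<in>S k. cmod (c k w) * l2_norm pos (\<lambda>u. dil (r n) (expfun w) u - dil t (expfun w) u)) \<longlonglongrightarrow> (\<Sum>w\<in>S k. cmod (c k w) * 0)"
    by (intro tendsto_intros dil_expfun_continuous lim Re)
  then have "eventually (\<lambda>n. (\<Sum>w\<in>S k. cmod (c k w) * l2_norm pos (\<lambda>u. dil (r n) (expfun w) u - dil t (expfun w) u)) < e / 3) sequentially"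
    using e by (intro order_tendstoD(2)) auto
  then obtain n0 where n0: "\<And>n. n \<ge> n0 \<Longrightarrow> (\<Sum>w\<in>S k. cmod (c k w) * l2_norm pos (\<lambda>u. dil (r n) (expfun w) u - dil t (expfun w) u)) < e / 3"
    by (auto simp: eventually_sequentially)
  show "\<exists>no. \<forall>n\<ge>no. norm (l2_norm pos (\<lambda>u. dil (r n) f u - dil t f u) - 0) < e"
  proof (intro exI[of _ n0] allI impI)
    fix n assume n: "n \<ge> n0"
    have "l2_norm pos (\<lambda>u. dil (r n) v u - dil t v u)
        = l2_norm pos (\<lambda>u. \<Sum>w\<in>S k. c k w * (dil (r n) (expfun w) u - dil t (expfun w) u))"
      by (simp add: dil_def v_def sum_distrib_left sum_subtractf[symmetric] algebra_simps)
    also have "\<dots> \<le> (\<Sum>w\<in>S k. cmod (c k w) * l2_norm pos (\<lambda>u. dil (r n) (expfun w) u - dil t (expfun w) u))"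
      by (intro l2_norm_sum_le L2_diff dil_L2(1) expfun_L2 Re)
    also have "\<dots> < e / 3"
      by (rule n0[OF n])
    finally have mid: "l2_norm pos (\<lambda>u. dil (r n) v u - dil t v u) < e / 3" .
    have "l2_norm pos (\<lambda>u. dil (r n) f u - dil t f u)
        \<le> l2_norm pos (\<lambda>u. dil (r n) f u - dil (r n) v u) + l2_norm pos (\<lambda>u. dil (r n) v u - dil t f u)"
      by (intro l2_norm_triangle_diff dil_L2(1) f v)
    also have "\<dots> \<le> l2_norm pos (\<lambda>u. dil (r n) f u - dil (r n) v u)
        + (l2_norm pos (\<lambda>u. dil (r n) v u - dil t v u) + l2_norm pos (\<lambda>u. dil t v u - dil t f u))"
      by (intro add_left_mono l2_norm_triangle_diff dil_L2(1) f v)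
    also have "\<dots> < e"
      using near mid dil_diff[of "r n"] dil_diff[of t] l2_norm_minus_commute[of pos "dil (r n) f" "dil (r n) v"] by simp
    finally show "norm (l2_norm pos (\<lambda>u. dil (r n) f u - dil t f u) - 0) < e"
      by simp
  qed
qed

section \<open>Bochner integrals in the Hardy space\<close>

lemma hardy_lincomb:
  assumes F: "F \<in> hardy" and G: "G \<in> hardy"
  shows "(\<lambda>z. a * F z + b * G z) \<in> hardy"
proof -
  obtain f where f: "f \<in> L2 pos" "laplace f = F" by (rule paley_wiener[OF F])
  obtain g where g: "g \<in> L2 pos" "laplace g = G" by (rule paley_wiener[OF G])
  have "laplace (\<lambda>t. a * f t + b * g t) = (\<lambda>z. a * F z + b * G z)"
    using laplace_lincomb[OF f(1) g(1), of a b] by (simp add: f(2) g(2) fun_eq_iff)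
  then show ?thesis
    using laplace_in_hardy(1)[OF L2_lincomb[OF f(1) g(1), of a b]] by simp
qed

lemma hardy_diff: "F \<in> hardy \<Longrightarrow> G \<in> hardy \<Longrightarrow> (\<lambda>z. F z - G z) \<in> hardy"
  using hardy_lincomb[of F G 1 "-1"] by simp

lemma hardy_zero: "(\<lambda>_. 0) \<in> hardy"
  using laplace_in_hardy(1)[OF L2_zero] by (simp add: laplace_def zero_ext_def)

lemma hardy_outside: "F \<in> hardy \<Longrightarrow> \<not> 0 < Re z \<Longrightarrow> F z = 0"
  by (simp add: hardy_def right_half_plane_def)

lemma hardy_point_bound:
  assumes F: "F \<in> hardy" and z: "0 < Re z"
  shows "cmod (F z) \<le> hardy_norm F / sqrt (2 * Re z)"
proof -
  obtain f where f: "f \<in> L2 pos" "laplace f = F" by (rule paley_wiener[OF F])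
  then show ?thesis
    using laplace_bound[OF f(1) z] hardy_norm_laplace[OF f(1)] by simp
qed

text \<open>The triangle inequality for integrals, obtained without vector-valued integration: the
  combination bound holds for each \<psi> t, integrating it over t gives one for the mean, and the
  duality criterion returns membership and norm.\<close>

lemma hardy_mean:
  assumes \<psi>: "\<And>t. t \<in> space pos \<Longrightarrow> \<psi> t \<in> hardy"
    and int: "\<And>w. 0 < Re w \<Longrightarrow> integrable pos (\<lambda>t. \<psi> t w)"
    and meas: "(\<lambda>t. hardy_norm (\<psi> t)) \<in> borel_measurable pos"
    and bound: "(\<integral>\<^sup>+t. ennreal (hardy_norm (\<psi> t)) \<partial>pos) \<le> ennreal C" and C: "0 \<le> C"
  shows "(\<lambda>w. LINT t|pos. \<psi> t w) \<in> hardy" "hardy_norm (\<lambda>w. LINT t|pos. \<psi> t w) \<le> C"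
proof -
  define J where "J w = (LINT t|pos. \<psi> t w)" for w
  have out: "J z = 0" if "z \<notin> right_half_plane" for z
  proof -
    have "J z = (LINT t|pos. 0)"
      unfolding J_def
    proof (rule Bochner_Integration.integral_cong[OF refl])
      fix t assume "t \<in> space pos"
      from hardy_outside[OF \<psi>[OF this], of z] that show "\<psi> t z = 0"
        by (simp add: right_half_plane_def)
    qed
    then show ?thesis by simp
  qed
  have "cmod (\<Sum>w\<in>S. c w * J w) \<le> C * l2_norm pos (\<lambda>t. \<Sum>w\<in>S. c w * expfun w t)"
    if S: "finite S" "S \<subseteq> right_half_plane" for S c
  proof -
    define L where "L = l2_norm pos (\<lambda>t. \<Sum>w\<in>S. c w * expfun w t)"
    have i: "integrable pos (\<lambda>t. c w * \<psi> t w)" if "w \<in> S" for w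
      using S(2) that by (intro integrable_mult_right int) (auto simp: right_half_plane_def)
    have "(\<Sum>w\<in>S. c w * J w) = (LINT t|pos. (\<Sum>w\<in>S. c w * \<psi> t w))"
      using i by (simp add: J_def Bochner_Integration.integral_sum)
    then have "ennreal (cmod (\<Sum>w\<in>S. c w * J w)) \<le> (\<integral>\<^sup>+t. ennreal (cmod (\<Sum>w\<in>S. c w * \<psi> t w)) \<partial>pos)"
      using integral_norm_bound_ennreal[OF Bochner_Integration.integrable_sum[of S pos "\<lambda>w t. c w * \<psi> t w", OF i]] by simp
    also have "\<dots> \<le> (\<integral>\<^sup>+t. ennreal L * ennreal (hardy_norm (\<psi> t)) \<partial>pos)"
    proof (rule nn_integral_mono)
      fix t assume "t \<in> space pos"
      then have "cmod (\<Sum>w\<in>S. c w * \<psi> t w) \<le> hardy_norm (\<psi> t) * L"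
        unfolding L_def by (intro hardy_combination_bound S \<psi>)
      then show "ennreal (cmod (\<Sum>w\<in>S. c w * \<psi> t w)) \<le> ennreal L * ennreal (hardy_norm (\<psi> t))"
        using hardy_norm_nonneg[OF \<psi>[OF \<open>t \<in> space pos\<close>]]
        by (subst ennreal_mult[symmetric]) (auto simp: L_def mult.commute intro: ennreal_leI)
    qed
    also have "\<dots> = ennreal L * (\<integral>\<^sup>+t. ennreal (hardy_norm (\<psi> t)) \<partial>pos)"
      using meas by (intro nn_integral_cmult) auto
    also have "\<dots> \<le> ennreal L * ennreal C"
      by (intro mult_left_mono bound) simp
    finally show ?thesis
      using C by (simp add: L_def ennreal_mult[symmetric] mult.commute ennreal_le_iff)
  qed
  then obtain g where g: "g \<in> L2 pos" "laplace g = J" "l2_norm pos g \<le> C"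
    by (rule laplace_representation[OF _ C out])
  have "J \<in> hardy" "hardy_norm J \<le> C"
    using laplace_in_hardy[OF g(1)] g by auto
  then show "(\<lambda>w. LINT t|pos. \<psi> t w) \<in> hardy" "hardy_norm (\<lambda>w. LINT t|pos. \<psi> t w) \<le> C"
    by (simp_all add: J_def[abs_def])
qed

lemma simple_bochner_integral_in_eq:
  assumes s: "simple_bochner_integrable_in M H s"
  shows "simple_bochner_integral_in M s z = (LINT t|M. s t z)" "integrable M (\<lambda>t. s t z)"
proof -
  have simple: "simple_function M s" and fin: "emeasure M {t \<in> space M. s t \<noteq> (\<lambda>_. 0)} \<noteq> \<infinity>"
    using s by (auto simp: simple_bochner_integrable_in_def)
  define A where "A y = {t \<in> space M. s t = y}" for y
  have finite: "finite (s ` space M)"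
    using simple by (simp add: simple_function_def)
  have A: "A y \<in> sets M" for y
  proof -
    have "A y = s -` {y} \<inter> space M" by (auto simp: A_def)
    then show ?thesis using simple_functionD(2)[OF simple] by simp
  qed
  \<comment> \<open>Only values with y z \<noteq> 0 contribute, and their level sets lie in the set
    where s is non-zero, which has finite measure. For y z = 0 the term vanishes even if the level
    set has infinite measure.\<close>
  have int_ind: "integrable M (indicator (A y) :: _ \<Rightarrow> real)" if "y z \<noteq> 0" for y
  proof -
    have "{t \<in> space M. s t \<noteq> (\<lambda>_. 0)} \<in> sets M"
    proof -
      have "{t \<in> space M. s t \<noteq> (\<lambda>_. 0)} = space M - A (\<lambda>_. 0)" by (auto simp: A_def)
      then show ?thesis using A by auto
    qed
    then have "emeasure M (A y) \<le> emeasure M {t \<in> space M. s t \<noteq> (\<lambda>_. 0)}"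
      using that by (intro emeasure_mono) (auto simp: A_def)
    then have "emeasure M (A y) < \<infinity>"
      using fin by (simp add: top.not_eq_extremum le_less_trans)
    then show ?thesis
      using A by (intro integrable_real_indicator)
  qed
  have int: "integrable M (\<lambda>t. indicator (A y) t *\<^sub>R y z)" for y
    using int_ind by (cases "y z = 0") (auto intro: integrable_scaleR_left)
  have val: "(LINT t|M. indicator (A y) t *\<^sub>R y z) = measure M (A y) *\<^sub>R y z" for y
    using A[of y] int_ind[of y] by (subst integral_scaleR_left) (auto simp: sets.Int_space_eq2)
  have eq: "s t z = (\<Sum>y\<in>s ` space M. indicator (A y) t *\<^sub>R y z)" if t: "t \<in> space M" for t
  proof -
    have "(\<Sum>y\<in>s ` space M. indicator (A y) t *\<^sub>R y z) = (\<Sum>y\<in>{s t}. indicator (A y) t *\<^sub>R y z)"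
      using finite t by (intro sum.mono_neutral_right) (auto simp: A_def)
    then show ?thesis using t by (simp add: A_def)
  qed
  have "(LINT t|M. s t z) = (LINT t|M. (\<Sum>y\<in>s ` space M. indicator (A y) t *\<^sub>R y z))"
    by (intro Bochner_Integration.integral_cong refl eq)
  also have "\<dots> = (\<Sum>y\<in>s ` space M. measure M (A y) *\<^sub>R y z)"
    using int by (simp add: Bochner_Integration.integral_sum val)
  finally show "simple_bochner_integral_in M s z = (LINT t|M. s t z)"
    by (simp add: simple_bochner_integral_in_def A_def)
  have "integrable M (\<lambda>t. (\<Sum>y\<in>s ` space M. indicator (A y) t *\<^sub>R y z))"
    by (intro Bochner_Integration.integrable_sum int)
  then show "integrable M (\<lambda>t. s t z)"
    using Bochner_Integration.integrable_cong[OF refl eq, of M] by simp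
qed

text \<open>Point evaluations are continuous on the Hardy space, so a Bochner integral is determined by
  the pointwise integrals.\<close>

lemma has_bochner_integral_in_hardy_eval:
  assumes \<phi>: "has_bochner_integral_in pos hardy hardy_norm \<phi> G"
    and int: "integrable pos (\<lambda>t. \<phi> t w)" and w: "0 < Re w"
  shows "G w = (LINT t|pos. \<phi> t w)"
proof -
  obtain s where phi_h: "\<And>t. t \<in> space pos \<Longrightarrow> \<phi> t \<in> hardy" and G: "G \<in> hardy"
    and s: "\<And>n::nat. simple_bochner_integrable_in pos hardy (s n)"
      "(\<lambda>n. \<integral>\<^sup>+ t. ennreal (hardy_norm (\<lambda>z. \<phi> t z - s n t z)) \<partial>pos) \<longlonglongrightarrow> 0"
      "(\<lambda>n. hardy_norm (\<lambda>z. simple_bochner_integral_in pos (s n) z - G z)) \<longlonglongrightarrow> 0"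
    and meas: "\<And>n. (\<lambda>t. hardy_norm (\<lambda>z. \<phi> t z - s n t z)) \<in> borel_measurable pos"
    using \<phi> unfolding has_bochner_integral_in_def by blast
  have s_h: "s n t \<in> hardy" if "t \<in> space pos" for n t
    using s(1)[of n] that by (auto simp: simple_bochner_integrable_in_def)
  \<comment> \<open>The norm of the evaluation at w; it converts errors in the Hardy norm into
    errors at w.\<close>
  define c where "c = 1 / sqrt (2 * Re w)"
  have c: "c > 0" using w by (simp add: c_def)
  define I where "I n = (LINT t|pos. s n t w)" for n
  have I_eq: "simple_bochner_integral_in pos (s n) w = I n" for n
    using simple_bochner_integral_in_eq(1)[OF s(1)] by (simp add: I_def)
  have "(\<lambda>n. ennreal c * (\<integral>\<^sup>+ t. ennreal (hardy_norm (\<lambda>z. \<phi> t z - s n t z)) \<partial>pos)) \<longlonglongrightarrow> ennreal c * 0"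
    by (rule ennreal_tendsto_cmult[OF _ s(2)]) simp
  then have up: "(\<lambda>n. ennreal c * (\<integral>\<^sup>+ t. ennreal (hardy_norm (\<lambda>z. \<phi> t z - s n t z)) \<partial>pos)) \<longlonglongrightarrow> 0"
    by (simp only: mult_zero_right)
  have le: "ennreal (cmod ((LINT t|pos. \<phi> t w) - I n)) \<le> ennreal c * (\<integral>\<^sup>+ t. ennreal (hardy_norm (\<lambda>z. \<phi> t z - s n t z)) \<partial>pos)" for n
  proof -
    have i: "integrable pos (\<lambda>t. s n t w)"
      by (rule simple_bochner_integral_in_eq(2)[OF s(1)])
    have "ennreal (cmod ((LINT t|pos. \<phi> t w) - I n)) \<le> (\<integral>\<^sup>+ t. ennreal (cmod (\<phi> t w - s n t w)) \<partial>pos)"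
      using integral_norm_bound_ennreal[OF Bochner_Integration.integrable_diff[OF int i]] int i by (simp add: I_def)
    also have "\<dots> \<le> (\<integral>\<^sup>+ t. ennreal c * ennreal (hardy_norm (\<lambda>z. \<phi> t z - s n t z)) \<partial>pos)"
    proof (rule nn_integral_mono)
      fix t assume t: "t \<in> space pos"
      have H: "(\<lambda>z. \<phi> t z - s n t z) \<in> hardy"
        by (intro hardy_diff phi_h s_h t)
      then show "ennreal (cmod (\<phi> t w - s n t w)) \<le> ennreal c * ennreal (hardy_norm (\<lambda>z. \<phi> t z - s n t z))"
        using hardy_point_bound[OF H w] hardy_norm_nonneg[OF H] c
        by (subst ennreal_mult[symmetric]) (auto simp: c_def intro: ennreal_leI)
    qed
    also have "\<dots> = ennreal c * (\<integral>\<^sup>+ t. ennreal (hardy_norm (\<lambda>z. \<phi> t z - s n t z)) \<partial>pos)"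
      using meas by (intro nn_integral_cmult) auto
    finally show ?thesis .
  qed
  have "(\<lambda>n. ennreal (cmod ((LINT t|pos. \<phi> t w) - I n))) \<longlonglongrightarrow> 0"
    by (rule tendsto_sandwich[OF _ _ tendsto_const up]) (simp_all only: zero_le le eventually_True)
  then have "(\<lambda>n. cmod ((LINT t|pos. \<phi> t w) - I n)) \<longlonglongrightarrow> 0"
    using tendsto_ennreal_iff[of "\<lambda>n. cmod ((LINT t|pos. \<phi> t w) - I n)" sequentially 0] by simp
  then have lim1: "(\<lambda>n. (LINT t|pos. \<phi> t w) - I n) \<longlonglongrightarrow> 0"
    by (rule tendsto_norm_zero_cancel)
  have "(\<lambda>n. I n - G w) \<longlonglongrightarrow> 0"
  proof (rule Lim_null_comparison)
    show "eventually (\<lambda>n. norm (I n - G w) \<le> c * hardy_norm (\<lambda>z. simple_bochner_integral_in pos (s n) z - G z)) sequentially"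
    proof (intro always_eventually allI)
      fix n
      have "finite (s n ` space pos)" "s n ` space pos \<subseteq> hardy"
        using s(1)[of n] by (auto simp: simple_bochner_integrable_in_def simple_function_def)
      then have "simple_bochner_integral_in pos (s n) \<in> hardy"
        unfolding simple_bochner_integral_in_def
      proof (induction rule: finite_induct)
        case (insert y Y)
        then show ?case
          using hardy_lincomb[of y _ "of_real (measure pos {t \<in> space pos. s n t = y})" 1]
          by (simp add: scaleR_conv_of_real)
      qed (simp add: hardy_zero)
      then show "norm (I n - G w) \<le> c * hardy_norm (\<lambda>z. simple_bochner_integral_in pos (s n) z - G z)"
        using hardy_point_bound[OF hardy_diff[OF _ G] w, of "simple_bochner_integral_in pos (s n)"]
        by (simp add: I_eq c_def)
    qed
    show "(\<lambda>n. c * hardy_norm (\<lambda>z. simple_bochner_integral_in pos (s n) z - G z)) \<longlonglongrightarrow> 0"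
      using tendsto_mult_right_zero[OF s(3)] .
  qed
  from tendsto_add[OF lim1 this] show ?thesis
    by (simp add: LIMSEQ_const_iff)
qed

lemma hardy_norm_minus_commute: "hardy_norm (\<lambda>z. F z - G z) = hardy_norm (\<lambda>z. G z - F z)"
  by (simp add: hardy_norm_def norm_minus_commute)

text \<open>The substitution x = exp (- t) links averages over the unit interval with the integral
  over the dilation group in the definition of the operator. It is carried out for completed
  Lebesgue measure and brought back by measurability of h.\<close>

lemma integral_unit_exp:
  fixes h :: "real \<Rightarrow> 'a::euclidean_space"
  assumes h: "h \<in> borel_measurable unit_leb"
  shows "integrable unit_leb h \<longleftrightarrow> integrable pos (\<lambda>t. exp (- t) *\<^sub>R h (exp (- t)))"
    and "(LINT x|unit_leb. h x) = (LINT t|pos. exp (- t) *\<^sub>R h (exp (- t)))"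
proof -
  define k where "k t = exp (- t) *\<^sub>R h (exp (- t))" for t :: real
  have h_meas: "(\<lambda>x. indicator {0<..<1} x *\<^sub>R h x) \<in> borel_measurable lborel"
    using h by (subst (asm) borel_measurable_restrict_space_iff) auto
  have k_meas: "(\<lambda>t. indicator {0<..} t *\<^sub>R k t) \<in> borel_measurable lborel"
  proof -
    have "(\<lambda>t. exp (- t)) \<in> pos \<rightarrow>\<^sub>M unit_leb"
      by (intro measurable_restrict_space2 measurable_restrict_space1) (auto simp: space_restrict_space)
    then have "(\<lambda>t. h (exp (- t))) \<in> borel_measurable pos"
      by (rule measurable_compose[OF _ h])
    then have "k \<in> borel_measurable pos"
      unfolding k_def by (intro borel_measurable_scaleR) (auto intro!: measurable_restrict_space1)
    then show ?thesis
      by (subst (asm) borel_measurable_restrict_space_iff) auto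
  qed
  have h_abs: "integrable unit_leb h \<longleftrightarrow> h absolutely_integrable_on {0<..<1}"
    "(LINT x|unit_leb. h x) = (LINT x:{0<..<1}|lebesgue. h x)"
    using h_meas
    by (simp_all add: set_integrable_def set_lebesgue_integral_def integrable_restrict_space
        integral_restrict_space integrable_completion integral_completion)
  have k_abs: "integrable pos k \<longleftrightarrow> k absolutely_integrable_on {0<..}"
    "(LINT t|pos. k t) = (LINT t:{0<..}|lebesgue. k t)"
    using k_meas
    by (simp_all add: set_integrable_def set_lebesgue_integral_def integrable_restrict_space
        integral_restrict_space integrable_completion integral_completion)
  have img: "(\<lambda>t::real. exp (- t)) ` {0<..} = {0<..<1}"
  proof -
    have "x \<in> (\<lambda>t. exp (- t)) ` {0<..}" if "0 < x" "x < 1" for x :: real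
      using that by (intro image_eqI[of _ _ "- ln x"]) auto
    then show ?thesis by auto
  qed
  have der: "((\<lambda>t::real. exp (- t)) has_field_derivative - exp (- t)) (at t within {0<..})" for t
    by (auto intro!: derivative_eq_intros)
  have inj: "inj_on (\<lambda>t::real. exp (- t)) {0<..}"
    by (simp add: inj_on_def)
  have cov: "k absolutely_integrable_on {0<..} \<and> integral {0<..} k = b \<longleftrightarrow>
      h absolutely_integrable_on {0<..<1} \<and> integral {0<..<1} h = b" for b
    using has_absolute_integral_change_of_variables_real[OF _ der inj, of h b]
    by (simp add: img k_def[abs_def])
  show iff: "integrable unit_leb h \<longleftrightarrow> integrable pos (\<lambda>t. exp (- t) *\<^sub>R h (exp (- t)))"
    using h_abs(1) k_abs(1) cov by (auto simp: k_def[abs_def])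
  show "(LINT x|unit_leb. h x) = (LINT t|pos. exp (- t) *\<^sub>R h (exp (- t)))"
  proof (cases "integrable unit_leb h")
    case True
    then have a: "h absolutely_integrable_on {0<..<1}" "k absolutely_integrable_on {0<..}"
      using h_abs(1) k_abs(1) iff by (auto simp: k_def[abs_def])
    have "integral {0<..} k = integral {0<..<1} h"
      using cov[of "integral {0<..<1} h"] a by simp
    then show ?thesis
      using h_abs(2) k_abs(2) set_lebesgue_integral_eq_integral(2)[OF a(1)] set_lebesgue_integral_eq_integral(2)[OF a(2)]
      by (simp add: k_def[abs_def])
  next
    case False
    \<comment> \<open>Both integrals then take the default value 0 of non-integrable
      functions.\<close>
    then show ?thesis
      using iff by (simp add: not_integrable_integral_eq)
  qed
qed

text \<open>A representative that is Borel on the whole line makes f (exp (- t) * u) jointly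
  measurable in t and u, on which measurability of the approximation error rests.\<close>

lemma L2_borel_representative:
  assumes f: "f \<in> L2 pos"
  obtains g where "g \<in> L2 pos" "g \<in> borel_measurable borel" "AE t in pos. g t = f t"
proof -
  define g where "g t = indicator {0<..} t *\<^sub>R f t" for t
  have "g \<in> borel_measurable borel"
    using L2_measurable[OF f] unfolding g_def[abs_def] by (subst (asm) borel_measurable_restrict_space_iff) auto
  moreover have ae: "AE t in pos. g t = f t"
    by (intro AE_I2) (simp add: g_def space_restrict_space)
  moreover have "g \<in> L2 pos"
  proof (rule L2_cong_AE[OF f])
    show "g \<in> borel_measurable pos"
      using calculation(1) by (intro measurable_restrict_space1) simp
    show "AE t in pos. f t = g t"
      using ae by eventually_elim simp
  qed
  ultimately show ?thesis
    using that by blast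
qed

section \<open>Step approximation of the orbit under dilations\<close>

context cesaro
begin

definition flow_density :: "real \<Rightarrow> real" where
  "flow_density t = \<alpha> * (1 - exp (- t)) powr (\<alpha> - 1) * exp (- t / 2)"

lemma flow_density_nonneg: "0 \<le> flow_density t"
  using alpha by (simp add: flow_density_def)

lemma flow_density_measurable [measurable]: "flow_density \<in> borel_measurable borel"
  unfolding flow_density_def by measurable

text \<open>This is the Beta density of \<open>mass\<close> after x = exp (- t), with the Jacobian
  included.\<close>

lemma flow_density_integrable: "integrable pos flow_density"
proof -
  have "integrable unit_leb (\<lambda>x. \<alpha> * (1 - x) powr (\<alpha> - 1) * x powr (- 1 / 2))"
    by (rule q.integrable_mass)
  then have "integrable pos (\<lambda>t. exp (- t) *\<^sub>R (\<alpha> * (1 - exp (- t)) powr (\<alpha> - 1) * exp (- t) powr (- 1 / 2)))"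
    by (subst (asm) integral_unit_exp(1)) auto
  moreover have "exp (- t) *\<^sub>R (\<alpha> * (1 - exp (- t)) powr (\<alpha> - 1) * exp (- t) powr (- 1 / 2)) = flow_density t" for t
  proof -
    have "exp (- t) * exp (- t) powr (- 1 / 2) = exp (- t / 2)"
      by (simp add: exp_powr_real exp_add[symmetric])
    then show ?thesis
      by (simp add: flow_density_def mult_ac)
  qed
  ultimately show ?thesis by simp
qed

text \<open>For \<alpha> < 1 the power is singular at 0 but decreasing; for \<alpha> \<ge> 1 it is
  at most 1. The sum of the two bounds covers both cases and gives an integrable majorant for
  densities sampled at later times.\<close>

lemma flow_density_later_le:
  assumes "0 < t" "t \<le> r"
  shows "flow_density r \<le> flow_density t + \<alpha> * exp (- t / 2)"
proof -
  have e: "0 < 1 - exp (- t)" "1 - exp (- t) \<le> 1 - exp (- r)" "1 - exp (- r) \<le> 1"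
    using assms by auto
  have "(1 - exp (- r)) powr (\<alpha> - 1) \<le> (1 - exp (- t)) powr (\<alpha> - 1) + 1"
  proof (cases "1 \<le> \<alpha>")
    case True
    then have "(1 - exp (- r)) powr (\<alpha> - 1) \<le> 1 powr (\<alpha> - 1)"
      using e by (intro powr_mono2) auto
    then show ?thesis by (simp add: add_increasing)
  next
    case False
    then have "(1 - exp (- r)) powr (\<alpha> - 1) \<le> (1 - exp (- t)) powr (\<alpha> - 1)"
      using e by (intro powr_mono2') auto
    then show ?thesis by simp
  qed
  then have "\<alpha> * (1 - exp (- r)) powr (\<alpha> - 1) * exp (- r / 2) \<le> \<alpha> * ((1 - exp (- t)) powr (\<alpha> - 1) + 1) * exp (- t / 2)"
    using alpha assms by (intro mult_mono) auto
  then show ?thesis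
    by (simp add: flow_density_def algebra_simps)
qed

text \<open>Rounds up, strictly, to a multiple of 1 / (n + 1). Sampling at a later time keeps away
  from the singularity of the density at 0 and fits \<open>flow_density_later_le\<close>.\<close>

definition grid :: "nat \<Rightarrow> real \<Rightarrow> real" where
  "grid n t = (real_of_int \<lfloor>real (Suc n) * t\<rfloor> + 1) / real (Suc n)"

lemma grid_bounds: "t < grid n t" "grid n t \<le> t + 1 / real (Suc n)"
proof -
  have "real (Suc n) * t < real_of_int \<lfloor>real (Suc n) * t\<rfloor> + 1"
    by linarith
  then show "t < grid n t"
    unfolding grid_def by (subst pos_less_divide_eq) (auto simp: mult.commute)
  have "real_of_int \<lfloor>real (Suc n) * t\<rfloor> + 1 \<le> real (Suc n) * t + 1"
    by linarith
  then have "grid n t \<le> (real (Suc n) * t + 1) / real (Suc n)"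
    unfolding grid_def by (intro divide_right_mono) auto
  then show "grid n t \<le> t + 1 / real (Suc n)"
    by (simp add: add_divide_distrib)
qed

lemma grid_tendsto: "(\<lambda>n. grid n t) \<longlonglongrightarrow> t"
proof (rule tendsto_sandwich[where f = "\<lambda>_. t" and h = "\<lambda>n. t + 1 / real (Suc n)"])
  show "(\<lambda>n. t + 1 / real (Suc n)) \<longlonglongrightarrow> t"
    using tendsto_add[OF tendsto_const LIMSEQ_Suc[OF lim_1_over_n], of t] by simp
  show "eventually (\<lambda>n. t \<le> grid n t) sequentially"
    using grid_bounds(1) by (intro always_eventually allI less_imp_le)
  show "eventually (\<lambda>n. grid n t \<le> t + 1 / real (Suc n)) sequentially"
    by (intro always_eventually allI grid_bounds)
qed simp

definition flow :: "(real \<Rightarrow> complex) \<Rightarrow> real \<Rightarrow> real \<Rightarrow> complex" where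
  "flow f t u = of_real (flow_density t) * dil t f u"

text \<open>The cut-off leaves finitely many grid values and a support of finite measure, as a
  simple Bochner integrable function requires.\<close>

definition step :: "(real \<Rightarrow> complex) \<Rightarrow> nat \<Rightarrow> real \<Rightarrow> real \<Rightarrow> complex" where
  "step f n t u = (if t < real (Suc n) then flow f (grid n t) u else 0)"

lemma flow_L2: "f \<in> L2 pos \<Longrightarrow> flow f t \<in> L2 pos"
  unfolding flow_def[abs_def] by (intro L2_scale dil_L2)

lemma flow_norm: "f \<in> L2 pos \<Longrightarrow> l2_norm pos (flow f t) = flow_density t * l2_norm pos f"
  unfolding flow_def[abs_def] by (simp add: l2_norm_scale dil_L2 flow_density_nonneg)

lemma step_L2: "f \<in> L2 pos \<Longrightarrow> step f n t \<in> L2 pos"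
  unfolding step_def[abs_def] by (cases "t < real (Suc n)") (simp_all add: flow_L2 flip: eta_contract_eq)

lemma laplace_flow:
  "laplace (flow f t) = (\<lambda>z. (\<alpha> * (1 - exp (- t)) powr (\<alpha> - 1) * exp (- t / 2)) *\<^sub>R dilation (- t) (laplace f) z)"
proof
  fix z
  have "laplace (flow f t) z = of_real (flow_density t) * laplace (dil t f) z"
    by (cases "0 < Re z") (simp_all add: laplace_eq laplace_outside flow_def mult.assoc)
  then show "laplace (flow f t) z = (\<alpha> * (1 - exp (- t)) powr (\<alpha> - 1) * exp (- t / 2)) *\<^sub>R dilation (- t) (laplace f) z"
    by (simp add: laplace_dil flow_density_def scaleR_conv_of_real)
qed

text \<open>The half powers exp (- t / 2) of the density and exp (t / 2) of the dilation cancel.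
  What remains is the integrand of the family with m x = 1 / x at x = exp (- t), together with the
  Jacobian.\<close>

lemma flow_integral:
  assumes f: "f \<in> L2 pos"
  shows "integrable pos (\<lambda>t. laplace (flow f t) w)" "(LINT t|pos. laplace (flow f t) w) = p.transform f w"
proof -
  have "integrable pos (\<lambda>t. laplace (flow f t) w) \<and> (LINT t|pos. laplace (flow f t) w) = p.transform f w"
  proof (cases "0 < Re w")
    case True
    define h where "h x = of_real (p.weight x) * laplace f (w * of_real (p.rate x))" for x
    have h: "integrable unit_leb h" "p.transform f w = (LINT x|unit_leb. h x)"
      using p.avg_integral[OF f True] True by (auto simp: h_def[abs_def] p.transform_eq)
    have eq: "exp (- t) *\<^sub>R h (exp (- t)) = laplace (flow f t) w" for t
    proof -
      have "exp (- t / 2) * exp (t / 2) = 1"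
        by (simp add: exp_add[symmetric])
      then have "\<alpha> * (1 - exp (- t)) powr (\<alpha> - 1) * exp (- t / 2) * exp (t / 2) = \<alpha> * (1 - exp (- t)) powr (\<alpha> - 1)"
        by (simp add: mult.assoc)
      then have "laplace (flow f t) w = of_real (\<alpha> * (1 - exp (- t)) powr (\<alpha> - 1)) * laplace f (exp t *\<^sub>R w)"
        by (simp only: laplace_flow dilation_def scaleR_scaleR minus_minus) (simp add: scaleR_conv_of_real)
      moreover have "h (exp (- t)) = of_real (\<alpha> * (1 - exp (- t)) powr (\<alpha> - 1) / exp (- t)) * laplace f (exp t *\<^sub>R w)"
      proof -
        have "1 / exp (- t) = exp t"
          by (simp add: exp_minus field_simps)
        then have "p.rate (exp (- t)) = exp t"
          by (simp only: p_rate[OF exp_gt_zero])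
        then show ?thesis
          by (simp add: h_def p_weight scaleR_conv_of_real mult.commute[of w])
      qed
      ultimately show ?thesis
        by (simp add: scaleR_conv_of_real)
    qed
    show ?thesis
      using integral_unit_exp[OF borel_measurable_integrable[OF h(1)]] h by (simp add: eq)
  qed (simp add: laplace_outside p.transform_outside)
  then show "integrable pos (\<lambda>t. laplace (flow f t) w)" "(LINT t|pos. laplace (flow f t) w) = p.transform f w"
    by auto
qed

definition step_error :: "(real \<Rightarrow> complex) \<Rightarrow> nat \<Rightarrow> real \<Rightarrow> real" where
  "step_error f n t = l2_norm pos (\<lambda>u. flow f t u - step f n t u)"

lemma hardy_norm_step_error:
  assumes f: "f \<in> L2 pos"
  shows "(\<lambda>z. laplace (flow f t) z - laplace (step f n t) z) \<in> hardy"
    "hardy_norm (\<lambda>z. laplace (flow f t) z - laplace (step f n t) z) = step_error f n t"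
proof -
  have eq: "(\<lambda>z. laplace (flow f t) z - laplace (step f n t) z) = laplace (\<lambda>u. flow f t u - step f n t u)"
    using laplace_lincomb[OF flow_L2[OF f] step_L2[OF f], of 1 t "-1" n t] by (simp add: fun_eq_iff)
  show "(\<lambda>z. laplace (flow f t) z - laplace (step f n t) z) \<in> hardy"
    "hardy_norm (\<lambda>z. laplace (flow f t) z - laplace (step f n t) z) = step_error f n t"
    unfolding eq step_error_def using f
    by (auto intro!: laplace_in_hardy hardy_norm_laplace L2_diff flow_L2 step_L2)
qed

lemma step_error_measurable:
  assumes f: "f \<in> borel_measurable borel"
  shows "step_error f n \<in> borel_measurable pos"
proof -
  have [measurable]: "f \<in> borel_measurable borel" by fact
  have [measurable]: "(\<lambda>p. snd p) \<in> borel_measurable (lborel \<Otimes>\<^sub>M pos)"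
    by (rule measurable_compose[OF measurable_snd measurable_leb_id])
  have "(\<lambda>(t, u). (cmod (flow f t u - step f n t u))\<^sup>2) \<in> borel_measurable (lborel \<Otimes>\<^sub>M pos)"
    unfolding flow_def step_def dil_def grid_def flow_density_def case_prod_beta' by measurable
  then have "(\<lambda>t. LINT u|pos. (cmod (flow f t u - step f n t u))\<^sup>2) \<in> borel_measurable lborel"
    by (rule pos.borel_measurable_lebesgue_integral)
  then have "step_error f n \<in> borel_measurable lborel"
    unfolding step_error_def l2_norm_def
    by (rule borel_measurable_continuous_on[where f = sqrt, rotated]) (intro continuous_intros)
  then show ?thesis
    by (rule measurable_restrict_space1)
qed

lemma step_error_bound:
  assumes f: "f \<in> L2 pos" and t: "0 < t"
  shows "step_error f n t \<le> (2 * flow_density t + \<alpha> * exp (- t / 2)) * l2_norm pos f"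
proof -
  have "l2_norm pos (step f n t) \<le> (flow_density t + \<alpha> * exp (- t / 2)) * l2_norm pos f"
  proof (cases "t < real (Suc n)")
    case True
    then have "step f n t = flow f (grid n t)"
      by (simp add: step_def fun_eq_iff)
    then show ?thesis
      using flow_density_later_le[OF t less_imp_le[OF grid_bounds(1)], of n] by (simp add: flow_norm[OF f] mult_right_mono)
  next
    case False
    then have "step f n t = (\<lambda>_. 0)"
      by (simp add: step_def fun_eq_iff)
    then show ?thesis
      using flow_density_nonneg[of t] alpha by simp
  qed
  moreover have "step_error f n t \<le> l2_norm pos (flow f t) + l2_norm pos (step f n t)"
    using l2_norm_triangle_diff[OF flow_L2[OF f] L2_zero step_L2[OF f], of t n t]
      l2_norm_scale[of pos "-1" "step f n t"] by (simp add: step_error_def)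
  ultimately show ?thesis
    by (simp add: flow_norm[OF f] algebra_simps)
qed

lemma step_error_tendsto:
  assumes f: "f \<in> L2 pos" and t: "0 < t"
  shows "(\<lambda>n. step_error f n t) \<longlonglongrightarrow> 0"
proof (rule Lim_null_comparison)
  show "eventually (\<lambda>n. norm (step_error f n t) \<le> flow_density t * l2_norm pos (\<lambda>u. dil (grid n t) f u - dil t f u)
      + \<bar>flow_density t - flow_density (grid n t)\<bar> * l2_norm pos f) sequentially"
    using eventually_gt_at_top[of "nat \<lceil>t\<rceil>"]
  proof eventually_elim
    case (elim n)
    \<comment> \<open>From here on the cut-off is inactive, and the error splits into a change of
      the dilated vector and a change of the density.\<close>
    then have "t < real (Suc n)" by linarith
    then have "(\<lambda>u. flow f t u - step f n t u)
        = (\<lambda>u. of_real (flow_density t) * (dil t f u - dil (grid n t) f u)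
          + of_real (flow_density t - flow_density (grid n t)) * dil (grid n t) f u)"
      by (simp add: step_def flow_def fun_eq_iff algebra_simps)
    then have "step_error f n t \<le> l2_norm pos (\<lambda>u. of_real (flow_density t) * (dil t f u - dil (grid n t) f u))
        + l2_norm pos (\<lambda>u. of_real (flow_density t - flow_density (grid n t)) * dil (grid n t) f u)"
      unfolding step_error_def by (simp only:) (intro l2_norm_triangle L2_scale L2_diff dil_L2 f)
    also have "\<dots> = flow_density t * l2_norm pos (\<lambda>u. dil (grid n t) f u - dil t f u)
        + \<bar>flow_density t - flow_density (grid n t)\<bar> * l2_norm pos f"
      unfolding l2_norm_scale dil_L2(2)[OF f] norm_of_real
      by (simp add: flow_density_nonneg l2_norm_minus_commute[of pos "dil t f"])
    finally show ?case
      by (simp add: step_error_def)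
  qed
  have "(\<lambda>n. flow_density (grid n t)) \<longlonglongrightarrow> flow_density t"
    unfolding flow_density_def using t by (intro tendsto_intros grid_tendsto) auto
  then have "(\<lambda>n. flow_density t * l2_norm pos (\<lambda>u. dil (grid n t) f u - dil t f u)
      + \<bar>flow_density t - flow_density (grid n t)\<bar> * l2_norm pos f) \<longlonglongrightarrow> flow_density t * 0 + \<bar>flow_density t - flow_density t\<bar> * l2_norm pos f"
    by (intro tendsto_intros dil_continuous[OF f] grid_tendsto)
  then show "(\<lambda>n. flow_density t * l2_norm pos (\<lambda>u. dil (grid n t) f u - dil t f u)
      + \<bar>flow_density t - flow_density (grid n t)\<bar> * l2_norm pos f) \<longlonglongrightarrow> 0"
    by simp
qed

lemma step_error_integral_tendsto:
  assumes f: "f \<in> L2 pos" "f \<in> borel_measurable borel"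
  shows "integrable pos (step_error f n)" "(\<lambda>n. LINT t|pos. step_error f n t) \<longlonglongrightarrow> 0"
proof -
  define D where "D t = (2 * flow_density t + \<alpha> * exp (- t / 2)) * l2_norm pos f" for t
  have D: "integrable pos D"
    unfolding D_def using flow_density_integrable has_bochner_integral_exp_pos[of "1/2"]
    by (intro integrable_mult_left Bochner_Integration.integrable_add integrable_mult_right) (auto simp: has_bochner_integral_iff)
  have ae: "AE t in pos. norm (step_error f n t) \<le> D t" for n
    using step_error_bound[OF f(1)]
    by (intro AE_I2) (simp add: D_def space_restrict_space step_error_def)
  show "integrable pos (step_error f n)" for n
  proof (rule Bochner_Integration.integrable_bound[OF D step_error_measurable[OF f(2)]])
    show "AE t in pos. norm (step_error f n t) \<le> norm (D t)"
      using ae[of n] by eventually_elim simp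
  qed
  have "(\<lambda>n. LINT t|pos. step_error f n t) \<longlonglongrightarrow> (LINT t|pos. 0)"
  proof (rule integral_dominated_convergence[where w = D])
    show "AE t in pos. (\<lambda>n. step_error f n t) \<longlonglongrightarrow> 0"
      using step_error_tendsto[OF f(1)] by (intro AE_I2) (simp add: space_restrict_space)
  qed (use D ae step_error_measurable[OF f(2)] in simp_all)
  then show "(\<lambda>n. LINT t|pos. step_error f n t) \<longlonglongrightarrow> 0"
    by simp
qed

lemma step_simple:
  assumes f: "f \<in> L2 pos"
  shows "simple_bochner_integrable_in pos hardy (\<lambda>t. laplace (step f n t))"
  unfolding simple_bochner_integrable_in_def
proof (intro conjI)
  define m where "m = real (Suc n)"
  have m: "m > 0" by (simp add: m_def)
  \<comment> \<open>The step function factors through the index of the grid cell, so that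
    measurability is checked for a real-valued function of finite range. The index -1 stands for the
    region beyond the cut-off; genuine cells have non-negative indices.\<close>
  define \<kappa> where "\<kappa> t = (if t < m then real_of_int \<lfloor>m * t\<rfloor> else - 1)" for t
  define g where "g r = (if r = - 1 then laplace (\<lambda>_. 0) else laplace (flow f ((r + 1) / m)))" for r :: real
  have step_eq: "laplace (step f n t) = (g \<circ> \<kappa>) t" if "t \<in> space pos" for t
  proof (cases "t < m")
    case True
    have "0 \<le> \<lfloor>m * t\<rfloor>" using that m by (simp add: space_restrict_space)
    then have "real_of_int \<lfloor>m * t\<rfloor> \<noteq> - 1" by linarith
    moreover have "step f n t = flow f (grid n t)"
      using True by (simp add: step_def m_def fun_eq_iff)
    moreover have "grid n t = (real_of_int \<lfloor>m * t\<rfloor> + 1) / m"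
      by (simp only: grid_def m_def)
    ultimately show ?thesis
      using True by (simp add: \<kappa>_def g_def)
  next
    case False
    then have "step f n t = (\<lambda>_. 0)"
      by (simp add: step_def m_def fun_eq_iff)
    then show ?thesis
      using False by (simp add: \<kappa>_def g_def)
  qed
  have "simple_function pos \<kappa>"
  proof (rule simple_function_borel_measurable)
    show "\<kappa> \<in> borel_measurable pos"
      unfolding \<kappa>_def by (intro measurable_restrict_space1) measurable
    have "\<kappa> ` space pos \<subseteq> real_of_int ` {- 1..\<lfloor>m * m\<rfloor>}"
    proof
      fix r assume "r \<in> \<kappa> ` space pos"
      then obtain t where t: "0 < t" "r = \<kappa> t" by (auto simp: space_restrict_space)
      show "r \<in> real_of_int ` {- 1..\<lfloor>m * m\<rfloor>}"
      proof (cases "t < m")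
        case True
        have "0 \<le> m * t" "\<lfloor>m * t\<rfloor> \<le> \<lfloor>m * m\<rfloor>"
          using t m True by (auto intro!: floor_mono mult_left_mono)
        then have "- 1 \<le> \<lfloor>m * t\<rfloor>" "\<lfloor>m * t\<rfloor> \<le> \<lfloor>m * m\<rfloor>"
          by linarith+
        then show ?thesis
          using t True by (intro image_eqI[of _ _ "\<lfloor>m * t\<rfloor>"]) (auto simp: \<kappa>_def)
      next
        case False
        have "0 \<le> m * m" using m by simp
        then have "- 1 \<le> \<lfloor>m * m\<rfloor>" by linarith
        then show ?thesis
          using t False by (intro image_eqI[of _ _ "- 1"]) (auto simp: \<kappa>_def)
      qed
    qed
    then show "finite (\<kappa> ` space pos)"
      by (rule finite_subset) simp
  qed
  then have "simple_function pos (g \<circ> \<kappa>)"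
    by (rule simple_function_compose)
  then show "simple_function pos (\<lambda>t. laplace (step f n t))"
    using simple_function_cong[of pos "\<lambda>t. laplace (step f n t)" "g \<circ> \<kappa>", OF step_eq] by simp
  show "(\<lambda>t. laplace (step f n t)) ` space pos \<subseteq> hardy"
    using laplace_in_hardy(1)[OF step_L2[OF f]] by auto
  have zero: "laplace (\<lambda>_. 0) = (\<lambda>_. 0)"
    by (simp add: laplace_def zero_ext_def)
  have "{t \<in> space pos. laplace (step f n t) \<noteq> (\<lambda>_. 0)} \<subseteq> {0<..<m}"
    by (auto simp: space_restrict_space step_def[abs_def] zero m_def split: if_splits)
  moreover have "{0<..<m} \<in> sets pos"
    by (subst sets_restrict_space_iff) auto
  ultimately have "emeasure pos {t \<in> space pos. laplace (step f n t) \<noteq> (\<lambda>_. 0)} \<le> emeasure pos {0<..<m}"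
    by (rule emeasure_mono)
  also have "\<dots> = emeasure lborel {0<..<m}"
    by (subst emeasure_restrict_space) auto
  also have "\<dots> < \<infinity>" using m by simp
  finally show "emeasure pos {t \<in> space pos. laplace (step f n t) \<noteq> (\<lambda>_. 0)} \<noteq> \<infinity>"
    by simp
qed

text \<open>The pointwise integral is the only candidate. \<open>hardy_mean\<close> is applied
  twice: to the flow, for membership of the candidate, and to the difference of flow and step
  function, which bounds the error of the simple integrals by the integral of
  \<open>step_error\<close>.\<close>

lemma flow_has_bochner_integral:
  assumes f: "f \<in> L2 pos" and borel: "f \<in> borel_measurable borel"
  shows "has_bochner_integral_in pos hardy hardy_norm (\<lambda>t. laplace (flow f t)) (p.transform f)"
proof -
  have flow_hardy: "laplace (flow f t) \<in> hardy" for t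
    by (intro laplace_in_hardy flow_L2 f)
  have G: "p.transform f \<in> hardy"
  proof -
    have norm: "hardy_norm (laplace (flow f t)) = flow_density t * l2_norm pos f" for t
      using f by (simp add: hardy_norm_laplace flow_L2 flow_norm)
    have int: "integrable pos (\<lambda>t. flow_density t * l2_norm pos f)"
      using flow_density_integrable by simp
    have "(\<lambda>w. LINT t|pos. laplace (flow f t) w) \<in> hardy"
    proof (rule hardy_mean(1)[where C = "LINT t|pos. flow_density t * l2_norm pos f"])
      show "(\<lambda>t. hardy_norm (laplace (flow f t))) \<in> borel_measurable pos"
        unfolding norm using int by (rule borel_measurable_integrable)
      show "(\<integral>\<^sup>+t. ennreal (hardy_norm (laplace (flow f t))) \<partial>pos) \<le> ennreal (LINT t|pos. flow_density t * l2_norm pos f)"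
        unfolding norm using int flow_density_nonneg by (subst nn_integral_eq_integral) auto
      show "0 \<le> (LINT t|pos. flow_density t * l2_norm pos f)"
        using flow_density_nonneg by (intro Bochner_Integration.integral_nonneg) auto
    qed (auto intro: flow_hardy flow_integral(1)[OF f])
    then show ?thesis
      by (simp add: flow_integral(2)[OF f])
  qed
  have nn: "(\<integral>\<^sup>+ t. ennreal (step_error f n t) \<partial>pos) = ennreal (LINT t|pos. step_error f n t)" for n
    by (rule nn_integral_eq_integral[OF step_error_integral_tendsto(1)[OF f borel]]) (simp add: step_error_def)
  have err: "hardy_norm (\<lambda>z. simple_bochner_integral_in pos (\<lambda>t. laplace (step f n t)) z - p.transform f z)
      \<in> {0..LINT t|pos. step_error f n t}" for n
  proof -
    note S = simple_bochner_integral_in_eq[OF step_simple[OF f, of n]]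
    define \<psi> where "\<psi> t w = laplace (flow f t) w - laplace (step f n t) w" for t w
    have norm: "hardy_norm (\<psi> t) = step_error f n t" for t
      unfolding \<psi>_def by (rule hardy_norm_step_error(2)[OF f])
    have a: "\<psi> t \<in> hardy" for t
      unfolding \<psi>_def by (rule hardy_norm_step_error(1)[OF f])
    have b: "integrable pos (\<lambda>t. \<psi> t w)" for w
      unfolding \<psi>_def by (intro Bochner_Integration.integrable_diff flow_integral(1) f S(2))
    have c: "(\<lambda>t. hardy_norm (\<psi> t)) \<in> borel_measurable pos"
      unfolding norm by (rule step_error_measurable[OF borel])
    have d: "(\<integral>\<^sup>+ t. ennreal (hardy_norm (\<psi> t)) \<partial>pos) \<le> ennreal (LINT t|pos. step_error f n t)"
      unfolding norm nn by simp
    have e: "0 \<le> (LINT t|pos. step_error f n t)"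
      by (intro Bochner_Integration.integral_nonneg) (simp add: step_error_def)
    have "(LINT t|pos. \<psi> t w) = p.transform f w - simple_bochner_integral_in pos (\<lambda>t. laplace (step f n t)) w" for w
      by (simp add: \<psi>_def Bochner_Integration.integral_diff[OF flow_integral(1)[OF f] S(2)] flow_integral(2)[OF f] S(1))
    then show ?thesis
      using hardy_mean[of \<psi>, OF a b c d e] hardy_norm_nonneg[OF hardy_mean(1)[of \<psi>, OF a b c d e]]
      by (simp add: hardy_norm_minus_commute[of "p.transform f"])
  qed
  show ?thesis
    unfolding has_bochner_integral_in_def
  proof (intro conjI exI[of _ "\<lambda>n t. laplace (step f n t)"] ballI allI)
    show "laplace (flow f t) \<in> hardy" for t by (rule flow_hardy)
    show "p.transform f \<in> hardy" by (rule G)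
    show "simple_bochner_integrable_in pos hardy (\<lambda>t. laplace (step f n t))" for n by (rule step_simple[OF f])
    show "(\<lambda>t. hardy_norm (\<lambda>z. laplace (flow f t) z - laplace (step f n t) z)) \<in> borel_measurable pos" for n
      unfolding hardy_norm_step_error(2)[OF f] by (rule step_error_measurable[OF borel])
    show "(\<lambda>n. \<integral>\<^sup>+ t. ennreal (hardy_norm (\<lambda>z. laplace (flow f t) z - laplace (step f n t) z)) \<partial>pos) \<longlonglongrightarrow> 0"
      unfolding hardy_norm_step_error(2)[OF f] nn
      using tendsto_ennrealI[OF step_error_integral_tendsto(2)[OF f borel]] by simp
    show "(\<lambda>n. hardy_norm (\<lambda>z. simple_bochner_integral_in pos (\<lambda>t. laplace (step f n t)) z - p.transform f z)) \<longlonglongrightarrow> 0"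
    proof (rule Lim_null_comparison[OF _ step_error_integral_tendsto(2)[OF f borel]])
      show "eventually (\<lambda>n. norm (hardy_norm (\<lambda>z. simple_bochner_integral_in pos (\<lambda>t. laplace (step f n t)) z - p.transform f z))
          \<le> (LINT t|pos. step_error f n t)) sequentially"
        using err by (intro always_eventually allI) simp
    qed
  qed
qed

text \<open>Point evaluations determine any Bochner integral, so the definite description is met by
  the transform alone. Both sides depend only on the class of f, which permits a Borel
  representative.\<close>

theorem cesaro_star_hardy_laplace:
  assumes f: "f \<in> L2 pos"
  shows "cesaro_star_hardy \<alpha> (laplace f) = p.transform f"
proof -
  obtain g where g: "g \<in> L2 pos" "g \<in> borel_measurable borel" "AE t in pos. g t = f t"
    by (rule L2_borel_representative[OF f])
  have lap: "laplace g = laplace f"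
    using g f by (intro laplace_cong_AE L2_measurable)
  have tr: "p.transform g = p.transform f"
    using g f by (intro p.transform_cong_AE)
  have "(THE G. has_bochner_integral_in pos hardy hardy_norm (\<lambda>t. laplace (flow g t)) G) = p.transform g"
  proof (rule the_equality)
    show "has_bochner_integral_in pos hardy hardy_norm (\<lambda>t. laplace (flow g t)) (p.transform g)"
      by (rule flow_has_bochner_integral[OF g(1,2)])
    fix G assume G: "has_bochner_integral_in pos hardy hardy_norm (\<lambda>t. laplace (flow g t)) G"
    then have "G \<in> hardy" by (simp add: has_bochner_integral_in_def)
    show "G = p.transform g"
    proof
      fix w
      show "G w = p.transform g w"
      proof (cases "0 < Re w")
        case True
        then show ?thesis
          using has_bochner_integral_in_hardy_eval[OF G flow_integral(1)[OF g(1)] True] flow_integral(2)[OF g(1)] by simp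
      next
        case False
        then show ?thesis
          using hardy_outside[OF \<open>G \<in> hardy\<close>] by (simp add: p.transform_outside)
      qed
    qed
  qed
  then show ?thesis
    unfolding cesaro_star_hardy_def bochner_integral_in_def by (simp only: laplace_flow lap tr)
qed

end

section \<open>The Hilbert space and the isomorphism\<close>

lemma L2_pos_eq: "L2_pos = L2 pos"
  by (auto simp: L2_pos_def L2_def set_borel_measurable_leb set_integrable_leb)

lemma L2_pos_norm_eq: "L2_pos_norm = l2_norm pos"
  by (simp add: L2_pos_norm_def l2_norm_def set_integral_leb fun_eq_iff)

lemma ae_eq_pos_iff: "ae_eq_pos f g \<longleftrightarrow> (AE t in pos. f t = g t)"
  by (simp add: ae_eq_pos_def AE_pos_iff)

lemma hardy_eq_laplace_image: "hardy = laplace ` L2 pos"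
proof (intro equalityI subsetI)
  fix F assume "F \<in> hardy"
  then obtain f where "f \<in> L2 pos" "laplace f = F" by (rule paley_wiener)
  then show "F \<in> laplace ` L2 pos" by blast
next
  fix F assume "F \<in> laplace ` L2 pos"
  then show "F \<in> hardy" using laplace_in_hardy(1) by blast
qed

context cesaro
begin

lemma hardy_sobolev_eq: "hardy_sobolev \<alpha> = p.transform ` L2 pos"
  unfolding hardy_sobolev_def hardy_eq_laplace_image image_image
  by (rule image_cong[OF refl cesaro_star_hardy_laplace])

text \<open>Makes \<open>inv_into\<close> in the norm and the inner product a genuine
  inverse.\<close>

lemma cesaro_star_hardy_inj: "inj_on (cesaro_star_hardy \<alpha>) hardy"
proof (rule inj_onI)
  fix F G assume F: "F \<in> hardy" and G: "G \<in> hardy" and eq: "cesaro_star_hardy \<alpha> F = cesaro_star_hardy \<alpha> G"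
  obtain f where f: "f \<in> L2 pos" "laplace f = F" by (rule paley_wiener[OF F])
  obtain g where g: "g \<in> L2 pos" "laplace g = G" by (rule paley_wiener[OF G])
  have "p.transform f = p.transform g"
    using eq f g cesaro_star_hardy_laplace[OF f(1)] cesaro_star_hardy_laplace[OF g(1)] by simp
  then have "AE t in pos. f t = g t"
    by (rule p_transform_inj[OF f(1) g(1)])
  then have "laplace f = laplace g"
    by (intro laplace_cong_AE L2_measurable f(1) g(1))
  then show "F = G"
    using f g by simp
qed

lemma inv_cesaro_star_hardy:
  assumes f: "f \<in> L2 pos"
  shows "inv_into hardy (cesaro_star_hardy \<alpha>) (p.transform f) = laplace f"
  using inv_into_f_f[OF cesaro_star_hardy_inj laplace_in_hardy(1)[OF f]] cesaro_star_hardy_laplace[OF f] by simp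

lemma hardy_sobolev_norm_transform:
  "f \<in> L2 pos \<Longrightarrow> hardy_sobolev_norm \<alpha> (p.transform f) = Gamma (\<alpha> + 1) * l2_norm pos f"
  by (simp add: hardy_sobolev_norm_def inv_cesaro_star_hardy hardy_norm_laplace)

lemma hardy_sobolev_inner_transform:
  "f \<in> L2 pos \<Longrightarrow> g \<in> L2 pos \<Longrightarrow>
    hardy_sobolev_inner \<alpha> (p.transform f) (p.transform g) = of_real ((Gamma (\<alpha> + 1))\<^sup>2) * l2_inner pos f g"
  by (simp add: hardy_sobolev_inner_def inv_cesaro_star_hardy hardy_inner_laplace)

lemma Gamma_pos: "0 < Gamma (\<alpha> + 1)"
  using alpha by (intro Gamma_real_pos) simp

lemma transform_lincomb_fun:
  assumes "f \<in> L2 pos" "g \<in> L2 pos"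
  shows "(\<lambda>z. a * p.transform f z + b * p.transform g z) = p.transform (\<lambda>t. a * f t + b * g t)"
  using p.transform_lincomb[OF assms] by (simp add: fun_eq_iff)

lemma transform_diff_fun:
  assumes "f \<in> L2 pos" "g \<in> L2 pos"
  shows "(\<lambda>z. p.transform f z - p.transform g z) = p.transform (\<lambda>t. f t - g t)"
  using transform_lincomb_fun[OF assms, of 1 "-1"] by simp

text \<open>All axioms are transported from the square-integrable functions along
  \<open>p.transform\<close>, which multiplies norms by \<open>Gamma (\<alpha> + 1)\<close>;
  completeness is Riesz-Fischer for the preimages of a Cauchy sequence.\<close>

lemma hardy_sobolev_hilbert:
  "hilbert_function_space right_half_plane
    (hardy_sobolev \<alpha>) (hardy_sobolev_norm \<alpha>) (hardy_sobolev_inner \<alpha>)"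
  unfolding hilbert_function_space_def hardy_sobolev_eq
proof (intro conjI ballI allI impI)
  show "F z = 0" if "F \<in> p.transform ` L2 pos" "z \<notin> right_half_plane" for F z
    using that by (auto simp: right_half_plane_def p.transform_outside)
  have "p.transform (\<lambda>_. 0) = (\<lambda>_. 0)"
    by (simp add: p.transform_def zero_ext_def)
  then show "(\<lambda>_. 0) \<in> p.transform ` L2 pos"
    using L2_zero by (metis imageI)
  show "(\<lambda>z. a * F z + b * G z) \<in> p.transform ` L2 pos"
    if "F \<in> p.transform ` L2 pos" "G \<in> p.transform ` L2 pos" for F G a b
    using that by (auto simp: transform_lincomb_fun intro!: imageI L2_lincomb)
  show "hardy_sobolev_inner \<alpha> (\<lambda>z. a * F z + b * G z) L = a * hardy_sobolev_inner \<alpha> F L + b * hardy_sobolev_inner \<alpha> G L"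
    if "F \<in> p.transform ` L2 pos" "G \<in> p.transform ` L2 pos" "L \<in> p.transform ` L2 pos" for F G L a b
    using that
    by (auto simp: transform_lincomb_fun hardy_sobolev_inner_transform L2_lincomb l2_inner_lincomb_left algebra_simps)
  show "hardy_sobolev_inner \<alpha> G F = cnj (hardy_sobolev_inner \<alpha> F G)"
    if "F \<in> p.transform ` L2 pos" "G \<in> p.transform ` L2 pos" for F G
    using that by (auto simp: hardy_sobolev_inner_transform l2_inner_cnj[symmetric])
  show "0 \<le> hardy_sobolev_norm \<alpha> F" if "F \<in> p.transform ` L2 pos" for F
    using that Gamma_pos by (auto simp: hardy_sobolev_norm_transform less_imp_le)
  show "hardy_sobolev_inner \<alpha> F F = complex_of_real ((hardy_sobolev_norm \<alpha> F)\<^sup>2)"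
    if "F \<in> p.transform ` L2 pos" for F
    using that
    by (auto simp: hardy_sobolev_inner_transform hardy_sobolev_norm_transform l2_inner_self power_mult_distrib)
  show "F = (\<lambda>_. 0)" if F: "F \<in> p.transform ` L2 pos" and zero: "hardy_sobolev_norm \<alpha> F = 0" for F
  proof -
    obtain f where f: "f \<in> L2 pos" "F = p.transform f" using F by blast
    then have "l2_norm pos f = 0"
      using zero Gamma_pos by (simp add: hardy_sobolev_norm_transform)
    then have "AE t in pos. f t = 0"
      using l2_norm_eq_0_iff[OF f(1)] by simp
    then have "p.transform f = p.transform (\<lambda>_. 0)"
      by (rule p.transform_cong_AE[OF f(1) L2_zero])
    then show ?thesis
      using f by (simp add: p.transform_def zero_ext_def)
  qed
  fix Q :: "nat \<Rightarrow> complex \<Rightarrow> complex"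
  assume Q: "(\<forall>n. Q n \<in> p.transform ` L2 pos) \<and>
    (\<forall>e>0. \<exists>n0. \<forall>m\<ge>n0. \<forall>n\<ge>n0. hardy_sobolev_norm \<alpha> (\<lambda>z. Q m z - Q n z) < e)"
  then have "\<forall>n. \<exists>h. h \<in> L2 pos \<and> Q n = p.transform h" by blast
  then obtain h where h: "\<And>n. h n \<in> L2 pos" "\<And>n. Q n = p.transform (h n)"
    by metis
  have norm_diff: "hardy_sobolev_norm \<alpha> (\<lambda>z. Q m z - p.transform g z) = Gamma (\<alpha> + 1) * l2_norm pos (\<lambda>t. h m t - g t)"
    if "g \<in> L2 pos" for m g
    using that by (simp add: h transform_diff_fun hardy_sobolev_norm_transform L2_diff)
  have "\<exists>N. \<forall>m\<ge>N. \<forall>n\<ge>N. l2_norm pos (\<lambda>t. h m t - h n t) < e" if "e > 0" for e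
  proof -
    have "0 < Gamma (\<alpha> + 1) * e" using that Gamma_pos by simp
    then obtain N where N: "\<And>m n. m \<ge> N \<Longrightarrow> n \<ge> N \<Longrightarrow> hardy_sobolev_norm \<alpha> (\<lambda>z. Q m z - Q n z) < Gamma (\<alpha> + 1) * e"
      using Q by blast
    then show ?thesis
      using Gamma_pos norm_diff[OF h(1)] by (intro exI[of _ N]) (simp add: h(2)[symmetric])
  qed
  then obtain g where g: "g \<in> L2 pos" "(\<lambda>n. l2_norm pos (\<lambda>t. h n t - g t)) \<longlonglongrightarrow> 0"
    using L2_complete[of h pos] h(1) by blast
  have "(\<lambda>n. hardy_sobolev_norm \<alpha> (\<lambda>z. Q n z - p.transform g z)) \<longlonglongrightarrow> 0"
    unfolding norm_diff[OF g(1)] using tendsto_mult_right_zero[OF g(2)] .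
  then show "\<exists>F\<in>p.transform ` L2 pos. (\<lambda>n. hardy_sobolev_norm \<alpha> (\<lambda>z. Q n z - F z)) \<longlonglongrightarrow> 0"
    using g(1) by blast
qed

text \<open>The weights of \<open>kernel\<close> carry \<alpha> where the theorem has 1 / Gamma
  \<alpha>; the functional equation Gamma (\<alpha> + 1) = \<alpha> * Gamma \<alpha> accounts for
  the quotient.\<close>

lemma hardy_sobolev_kernel_eq: "hardy_sobolev_kernel \<alpha> z w = kernel z w / of_real ((Gamma (\<alpha> + 1))\<^sup>2)"
proof -
  define c where "c = complex_of_real (Gamma \<alpha>)"
  have c: "c \<noteq> 0" using Gamma_real_pos[OF alpha] by (simp add: c_def)
  have Gamma: "complex_of_real (Gamma (\<alpha> + 1)) = of_real \<alpha> * c"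
  proof -
    have "\<alpha> \<notin> \<int>\<^sub>\<le>\<^sub>0"
      using alpha by (auto elim!: nonpos_Ints_cases)
    then show ?thesis
      by (simp add: c_def Gamma_plus1)
  qed
  have unit: "(LBINT x=0..1. g x) = (LINT x|unit_leb. g x)" for g :: "real \<Rightarrow> complex"
    by (simp add: interval_lebesgue_integral_def zero_ereal_def one_ereal_def set_integral_leb)
  define K where "K x y = 1 / (x *\<^sub>R z + y *\<^sub>R cnj w)" for x y :: real
  define I where "I x = (LINT y|unit_leb. complex_of_real ((1 - y) powr (\<alpha> - 1)) * K x y)" for x
  have "hardy_sobolev_kernel \<alpha> z w = (LINT x|unit_leb. LINT y|unit_leb.
      (complex_of_real ((1 - x) powr (\<alpha> - 1)) / (c * c)) * (complex_of_real ((1 - y) powr (\<alpha> - 1)) * K x y))"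
    by (simp add: hardy_sobolev_kernel_def unit K_def c_def mult_ac)
  also have "\<dots> = (LINT x|unit_leb. (1 / (c * c)) * (complex_of_real ((1 - x) powr (\<alpha> - 1)) * I x))"
    by (simp add: I_def)
  also have "\<dots> = (1 / (c * c)) * (LINT x|unit_leb. complex_of_real ((1 - x) powr (\<alpha> - 1)) * I x)"
    by (rule integral_mult_right_zero)
  finally have 1: "hardy_sobolev_kernel \<alpha> z w = (1 / (c * c)) * (LINT x|unit_leb. complex_of_real ((1 - x) powr (\<alpha> - 1)) * I x)" .
  have "(LINT y|unit_leb. of_real (\<alpha> * (1 - y) powr (\<alpha> - 1)) * (1 / (x *\<^sub>R z + y *\<^sub>R cnj w))) = of_real \<alpha> * I x" for x
    by (simp only: I_def K_def of_real_mult mult.assoc integral_mult_right_zero)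
  then have "kernel z w = (LINT x|unit_leb. (of_real \<alpha> * of_real \<alpha>) * (complex_of_real ((1 - x) powr (\<alpha> - 1)) * I x))"
    unfolding kernel_def by (simp add: mult_ac)
  also have "\<dots> = (of_real \<alpha> * of_real \<alpha>) * (LINT x|unit_leb. complex_of_real ((1 - x) powr (\<alpha> - 1)) * I x)"
    by (rule integral_mult_right_zero)
  finally show ?thesis
    unfolding 1 using c alpha by (simp add: Gamma power2_eq_square)
qed

text \<open>Evaluation of a transform at w is the pairing with \<open>p.avg (cnj w)\<close>. The
  transform of that vector is computed by \<open>p_inner\<close>, and the constant c undoes the
  square of Gamma in the inner product.\<close>

lemma hardy_sobolev_reproducing:
  "reproducing_kernel right_half_plane (hardy_sobolev \<alpha>) (hardy_sobolev_inner \<alpha>) (hardy_sobolev_kernel \<alpha>)"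
  unfolding reproducing_kernel_def hardy_sobolev_eq
proof (intro ballI conjI)
  fix w assume "w \<in> right_half_plane"
  then have w: "0 < Re w" by (simp add: right_half_plane_def)
  define c where "c = 1 / complex_of_real ((Gamma (\<alpha> + 1))\<^sup>2)"
  define k where "k s = c * p.avg (cnj w) s" for s
  have avg: "p.avg (cnj w) \<in> L2 pos" using w by (intro p.avg_L2) simp
  have k: "k \<in> L2 pos"
    unfolding k_def[abs_def] by (intro L2_scale avg)
  have K: "zero_ext right_half_plane (\<lambda>z. hardy_sobolev_kernel \<alpha> z w) = p.transform k"
  proof
    fix z
    show "zero_ext right_half_plane (\<lambda>z. hardy_sobolev_kernel \<alpha> z w) z = p.transform k z"
    proof (cases "0 < Re z")
      case True
      have "p.transform k z = c * l2_inner pos (p.avg z) (p.avg w)"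
      proof -
        have "(\<lambda>s. k s * p.avg z s) = (\<lambda>s. c * (p.avg z s * cnj (p.avg w s)))"
          by (simp add: fun_eq_iff k_def p.cnj_avg)
        then show ?thesis
          by (simp only: p.transform_eq[OF True] l2_inner_def integral_mult_right_zero)
      qed
      also have "\<dots> = hardy_sobolev_kernel \<alpha> z w"
        using True w by (simp add: p_inner hardy_sobolev_kernel_eq c_def)
      finally show ?thesis
        using True by (simp add: zero_ext_def right_half_plane_def)
    qed (simp add: zero_ext_def right_half_plane_def p.transform_outside)
  qed
  show "zero_ext right_half_plane (\<lambda>z. hardy_sobolev_kernel \<alpha> z w) \<in> p.transform ` L2 pos"
    unfolding K using k by blast
  fix F assume "F \<in> p.transform ` L2 pos"
  then obtain f where f: "f \<in> L2 pos" "F = p.transform f" by blast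
  have "hardy_sobolev_inner \<alpha> F (p.transform k) = of_real ((Gamma (\<alpha> + 1))\<^sup>2) * (cnj c * l2_inner pos f (p.avg (cnj w)))"
    unfolding f(2) hardy_sobolev_inner_transform[OF f(1) k] k_def l2_inner_scale_right ..
  also have "\<dots> = l2_inner pos f (p.avg (cnj w))"
    using Gamma_pos by (simp add: c_def)
  finally show "F w = hardy_sobolev_inner \<alpha> F (zero_ext right_half_plane (\<lambda>z. hardy_sobolev_kernel \<alpha> z w))"
    using w by (simp add: K f(2) p.transform_inner)
qed

lemma T2_space_iff:
  "f \<in> T2_space \<alpha> \<longleftrightarrow> f \<in> borel_measurable pos \<and> (\<exists>g\<in>L2 pos. AE t in pos. f t = cesaro_star_real \<alpha> g t)"
  by (simp add: T2_space_def L2_pos_eq ae_eq_pos_iff set_borel_measurable_leb)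

lemma laplace_T2:
  assumes f: "f \<in> borel_measurable pos" and g: "g \<in> L2 pos" and ae: "AE t in pos. f t = cesaro_star_real \<alpha> g t"
  shows "laplace f = q.transform g" "0 < Re w \<Longrightarrow> integrable pos (\<lambda>s. f s * expfun w s)"
proof -
  have "laplace f = laplace (cesaro_star_real \<alpha> g)"
    by (rule laplace_cong_AE[OF f cesaro_star_real_measurable[OF g] ae])
  also have "\<dots> = q.transform g"
  proof
    fix z
    show "laplace (cesaro_star_real \<alpha> g) z = q.transform g z"
      using laplace_cesaro_star_real(2)[OF g, of z] by (cases "0 < Re z") (auto simp: laplace_outside q.transform_outside)
  qed
  finally show "laplace f = q.transform g" .
  assume w: "0 < Re w"
  have "integrable pos (\<lambda>s. f s * expfun w s) \<longleftrightarrow> integrable pos (\<lambda>s. cesaro_star_real \<alpha> g s * expfun w s)"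
  proof (rule integrable_cong_AE)
    show "AE s in pos. f s * expfun w s = cesaro_star_real \<alpha> g s * expfun w s"
      using ae by eventually_elim simp
  qed (intro borel_measurable_times f cesaro_star_real_measurable g expfun_pos_measurable)+
  then show "integrable pos (\<lambda>s. f s * expfun w s)"
    using laplace_cesaro_star_real(1)[OF g w] by simp
qed

lemma T2_norm_laplace:
  assumes f: "f \<in> borel_measurable pos" and ex: "\<exists>g\<in>L2 pos. AE t in pos. f t = cesaro_star_real \<alpha> g t"
  obtains g h where "g \<in> L2 pos" "AE t in pos. f t = cesaro_star_real \<alpha> g t" "T2_norm \<alpha> f = Gamma (\<alpha> + 1) * l2_norm pos g"
    "h \<in> L2 pos" "laplace f = p.transform h" "l2_norm pos h = l2_norm pos g"
proof -
  \<comment> \<open>The preimage chosen in \<open>T2_norm\<close> itself, so that its norm is the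
    one to be compared.\<close>
  define g where "g = (SOME g. g \<in> L2_pos \<and> ae_eq_pos f (cesaro_star_real \<alpha> g))"
  have "\<exists>g. g \<in> L2_pos \<and> ae_eq_pos f (cesaro_star_real \<alpha> g)"
    using ex by (auto simp: L2_pos_eq ae_eq_pos_iff)
  then have "g \<in> L2_pos \<and> ae_eq_pos f (cesaro_star_real \<alpha> g)"
    unfolding g_def by (rule someI_ex)
  then have g: "g \<in> L2 pos" "AE t in pos. f t = cesaro_star_real \<alpha> g t"
    by (auto simp: L2_pos_eq ae_eq_pos_iff)
  \<comment> \<open>The operator on the half-line leads to the first family; the exchange passes to
    the second, in which the target space and its norm are expressed.\<close>
  obtain h where h: "h \<in> L2 pos" "p.transform h = q.transform g"
    using transform_exchange(1)[OF g(1)] by blast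
  show ?thesis
  proof (rule that[OF g _ h(1)])
    show "T2_norm \<alpha> f = Gamma (\<alpha> + 1) * l2_norm pos g"
      by (simp add: T2_norm_def g_def L2_pos_norm_eq)
    show "laplace f = p.transform h"
      using laplace_T2(1)[OF f g] h(2) by simp
    show "l2_norm pos h = l2_norm pos g"
      by (rule transform_norm_eq[OF g(1) h(1,2)])
  qed
qed

lemma laplace_isometric_isomorphism:
  "isometric_isomorphism (T2_space \<alpha>) ae_eq_pos (T2_norm \<alpha>)
    (hardy_sobolev \<alpha>) (hardy_sobolev_norm \<alpha>) laplace"
  unfolding isometric_isomorphism_def
proof (intro conjI ballI allI impI)
  show "laplace f = laplace g" if "f \<in> T2_space \<alpha>" "g \<in> T2_space \<alpha>" "ae_eq_pos f g" for f g
    using that by (intro laplace_cong_AE) (auto simp: T2_space_iff ae_eq_pos_iff)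
  show "hardy_sobolev_norm \<alpha> (laplace f) = T2_norm \<alpha> f" if f: "f \<in> T2_space \<alpha>" for f
  proof -
    obtain g h where "T2_norm \<alpha> f = Gamma (\<alpha> + 1) * l2_norm pos g"
      "h \<in> L2 pos" "laplace f = p.transform h" "l2_norm pos h = l2_norm pos g"
      by (rule T2_norm_laplace[of f]) (use f in \<open>auto simp: T2_space_iff\<close>)
    then show ?thesis
      by (simp add: hardy_sobolev_norm_transform)
  qed
  show "ae_eq_pos f g" if f: "f \<in> T2_space \<alpha>" and g: "g \<in> T2_space \<alpha>" and eq: "laplace f = laplace g" for f g
  proof -
    have int: "integrable pos (\<lambda>s. h s * expfun w s)" if "h \<in> T2_space \<alpha>" "0 < Re w" for h w
      using that laplace_T2(2) by (auto simp: T2_space_iff)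
    \<comment> \<open>Elements of the domain are controlled through their integrals against
      exponentials, hence Lerch's theorem in place of \<open>laplace_inj\<close>.\<close>
    have "AE t in pos. f t - g t = 0"
    proof (rule lerch)
      show "integrable pos (\<lambda>t. (f t - g t) * expfun 1 t)"
        using Bochner_Integration.integrable_diff[OF int[OF f, of 1] int[OF g, of 1]] by (simp add: left_diff_distrib)
      show "(LINT t|pos. (f t - g t) * expfun (of_nat n) t) = 0" if n: "n \<ge> 1" for n :: nat
      proof -
        have re: "0 < Re (of_nat n)" using n by simp
        have "(LINT t|pos. f t * expfun (of_nat n) t) = (LINT t|pos. g t * expfun (of_nat n) t)"
          using eq laplace_eq[OF re, of f] laplace_eq[OF re, of g] by simp
        then show ?thesis
          using Bochner_Integration.integral_diff[OF int[OF f re] int[OF g re]] by (simp add: left_diff_distrib)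
      qed
    qed
    then have "AE t in pos. f t = g t"
      by eventually_elim simp
    then show ?thesis by (simp add: ae_eq_pos_iff)
  qed
  fix f g :: "real \<Rightarrow> complex" and a b :: complex
  assume f: "f \<in> T2_space \<alpha>" and g: "g \<in> T2_space \<alpha>"
  obtain f' where f': "f' \<in> L2 pos" "AE t in pos. f t = cesaro_star_real \<alpha> f' t" and fm: "f \<in> borel_measurable pos"
    using f by (auto simp: T2_space_iff)
  obtain g' where g': "g' \<in> L2 pos" "AE t in pos. g t = cesaro_star_real \<alpha> g' t" and gm: "g \<in> borel_measurable pos"
    using g by (auto simp: T2_space_iff)
  \<comment> \<open>The combination of the preimages is a preimage of the combination, up to a null
    set.\<close>
  have ae: "AE t in pos. a * f t + b * g t = cesaro_star_real \<alpha> (\<lambda>t. a * f' t + b * g' t) t"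
    using f'(2) g'(2) cesaro_star_real_lincomb[OF f'(1) g'(1), of a b] by eventually_elim simp
  have m: "(\<lambda>t. a * f t + b * g t) \<in> borel_measurable pos"
    by (intro borel_measurable_add borel_measurable_times borel_measurable_const fm gm)
  show "(\<lambda>t. a * f t + b * g t) \<in> T2_space \<alpha>"
    using m ae L2_lincomb[OF f'(1) g'(1)] by (auto simp: T2_space_iff intro!: bexI)
  show "laplace (\<lambda>t. a * f t + b * g t) = (\<lambda>z. a * laplace f z + b * laplace g z)"
    using laplace_T2(1)[OF m L2_lincomb[OF f'(1) g'(1)] ae] laplace_T2(1)[OF fm f'] laplace_T2(1)[OF gm g']
      q.transform_lincomb[OF f'(1) g'(1)] by (simp add: fun_eq_iff)
next
  show "laplace ` T2_space \<alpha> = hardy_sobolev \<alpha>"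
    unfolding hardy_sobolev_eq
  proof (intro equalityI subsetI)
    fix F assume "F \<in> laplace ` T2_space \<alpha>"
    then obtain f where f: "f \<in> T2_space \<alpha>" "F = laplace f" by blast
    obtain h where "h \<in> L2 pos" "laplace f = p.transform h"
      by (rule T2_norm_laplace[of f]) (use f in \<open>auto simp: T2_space_iff\<close>)
    then show "F \<in> p.transform ` L2 pos" using f by blast
  next
    fix F assume "F \<in> p.transform ` L2 pos"
    then obtain h where h: "h \<in> L2 pos" "F = p.transform h" by blast
    \<comment> \<open>Surjectivity uses the exchange in the opposite direction: a preimage under the
      second transform yields one under the first, which factors through the operator on the
      half-line.\<close>
    obtain g where g: "g \<in> L2 pos" "q.transform g = p.transform h"
      using transform_exchange(2)[OF h(1)] by blast
    have "laplace (cesaro_star_real \<alpha> g) = q.transform g"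
      by (rule laplace_T2(1)[OF cesaro_star_real_measurable[OF g(1)] g(1)]) simp
    moreover have "cesaro_star_real \<alpha> g \<in> T2_space \<alpha>"
      using cesaro_star_real_measurable[OF g(1)] g(1) by (auto simp: T2_space_iff)
    ultimately show "F \<in> laplace ` T2_space \<alpha>"
      using h(2) g(2) by (metis imageI)
  qed
qed

end

theorem theorem6p2:
  fixes \<alpha> :: real
  assumes "0 < \<alpha>"
  shows "(hilbert_function_space right_half_plane
            (hardy_sobolev \<alpha>) (hardy_sobolev_norm \<alpha>) (hardy_sobolev_inner \<alpha>) \<and>
          reproducing_kernel right_half_plane
            (hardy_sobolev \<alpha>) (hardy_sobolev_inner \<alpha>) (hardy_sobolev_kernel \<alpha>)) \<and>
         isometric_isomorphism (T2_space \<alpha>) ae_eq_pos (T2_norm \<alpha>)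
            (hardy_sobolev \<alpha>) (hardy_sobolev_norm \<alpha>) laplace"
proof -
  interpret cesaro \<alpha>
    by (rule cesaro.intro) fact
  show ?thesis
    using hardy_sobolev_hilbert hardy_sobolev_reproducing laplace_isometric_isomorphism by blast
qed

end
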